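(* Let $G$ be a $\mathrm{CAT}(0)$ group with isolated flats, and let $H \triangleleft G$ be an infinite hyperbolic normal subgroup. Then the Cannon--Thurston map does not exist for $(H,G)$ with respect to their Morse boundaries.
   Context: An action is geometric if it is properly discontinuous, cocompact and by isometries. Isolated flats: a $k$-flat ($k\ge 2$) in a proper $\mathrm{CAT}(0)$ space $X$ is an isometrically embedded copy of $\mathbb{E}^k$. A $\mathrm{CAT}(0)$ space $X$ on which a group $G$ acts geometrically has the isolated flats property if $X$ is not quasi-isometric to any $\mathbb{E}^n$ and there is a non-empty $G$-invariant collection $\mathcal{F}$ of flats of dimension at least two such that (1) there is $D<\infty$ such that each flat in $X$ lies in the $D$-neighborhood of some $F\in\mathcal{F}$; and (2) for every $\rho<\infty$ there is $\kappa(\rho)<\infty$ such that $\operatorname{diam}(N_\rho(F)\cap N_\rho(F'))<\kappa(\rho)$ for any two distinct $F,F'\in\mathcal{F}$. A group is $\mathrm{CAT}(0)$ with isolated flats if it acts geometrically on a $\mathrm{CAT}(0)$ space with the isolated flats property. Morse boundary: let $X$ be a proper geodesic metric space. A geodesic ray $\gamma$ is $N$-Morse, for a function $N:[1,\infty)\times[0,\infty)\to[0,\infty)$, if every $(K,C)$-quasi-geodesic with endpoints on $\gamma$ lies in the $N(K,C)$-neighborhood of $\gamma$; it is Morse if it is $N$-Morse for some $N$. The Morse boundary $\partial_M X$ is the set of Morse geodesic rays from a basepoint $e\in X$ modulo bounded Hausdorff distance, topologized as the direct limit over all $N$ of the subspaces of classes of $N$-Morse rays based at $e$, each with the topology of uniform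 convergence on compact sets (compact-open topology). It is independent of basepoint and is a quasi-isometry invariant up to homeomorphism, so $\partial_M G$ is defined for a finitely generated group $G$; it coincides with the visual boundary if $X$ is hyperbolic. A sequence $x_i\in X$ converges to $\xi\in\partial_M X$ if $d(e,x_i)\to\infty$ and every subsequential limit (uniformly on compact sets) of geodesic segments $[e,x_i]$ is a Morse ray representing $\xi$ (for $\mathrm{CAT}(0)$ or hyperbolic $X$ this is convergence in $X\cup\partial X$ with the cone topology to a point represented by a Morse ray). Cannon--Thurston map for Morse boundaries: let $H\le G$ with $H$ acting geometrically on $Y$ and $G$ acting geometrically on $X$, where $X$ and $Y$ are proper geodesic metric spaces, and let $x\in X$, $y\in Y$. A Cannon--Thurston map for the pair $(H,G)$ with respect to their Morse boundaries is the map $f:\partial_M Y\to\partial_M X$ defined by $f(\lim_{i\to\infty}h_i\cdot y)=\lim_{i\to\infty}h_i\cdot x$ (for sequences $h_i\in H$ such that $h_i\cdot y$ converges to a point of $\partial_M Y$), provided $f$ is well-defined (the limit on the right exists in $\partial_M X$ and depends only on $\lim h_i\cdot y$) and continuous. *)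

theory Defs
  imports "HOL-Analysis.Analysis" "HOL-Algebra.Group_Action" "HOL-Algebra.Generated_Groups"
begin

section \<open>Metric notions\<close>

text \<open>Euclidean \<open>k\<close>-space for a variable \<open>k\<close>: the points of the library's
  \<^term>\<open>Euclidean_space k\<close> (real sequences vanishing from index \<open>k\<close> on) with
  the following distance.\<close>

definition euclid_dist :: "nat \<Rightarrow> (nat \<Rightarrow> real) \<Rightarrow> (nat \<Rightarrow> real) \<Rightarrow> real" where
  "euclid_dist k u v = L2_set (\<lambda>i. u i - v i) {..<k}"

definition quasi_isometry ::
  "'a set \<Rightarrow> ('a \<Rightarrow> 'a \<Rightarrow> real) \<Rightarrow> 'b set \<Rightarrow> ('b \<Rightarrow> 'b \<Rightarrow> real) \<Rightarrow> ('a \<Rightarrow> 'b) \<Rightarrow> bool" where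
  "quasi_isometry A dA B dB f \<longleftrightarrow> f ` A \<subseteq> B \<and>
     (\<exists>K C. K \<ge> 1 \<and> C \<ge> 0 \<and>
        (\<forall>p\<in>A. \<forall>q\<in>A. dA p q / K - C \<le> dB (f p) (f q) \<and> dB (f p) (f q) \<le> K * dA p q + C) \<and>
        (\<forall>b\<in>B. \<exists>p\<in>A. dB b (f p) \<le> C))"

definition gromov_product :: "('a \<Rightarrow> 'a \<Rightarrow> real) \<Rightarrow> 'a \<Rightarrow> 'a \<Rightarrow> 'a \<Rightarrow> real" where
  "gromov_product d w u v = (d w u + d w v - d u v) / 2"

definition gromov_hyperbolic :: "'a set \<Rightarrow> ('a \<Rightarrow> 'a \<Rightarrow> real) \<Rightarrow> bool" where
  "gromov_hyperbolic A d \<longleftrightarrow>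
     (\<exists>\<delta>. \<forall>w\<in>A. \<forall>p\<in>A. \<forall>q\<in>A. \<forall>r\<in>A.
        gromov_product d w p r \<ge> min (gromov_product d w p q) (gromov_product d w q r) - \<delta>)"

context Metric_space
begin

definition nbhd :: "real \<Rightarrow> 'a set \<Rightarrow> 'a set" where
  "nbhd r S = (\<Union>s\<in>S. mcball s r)"

definition diam :: "'a set \<Rightarrow> ennreal" where
  "diam S = (SUP (p, q)\<in>S \<times> S. ennreal (d p q))"

definition proper :: bool where
  "proper \<longleftrightarrow> (\<forall>p\<in>M. \<forall>r. compactin mtopology (mcball p r))"

definition geodesic_segment :: "(real \<Rightarrow> 'a) \<Rightarrow> 'a \<Rightarrow> 'a \<Rightarrow> bool" where
  "geodesic_segment c p q \<longleftrightarrow> c ` {0..d p q} \<subseteq> M \<and> c 0 = p \<and> c (d p q) = q \<and>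
     (\<forall>s\<in>{0..d p q}. \<forall>t\<in>{0..d p q}. d (c s) (c t) = \<bar>s - t\<bar>)"

definition geodesic_space :: bool where
  "geodesic_space \<longleftrightarrow> (\<forall>p\<in>M. \<forall>q\<in>M. \<exists>c. geodesic_segment c p q)"

text \<open>Any two sides of a geodesic triangle share a vertex \<open>p\<close>, and points on one and
  the same side satisfy the comparison inequality trivially; so it is imposed on points
  of the sides \<open>[p,q]\<close> and \<open>[p,r]\<close>, for all \<open>p, q, r\<close>. The third side exists
  in a geodesic space. Primed points form a comparison triangle in the plane.\<close>

definition cat0 :: bool where
  "cat0 \<longleftrightarrow> geodesic_space \<and>
     (\<forall>p\<in>M. \<forall>q\<in>M. \<forall>r\<in>M. \<forall>a b. geodesic_segment a p q \<and> geodesic_segment b p r \<longrightarrow>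
       (\<forall>s\<in>{0..d p q}. \<forall>t\<in>{0..d p r}. \<forall>p' q' r' u' v' :: real^2.
          dist p' q' = d p q \<and> dist p' r' = d p r \<and> dist q' r' = d q r \<and>
          u' \<in> closed_segment p' q' \<and> dist p' u' = s \<and>
          v' \<in> closed_segment p' r' \<and> dist p' v' = t
          \<longrightarrow> d (a s) (b t) \<le> dist u' v'))"


section \<open>Geometric actions and isolated flats\<close>

definition geometric_action :: "('g, 'm) monoid_scheme \<Rightarrow> ('g \<Rightarrow> 'a \<Rightarrow> 'a) \<Rightarrow> bool" where
  "geometric_action G \<phi> \<longleftrightarrow> group_action G M \<phi> \<and>
     (\<forall>g\<in>carrier G. \<forall>p\<in>M. \<forall>q\<in>M. d (\<phi> g p) (\<phi> g q) = d p q) \<and>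
     (\<forall>K. compactin mtopology K \<longrightarrow> finite {g \<in> carrier G. \<phi> g ` K \<inter> K \<noteq> {}}) \<and>
     (\<exists>K. compactin mtopology K \<and> (\<Union>g\<in>carrier G. \<phi> g ` K) = M)"

definition flat :: "'a set \<Rightarrow> bool" where
  "flat F \<longleftrightarrow> (\<exists>k\<ge>2. \<exists>f. f ` topspace (Euclidean_space k) = F \<and> F \<subseteq> M \<and>
     (\<forall>u\<in>topspace (Euclidean_space k). \<forall>v\<in>topspace (Euclidean_space k).
        d (f u) (f v) = euclid_dist k u v))"

definition isolated_flats :: "('g, 'm) monoid_scheme \<Rightarrow> ('g \<Rightarrow> 'a \<Rightarrow> 'a) \<Rightarrow> bool" where
  "isolated_flats G \<phi> \<longleftrightarrow>
     \<not> (\<exists>n f. quasi_isometry M d (topspace (Euclidean_space n)) (euclid_dist n) f) \<and>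
     (\<exists>\<F>. \<F> \<noteq> {} \<and> (\<forall>F\<in>\<F>. flat F) \<and> (\<forall>g\<in>carrier G. \<forall>F\<in>\<F>. \<phi> g ` F \<in> \<F>) \<and>
        (\<exists>D. \<forall>F'. flat F' \<longrightarrow> (\<exists>F\<in>\<F>. F' \<subseteq> nbhd D F)) \<and>
        (\<forall>\<rho>. \<exists>\<kappa>::real. \<forall>F\<in>\<F>. \<forall>F'\<in>\<F>. F \<noteq> F' \<longrightarrow> diam (nbhd \<rho> F \<inter> nbhd \<rho> F') < ennreal \<kappa>))"


section \<open>The Morse boundary\<close>

definition quasi_geodesic :: "real \<Rightarrow> real \<Rightarrow> real \<Rightarrow> real \<Rightarrow> (real \<Rightarrow> 'a) \<Rightarrow> bool" where
  "quasi_geodesic K C a b \<sigma> \<longleftrightarrow> a \<le> b \<and> \<sigma> ` {a..b} \<subseteq> M \<and>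
     (\<forall>s\<in>{a..b}. \<forall>t\<in>{a..b}.
        \<bar>s - t\<bar> / K - C \<le> d (\<sigma> s) (\<sigma> t) \<and> d (\<sigma> s) (\<sigma> t) \<le> K * \<bar>s - t\<bar> + C)"

text \<open>Rays are extensional functions, so that they are determined by their values on
  the half-line.\<close>

definition geodesic_rays :: "'a \<Rightarrow> (real \<Rightarrow> 'a) set" where
  "geodesic_rays e = {\<gamma> \<in> {0..} \<rightarrow>\<^sub>E M. \<gamma> 0 = e \<and> (\<forall>s\<ge>0. \<forall>t\<ge>0. d (\<gamma> s) (\<gamma> t) = \<bar>s - t\<bar>)}"

text \<open>Only the values of a gauge at \<open>K \<ge> 1\<close>, \<open>C \<ge> 0\<close> matter.\<close>

definition gauge_fun :: "(real \<Rightarrow> real \<Rightarrow> real) \<Rightarrow> bool" where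
  "gauge_fun N \<longleftrightarrow> (\<forall>K\<ge>1. \<forall>C\<ge>0. N K C \<ge> 0)"

definition N_morse_rays :: "'a \<Rightarrow> (real \<Rightarrow> real \<Rightarrow> real) \<Rightarrow> (real \<Rightarrow> 'a) set" where
  "N_morse_rays e N = {\<gamma> \<in> geodesic_rays e.
     \<forall>K\<ge>1. \<forall>C\<ge>0. \<forall>a b \<sigma>. quasi_geodesic K C a b \<sigma> \<and> \<sigma> a \<in> \<gamma> ` {0..} \<and> \<sigma> b \<in> \<gamma> ` {0..}
       \<longrightarrow> \<sigma> ` {a..b} \<subseteq> nbhd (N K C) (\<gamma> ` {0..})}"

definition morse_rays :: "'a \<Rightarrow> (real \<Rightarrow> 'a) set" where
  "morse_rays e = (\<Union>N\<in>Collect gauge_fun. N_morse_rays e N)"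

definition ray_rel :: "'a \<Rightarrow> ((real \<Rightarrow> 'a) \<times> (real \<Rightarrow> 'a)) set" where
  "ray_rel e = {(\<alpha>, \<beta>). \<alpha> \<in> morse_rays e \<and> \<beta> \<in> morse_rays e \<and>
     (\<exists>R. \<alpha> ` {0..} \<subseteq> nbhd R (\<beta> ` {0..}) \<and> \<beta> ` {0..} \<subseteq> nbhd R (\<alpha> ` {0..}))}"

definition morse_boundary :: "'a \<Rightarrow> (real \<Rightarrow> 'a) set set" where
  "morse_boundary e = morse_rays e // ray_rel e"

definition morse_stratum :: "'a \<Rightarrow> (real \<Rightarrow> real \<Rightarrow> real) \<Rightarrow> (real \<Rightarrow> 'a) set set" where
  "morse_stratum e N = {\<xi> \<in> morse_boundary e. \<xi> \<inter> N_morse_rays e N \<noteq> {}}"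

text \<open>The topology of uniform convergence on compact sets on a set \<open>R\<close> of rays.\<close>

definition ray_topology :: "(real \<Rightarrow> 'a) set \<Rightarrow> (real \<Rightarrow> 'a) topology" where
  "ray_topology R = topology (\<lambda>U. U \<subseteq> R \<and>
     (\<forall>\<gamma>\<in>U. \<exists>T. \<exists>\<epsilon>>0. {\<beta> \<in> R. \<forall>t\<in>{0..T}. d (\<gamma> t) (\<beta> t) < \<epsilon>} \<subseteq> U))"

text \<open>A stratum is a quotient of the space of \<open>N\<close>-Morse rays.\<close>

definition stratum_topology :: "'a \<Rightarrow> (real \<Rightarrow> real \<Rightarrow> real) \<Rightarrow> (real \<Rightarrow> 'a) set topology" where
  "stratum_topology e N = topology (\<lambda>U. U \<subseteq> morse_stratum e N \<and>
     openin (ray_topology (N_morse_rays e N)) {\<gamma> \<in> N_morse_rays e N. ray_rel e `` {\<gamma>} \<in> U})"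

definition morse_topology :: "'a \<Rightarrow> (real \<Rightarrow> 'a) set topology" where
  "morse_topology e = topology (\<lambda>U. U \<subseteq> morse_boundary e \<and>
     (\<forall>N. gauge_fun N \<longrightarrow> openin (stratum_topology e N) (U \<inter> morse_stratum e N)))"

lemma openin_ray_topology:
  "openin (ray_topology R) U \<longleftrightarrow> U \<subseteq> R \<and>
     (\<forall>\<gamma>\<in>U. \<exists>T. \<exists>\<epsilon>>0. {\<beta> \<in> R. \<forall>t\<in>{0..T}. d (\<gamma> t) (\<beta> t) < \<epsilon>} \<subseteq> U)"
proof -
  let ?P = "\<lambda>U. U \<subseteq> R \<and>
     (\<forall>\<gamma>\<in>U. \<exists>T. \<exists>\<epsilon>>0. {\<beta> \<in> R. \<forall>t\<in>{0..T}. d (\<gamma> t) (\<beta> t) < \<epsilon>} \<subseteq> U)"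
  have "istopology ?P"
    unfolding istopology_def
  proof (intro conjI allI impI)
    fix S T assume S: "?P S" and T: "?P T"
    show "S \<inter> T \<subseteq> R" using S by blast
    show "\<forall>\<gamma>\<in>S \<inter> T. \<exists>A. \<exists>\<epsilon>>0. {\<beta> \<in> R. \<forall>t\<in>{0..A}. d (\<gamma> t) (\<beta> t) < \<epsilon>} \<subseteq> S \<inter> T"
    proof
      fix \<gamma> assume g: "\<gamma> \<in> S \<inter> T"
      obtain A \<epsilon> where 1: "\<epsilon> > 0" "{\<beta> \<in> R. \<forall>t\<in>{0..A}. d (\<gamma> t) (\<beta> t) < \<epsilon>} \<subseteq> S"
        using S g by blast
      obtain B \<delta> where 2: "\<delta> > 0" "{\<beta> \<in> R. \<forall>t\<in>{0..B}. d (\<gamma> t) (\<beta> t) < \<delta>} \<subseteq> T"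
        using T g by blast
      have "{\<beta> \<in> R. \<forall>t\<in>{0..max A B}. d (\<gamma> t) (\<beta> t) < min \<epsilon> \<delta>} \<subseteq> S \<inter> T"
        using 1(2) 2(2) by fastforce
      moreover have "min \<epsilon> \<delta> > 0" using 1 2 by simp
      ultimately show "\<exists>A. \<exists>\<epsilon>>0. {\<beta> \<in> R. \<forall>t\<in>{0..A}. d (\<gamma> t) (\<beta> t) < \<epsilon>} \<subseteq> S \<inter> T" by blast
    qed
  next
    fix \<K> assume K: "\<forall>U\<in>\<K>. ?P U"
    show "\<Union>\<K> \<subseteq> R" using K by blast
    show "\<forall>\<gamma>\<in>\<Union>\<K>. \<exists>A. \<exists>\<epsilon>>0. {\<beta> \<in> R. \<forall>t\<in>{0..A}. d (\<gamma> t) (\<beta> t) < \<epsilon>} \<subseteq> \<Union>\<K>"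
    proof
      fix \<gamma> assume "\<gamma> \<in> \<Union>\<K>"
      then obtain U where "U \<in> \<K>" "\<gamma> \<in> U" by blast
      then obtain A \<epsilon> where "\<epsilon> > 0" "{\<beta> \<in> R. \<forall>t\<in>{0..A}. d (\<gamma> t) (\<beta> t) < \<epsilon>} \<subseteq> U"
        using K by blast
      then show "\<exists>A. \<exists>\<epsilon>>0. {\<beta> \<in> R. \<forall>t\<in>{0..A}. d (\<gamma> t) (\<beta> t) < \<epsilon>} \<subseteq> \<Union>\<K>"
        using \<open>U \<in> \<K>\<close> by (meson Union_upper order_trans)
    qed
  qed
  then show ?thesis
    unfolding ray_topology_def by (simp add: topology_inverse')
qed

lemma openin_stratum_topology:
  "openin (stratum_topology e N) U \<longleftrightarrow> U \<subseteq> morse_stratum e N \<and>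
     openin (ray_topology (N_morse_rays e N)) {\<gamma> \<in> N_morse_rays e N. ray_rel e `` {\<gamma>} \<in> U}"
proof -
  let ?pre = "\<lambda>U. {\<gamma> \<in> N_morse_rays e N. ray_rel e `` {\<gamma>} \<in> U}"
  have i: "?pre (S \<inter> T) = ?pre S \<inter> ?pre T" for S T by blast
  have u: "?pre (\<Union>\<K>) = \<Union>(?pre ` \<K>)" for \<K> by blast
  have "istopology (\<lambda>U. U \<subseteq> morse_stratum e N \<and>
     openin (ray_topology (N_morse_rays e N)) (?pre U))"
    unfolding istopology_def i u by (auto intro: openin_Int openin_Union)
  then show ?thesis
    unfolding stratum_topology_def by (simp add: topology_inverse')
qed

lemma openin_morse_topology:
  "openin (morse_topology e) U \<longleftrightarrow> U \<subseteq> morse_boundary e \<and>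
     (\<forall>N. gauge_fun N \<longrightarrow> openin (stratum_topology e N) (U \<inter> morse_stratum e N))"
proof -
  have i: "(S \<inter> T) \<inter> B = (S \<inter> B) \<inter> (T \<inter> B)" for S T B :: "(real \<Rightarrow> 'a) set set" by blast
  have u: "\<Union>\<K> \<inter> B = \<Union>((\<lambda>U. U \<inter> B) ` \<K>)" for \<K> and B :: "(real \<Rightarrow> 'a) set set" by blast
  have "istopology (\<lambda>U. U \<subseteq> morse_boundary e \<and>
     (\<forall>N. gauge_fun N \<longrightarrow> openin (stratum_topology e N) (U \<inter> morse_stratum e N)))"
    unfolding istopology_def
  proof (intro conjI allI impI)
    fix S T N
    assume "S \<subseteq> morse_boundary e \<and>
        (\<forall>N. gauge_fun N \<longrightarrow> openin (stratum_topology e N) (S \<inter> morse_stratum e N))"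
      and "T \<subseteq> morse_boundary e \<and>
        (\<forall>N. gauge_fun N \<longrightarrow> openin (stratum_topology e N) (T \<inter> morse_stratum e N))"
      and "gauge_fun N"
    then show "openin (stratum_topology e N) (S \<inter> T \<inter> morse_stratum e N)"
      unfolding i[of S T] by (blast intro: openin_Int)
  next
    fix \<K> N
    assume "\<forall>K\<in>\<K>. K \<subseteq> morse_boundary e \<and>
        (\<forall>N. gauge_fun N \<longrightarrow> openin (stratum_topology e N) (K \<inter> morse_stratum e N))"
      and "gauge_fun N"
    then show "openin (stratum_topology e N) (\<Union>\<K> \<inter> morse_stratum e N)"
      unfolding u by (blast intro: openin_Union)
  qed blast+
  then show ?thesis
    unfolding morse_topology_def by (simp add: topology_inverse')
qed

lemma topspace_ray_topology: "topspace (ray_topology R) = R"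
proof -
  have "openin (ray_topology R) R"
    unfolding openin_ray_topology using zero_less_one by blast
  then show ?thesis
    by (meson openin_ray_topology openin_subset openin_topspace subset_antisym)
qed

lemma topspace_morse_topology: "topspace (morse_topology e) = morse_boundary e"
proof -
  have class_in: "ray_rel e `` {\<gamma>} \<in> morse_stratum e N"
    if "gauge_fun N" and g: "\<gamma> \<in> N_morse_rays e N" for \<gamma> N
  proof -
    have m: "\<gamma> \<in> morse_rays e" using that by (auto simp: morse_rays_def)
    have "\<gamma> ` {0..} \<subseteq> M" using g by (auto simp: N_morse_rays_def geodesic_rays_def)
    then have "\<gamma> ` {0..} \<subseteq> nbhd 0 (\<gamma> ` {0..})"
      by (force simp: nbhd_def mcball_def)
    then have "(\<gamma>, \<gamma>) \<in> ray_rel e" using m by (auto simp: ray_rel_def)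
    then show ?thesis
      using m g by (auto simp: morse_stratum_def morse_boundary_def quotient_def)
  qed
  have "openin (morse_topology e) (morse_boundary e)"
    unfolding openin_morse_topology
  proof (intro conjI allI impI subset_refl)
    fix N assume N: "gauge_fun N"
    have s: "morse_boundary e \<inter> morse_stratum e N = morse_stratum e N"
      by (auto simp: morse_stratum_def)
    have "{\<gamma> \<in> N_morse_rays e N. ray_rel e `` {\<gamma>} \<in> morse_stratum e N} = N_morse_rays e N"
      using class_in[OF N] by blast
    then show "openin (stratum_topology e N) (morse_boundary e \<inter> morse_stratum e N)"
      unfolding s openin_stratum_topology
      by (metis openin_topspace order_refl topspace_ray_topology)
  qed
  then show ?thesis
    by (meson openin_morse_topology openin_subset openin_topspace subset_antisym)
qed

text \<open>Convergence of points of the space to a point \<open>\<xi>\<close> of the Morse boundary, which is a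
  set of rays: \<open>c\<close> is a choice of segments \<open>[e, p i]\<close>, \<open>r\<close> selects a subsequence, and
  \<open>\<gamma>\<close> is its limit uniformly on compact sets. The segment \<open>c i\<close> is only defined on
  \<open>[0, d e (p i)]\<close>, which contains a given \<open>[0, T]\<close> for all large \<open>i\<close>.\<close>

definition morse_converges :: "'a \<Rightarrow> (nat \<Rightarrow> 'a) \<Rightarrow> (real \<Rightarrow> 'a) set \<Rightarrow> bool" where
  "morse_converges e p \<xi> \<longleftrightarrow> range p \<subseteq> M \<and> \<xi> \<in> morse_boundary e \<and>
     filterlim (\<lambda>i. d e (p i)) at_top sequentially \<and>
     (\<forall>c r. \<forall>\<gamma> \<in> {0..} \<rightarrow>\<^sub>E M. (\<forall>i. geodesic_segment (c i) e (p i)) \<and> strict_mono (r :: nat \<Rightarrow> nat) \<and>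
        (\<forall>T. \<forall>\<epsilon>>0. \<forall>\<^sub>F i in sequentially. \<forall>t\<in>{0..T}. d (c (r i) t) (\<gamma> t) < \<epsilon>)
        \<longrightarrow> \<gamma> \<in> \<xi>)"

end


section \<open>Cannon--Thurston maps\<close>

text \<open>\<open>H\<close> is the set of elements of the subgroup, acting on \<open>(Y, dY)\<close> by \<open>\<psi>\<close>; the big
  group acts on \<open>(X, dX)\<close> by \<open>\<phi>\<close>; \<open>eY\<close> and \<open>eX\<close> are the basepoints of the Morse
  boundaries. That the limit of \<open>h i \<cdot> x\<close> exists and depends only on that of
  \<open>h i \<cdot> y\<close> is expressed by its being the value of the function \<open>f\<close>.\<close>

definition cannon_thurston_map ::
  "'g set \<Rightarrow> 'y set \<Rightarrow> ('y \<Rightarrow> 'y \<Rightarrow> real) \<Rightarrow> ('g \<Rightarrow> 'y \<Rightarrow> 'y) \<Rightarrow> 'y \<Rightarrow> 'y \<Rightarrow>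
   'x set \<Rightarrow> ('x \<Rightarrow> 'x \<Rightarrow> real) \<Rightarrow> ('g \<Rightarrow> 'x \<Rightarrow> 'x) \<Rightarrow> 'x \<Rightarrow> 'x \<Rightarrow>
   ((real \<Rightarrow> 'y) set \<Rightarrow> (real \<Rightarrow> 'x) set) \<Rightarrow> bool" where
  "cannon_thurston_map H Y dY \<psi> eY y X dX \<phi> eX x f \<longleftrightarrow>
     continuous_map (Metric_space.morse_topology Y dY eY) (Metric_space.morse_topology X dX eX) f \<and>
     (\<forall>h \<xi>. range h \<subseteq> H \<and> Metric_space.morse_converges Y dY eY (\<lambda>i. \<psi> (h i) y) \<xi> \<longrightarrow>
        Metric_space.morse_converges X dX eX (\<lambda>i. \<phi> (h i) x) (f \<xi>))"


section \<open>Hyperbolic groups\<close>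

definition word_length :: "('g, 'm) monoid_scheme \<Rightarrow> 'g set \<Rightarrow> 'g \<Rightarrow> nat" where
  "word_length G S g = (LEAST n. \<exists>ws. length ws = n \<and> set ws \<subseteq> S \<union> m_inv G ` S \<and>
      foldr (\<otimes>\<^bsub>G\<^esub>) ws \<one>\<^bsub>G\<^esub> = g)"

definition word_metric :: "('g, 'm) monoid_scheme \<Rightarrow> 'g set \<Rightarrow> 'g \<Rightarrow> 'g \<Rightarrow> real" where
  "word_metric G S g h = real (word_length G S (inv\<^bsub>G\<^esub> g \<otimes>\<^bsub>G\<^esub> h))"

definition hyperbolic_group :: "('g, 'm) monoid_scheme \<Rightarrow> bool" where
  "hyperbolic_group G \<longleftrightarrow> group G \<and>
     (\<exists>S. finite S \<and> S \<subseteq> carrier G \<and> generate G S = carrier G \<and>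
        gromov_hyperbolic (carrier G) (word_metric G S))"

end

theory Submission
  imports Defs "HOL-Library.Diagonal_Subsequence" "HOL-Real_Asymp.Real_Asymp"
begin

text \<open>The obstruction comes from a flat in \<open>Z\<close>. The orbit maps of \<open>G\<close> carry a Euclidean plane in it
  to a quasi-isometrically embedded plane \<open>q\<close> in \<open>X\<close>, and Morse rays and such quasi-planes repel
  each other, for the following reason. Walk inside the quasi-plane to a point that is almost nearest to
  some \<open>p\<close>, and then go straight to \<open>p\<close>: this is a quasi-geodesic with constants that depend on
  nothing else, and inside the quasi-plane one may walk straight or around a right-angled corner.
  If both routes had to stay near one ray, then the corner would be near the straight
  line (\<open>plane_triangle_not_along_ray\<close>). So a Morse ray \<open>\<gamma>\<close> projects to a bounded part of the
  quasi-plane, and the same two routes show: if \<open>g\<^sub>n \<in> G\<close> brings the point \<open>q n\<close> back to the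
  basepoint, then for no gauge \<open>N\<close> can infinitely many of the translates \<open>g\<^sub>n \<gamma>\<close> be asymptotic to
  \<open>N\<close>-Morse rays from the basepoint (\<open>flat_translates_not_uniformly_morse\<close>).

  A Cannon--Thurston map \<open>f\<close> would provide such a gauge. As \<open>H\<close> is hyperbolic, the quasi-geodesics of
  \<open>Y\<close> are stable, so all rays in \<open>Y\<close> are Morse with one gauge, and every sequence of distinct elements of
  \<open>H\<close> subconverges to a point of the boundary of \<open>Y\<close>. In particular the Morse boundary of \<open>X\<close>
  contains some \<open>[\<gamma>]\<close>. Choose \<open>g\<^sub>j\<close> that moves the basepoint near \<open>\<gamma> j\<close>. For \<open>k \<in> H\<close> the element
  \<open>u\<^sub>j = g\<^sub>j k g\<^sub>j\<^sup>-\<^sup>1\<close> lies in \<open>H\<close>, by normality, and one gets from the basepoint to its image under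
  \<open>u\<^sub>j\<close> by following \<open>\<gamma>\<close> up to \<open>\<gamma> j\<close> and the Morse ray \<open>u\<^sub>j \<gamma>\<close> back. If \<open>k\<close> moves the endpoint
  of the ray that one sees in the limit when looking back along \<open>\<gamma>\<close> from \<open>\<gamma> j\<close>, then there is no
  shortcut, and the images of the basepoint under \<open>u\<^sub>j\<close> converge to \<open>[\<gamma>]\<close>; in the same way those under
  \<open>g u\<^sub>j g\<^sup>-\<^sup>1 \<in> H\<close> converge to \<open>[g \<gamma>]\<close> (\<open>conjugates_follow_translates\<close>). Such a \<open>k\<close>
  exists: if all of \<open>H\<close> fixed that endpoint, then, by normality, \<open>H\<close> would fix its whole \<open>G\<close>-orbit,
  which is infinite by the first paragraph; but an isometry that fixes three endpoints of Morse rays moves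
  their centre by a bounded amount, so \<open>H\<close> would be finite (\<open>element_moving_ray\<close>).

  Hence \<open>f\<close> attains every \<open>[g \<gamma>]\<close>. Let \<open>f \<zeta>\<^sub>n = [g\<^sub>n \<gamma>]\<close> with the \<open>g\<^sub>n\<close> from the first
  paragraph. By compactness a subsequence of \<open>\<zeta>\<^sub>n\<close> converges in the boundary of \<open>Y\<close>, so, by continuity, a
  subsequence of \<open>[g\<^sub>n \<gamma>]\<close> converges in the Morse boundary of \<open>X\<close>. In the direct limit topology
  a convergent sequence has infinitely many members in one stratum (\<open>morse_limit_in_stratum\<close>), that
  is, infinitely many \<open>[g\<^sub>n \<gamma>]\<close> contain Morse rays of one gauge, which the first paragraph excludes.\<close>

section \<open>Quasi-geodesics\<close>

context Metric_space
begin

lemma in_nbhd: "v \<in> nbhd r S \<longleftrightarrow> (\<exists>s\<in>S. s \<in> M \<and> v \<in> M \<and> d s v \<le> r)"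
  by (auto simp: nbhd_def)

lemma nbhd_mono: "r \<le> r' \<Longrightarrow> S \<subseteq> S' \<Longrightarrow> nbhd r S \<subseteq> nbhd r' S'"
  by (force simp: in_nbhd)

lemma nbhd_trans: "nbhd r (nbhd s A) \<subseteq> nbhd (r + s) A"
proof
  fix v assume "v \<in> nbhd r (nbhd s A)"
  then obtain w a where "w \<in> M" "v \<in> M" "d w v \<le> r" "a \<in> A" "a \<in> M" "d a w \<le> s"
    by (auto simp: in_nbhd)
  with triangle[of a w v] show "v \<in> nbhd (r + s) A" by (auto simp: in_nbhd intro!: bexI[of _ a])
qed

lemma qg_in: "quasi_geodesic K C a b \<sigma> \<Longrightarrow> t \<in> {a..b} \<Longrightarrow> \<sigma> t \<in> M"
  by (auto simp: quasi_geodesic_def)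

lemma qg_le: "quasi_geodesic K C a b \<sigma> \<Longrightarrow> a \<le> b"
  by (auto simp: quasi_geodesic_def)

lemma qg_lower: "quasi_geodesic K C a b \<sigma> \<Longrightarrow> s \<in> {a..b} \<Longrightarrow> t \<in> {a..b} \<Longrightarrow> \<bar>s - t\<bar> / K - C \<le> d (\<sigma> s) (\<sigma> t)"
  by (auto simp: quasi_geodesic_def)

lemma qg_upper: "quasi_geodesic K C a b \<sigma> \<Longrightarrow> s \<in> {a..b} \<Longrightarrow> t \<in> {a..b} \<Longrightarrow> d (\<sigma> s) (\<sigma> t) \<le> K * \<bar>s - t\<bar> + C"
  by (auto simp: quasi_geodesic_def)

lemma qg_gap: "quasi_geodesic K C a b \<sigma> \<Longrightarrow> K \<ge> 1 \<Longrightarrow> s \<in> {a..b} \<Longrightarrow> t \<in> {a..b} \<Longrightarrow> \<bar>s - t\<bar> \<le> K * (d (\<sigma> s) (\<sigma> t) + C)"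
  using qg_lower[of K C a b \<sigma> s t] by (simp add: field_simps)

lemma qgI:
  assumes "a \<le> b" "\<And>t. t \<in> {a..b} \<Longrightarrow> \<sigma> t \<in> M"
    "\<And>s t. s \<in> {a..b} \<Longrightarrow> t \<in> {a..b} \<Longrightarrow> s \<le> t \<Longrightarrow> (t - s) / K - C \<le> d (\<sigma> s) (\<sigma> t) \<and> d (\<sigma> s) (\<sigma> t) \<le> K * (t - s) + C"
  shows "quasi_geodesic K C a b \<sigma>"
proof -
  have "\<bar>s - t\<bar> / K - C \<le> d (\<sigma> s) (\<sigma> t) \<and> d (\<sigma> s) (\<sigma> t) \<le> K * \<bar>s - t\<bar> + C"
    if "s \<in> {a..b}" "t \<in> {a..b}" for s t
  proof (cases "s \<le> t")
    case True
    then show ?thesis using assms(3)[OF that] by simp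
  next
    case False
    then show ?thesis using assms(3)[OF that(2,1)] by (simp add: commute)
  qed
  then show ?thesis using assms(1,2) by (auto simp: quasi_geodesic_def)
qed

lemma qg_mono:
  assumes "quasi_geodesic K C a b \<sigma>" "1 \<le> K" "K \<le> K'" "C \<le> C'"
  shows "quasi_geodesic K' C' a b \<sigma>"
proof (rule qgI)
  show "a \<le> b" using assms qg_le by blast
  show "\<sigma> t \<in> M" if "t \<in> {a..b}" for t using assms qg_in that by blast
  fix s t assume st: "s \<in> {a..b}" "t \<in> {a..b}" "s \<le> t"
  have "(t - s) / K' \<le> (t - s) / K" using assms st by (intro divide_left_mono) auto
  moreover have "K * (t - s) \<le> K' * (t - s)" using assms st by (intro mult_right_mono) auto
  moreover have "\<bar>s - t\<bar> = t - s" using st by simp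
  ultimately show "(t - s) / K' - C' \<le> d (\<sigma> s) (\<sigma> t) \<and> d (\<sigma> s) (\<sigma> t) \<le> K' * (t - s) + C'"
    using qg_lower[OF assms(1) st(1,2)] qg_upper[OF assms(1) st(1,2)] assms(4)
      by (metis add_mono diff_mono order_trans)
qed

lemma qg_subinterval:
  assumes "quasi_geodesic K C a b \<sigma>" "a \<le> a'" "a' \<le> b'" "b' \<le> b"
  shows "quasi_geodesic K C a' b' \<sigma>"
  using assms by (auto simp: quasi_geodesic_def)

lemma qg_reverse:
  assumes "quasi_geodesic K C a b \<sigma>"
  shows "quasi_geodesic K C (-b) (-a) (\<lambda>t. \<sigma> (-t))"
proof (rule qgI)
  show "- b \<le> - a" using qg_le[OF assms] by simp
  show "\<sigma> (-t) \<in> M" if "t \<in> {-b..-a}" for t using assms that by (intro qg_in) auto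
  fix s t assume st: "s \<in> {-b..-a}" "t \<in> {-b..-a}" "s \<le> t"
  then have "-s \<in> {a..b}" "-t \<in> {a..b}" by auto
  then show "(t - s) / K - C \<le> d (\<sigma> (- s)) (\<sigma> (- t)) \<and> d (\<sigma> (- s)) (\<sigma> (- t)) \<le> K * (t - s) + C"
    using qg_lower[OF assms, of "-s" "-t"] qg_upper[OF assms, of "-s" "-t"] st by (simp add: abs_if split: if_splits)
qed

lemma qg_shift:
  assumes "quasi_geodesic K C a b \<sigma>"
  shows "quasi_geodesic K C (a + h) (b + h) (\<lambda>t. \<sigma> (t - h))"
proof (rule qgI)
  show "a + h \<le> b + h" using qg_le[OF assms] by simp
  show "\<sigma> (t - h) \<in> M" if "t \<in> {a + h..b + h}" for t using assms that by (intro qg_in) auto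
  fix s t assume st: "s \<in> {a + h..b + h}" "t \<in> {a + h..b + h}" "s \<le> t"
  then have "s - h \<in> {a..b}" "t - h \<in> {a..b}" by auto
  then show "(t - s) / K - C \<le> d (\<sigma> (s - h)) (\<sigma> (t - h)) \<and> d (\<sigma> (s - h)) (\<sigma> (t - h)) \<le> K * (t - s) + C"
    using qg_lower[OF assms, of "s-h" "t-h"] qg_upper[OF assms, of "s-h" "t-h"] st
      by (simp add: abs_if split: if_splits)
qed

text \<open>Quasi-geodesics need not be continuous. So single points of one, such as its endpoints, may be moved
  by a bounded distance at the cost of the additive constant only.\<close>

lemma qg_perturb:
  assumes "quasi_geodesic K C a b \<sigma>" "\<And>t. t \<in> {a..b} \<Longrightarrow> \<sigma>' t \<in> M \<and> d (\<sigma> t) (\<sigma>' t) \<le> R"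
  shows "quasi_geodesic K (C + 2 * R) a b \<sigma>'"
proof (rule qgI)
  show "a \<le> b" using assms qg_le by blast
  show "\<sigma>' t \<in> M" if "t \<in> {a..b}" for t using assms that by blast
  fix s t assume st: "s \<in> {a..b}" "t \<in> {a..b}" "s \<le> t"
  have m: "\<sigma> s \<in> M" "\<sigma> t \<in> M" "\<sigma>' s \<in> M" "\<sigma>' t \<in> M" using assms st qg_in by blast+
  have r: "d (\<sigma> s) (\<sigma>' s) \<le> R" "d (\<sigma> t) (\<sigma>' t) \<le> R" using assms st by blast+
  have "d (\<sigma> s) (\<sigma> t) \<le> d (\<sigma> s) (\<sigma>' s) + d (\<sigma>' s) (\<sigma>' t) + d (\<sigma> t) (\<sigma>' t)"
    using triangle[of "\<sigma> s" "\<sigma>' s" "\<sigma> t"] triangle[of "\<sigma>' s" "\<sigma>' t" "\<sigma> t"] m by (simp add: commute)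
  moreover have "d (\<sigma>' s) (\<sigma>' t) \<le> d (\<sigma> s) (\<sigma>' s) + d (\<sigma> s) (\<sigma> t) + d (\<sigma> t) (\<sigma>' t)"
    using triangle[of "\<sigma>' s" "\<sigma> s" "\<sigma>' t"] triangle[of "\<sigma> s" "\<sigma> t" "\<sigma>' t"] m by (simp add: commute)
  ultimately show "(t - s) / K - (C + 2 * R) \<le> d (\<sigma>' s) (\<sigma>' t) \<and> d (\<sigma>' s) (\<sigma>' t) \<le> K * (t - s) + (C + 2 * R)"
    using qg_lower[OF assms(1) st(1,2)] qg_upper[OF assms(1) st(1,2)] st r by (simp add: abs_if split: if_splits)
qed

text \<open>The hypothesis \<open>far\<close> says that, up to constants, no point of the second path is closer to a point of the
  first one than their common endpoint is. The distance of the two points then bounds what remains to be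
  walked on either path.\<close>

lemma qg_concat:
  assumes \<sigma>: "quasi_geodesic K C a b \<sigma>" and \<tau>: "quasi_geodesic K C b c \<tau>" and w: "\<sigma> b = \<tau> b"
    and K: "K \<ge> 1" and C: "C \<ge> 0" and A: "A \<ge> 0" and B: "B \<ge> 0"
    and far: "\<And>s t. s \<in> {a..b} \<Longrightarrow> t \<in> {b..c} \<Longrightarrow> d (\<sigma> s) (\<sigma> b) \<le> A * d (\<sigma> s) (\<tau> t) + B"
  shows "quasi_geodesic (K * (2 * A + 1)) (2 * (B + C)) a c (\<lambda>t. if t \<le> b then \<sigma> t else \<tau> t)"
    (is "quasi_geodesic ?K ?C a c ?f")
proof (rule qgI)
  have ab: "a \<le> b" "b \<le> c" using \<sigma> \<tau> qg_le by blast+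
  then show "a \<le> c" by simp
  show "?f t \<in> M" if "t \<in> {a..c}" for t using qg_in[OF \<sigma>, of t] qg_in[OF \<tau>, of t] that by auto
  have "1 * 1 \<le> K * (2 * A + 1)" using K A by (intro mult_mono) auto
  moreover have "K * 1 \<le> K * (2 * A + 1)" using K A by (intro mult_left_mono) auto
  ultimately have K': "K \<le> ?K" "1 \<le> ?K" by auto
  have C': "C \<le> ?C" using B C by simp
  have \<sigma>': "quasi_geodesic ?K ?C a b \<sigma>" by (rule qg_mono[OF \<sigma> K K'(1) C'])
  have \<tau>': "quasi_geodesic ?K ?C b c \<tau>" by (rule qg_mono[OF \<tau> K K'(1) C'])
  fix s t assume st: "s \<in> {a..c}" "t \<in> {a..c}" "s \<le> t"
  consider "t \<le> b" | "b < s" | "s \<le> b" "b < t" by linarith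
  then show "(t - s) / ?K - ?C \<le> d (?f s) (?f t) \<and> d (?f s) (?f t) \<le> ?K * (t - s) + ?C"
  proof cases
    case 1
    then show ?thesis using qg_lower[OF \<sigma>', of s t] qg_upper[OF \<sigma>', of s t] st by (simp add: abs_if split: if_splits)
  next
    case 2
    then show ?thesis using qg_lower[OF \<tau>', of s t] qg_upper[OF \<tau>', of s t] st by (simp add: abs_if split: if_splits)
  next
    case 3
    let ?x = "d (\<sigma> s) (\<tau> t)"
    have i: "s \<in> {a..b}" "b \<in> {a..b}" "t \<in> {b..c}" "b \<in> {b..c}" using st ab 3 by auto
    have m: "\<sigma> s \<in> M" "\<sigma> b \<in> M" "\<tau> t \<in> M" using qg_in \<sigma> \<tau> i by blast+
    have f: "d (\<sigma> s) (\<sigma> b) \<le> A * ?x + B" using far i by blast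
    have g: "d (\<sigma> b) (\<tau> t) \<le> (A + 1) * ?x + B" 
      using f triangle[of "\<sigma> b" "\<sigma> s" "\<tau> t"] m by (simp add: commute algebra_simps)
    have 1: "b - s \<le> K * (d (\<sigma> s) (\<sigma> b) + C)" using qg_gap[OF \<sigma> K i(1,2)] i by simp
    have 2: "t - b \<le> K * (d (\<sigma> b) (\<tau> t) + C)" using qg_gap[OF \<tau> K i(4,3)] i w by simp
    have "t - s \<le> K * (d (\<sigma> s) (\<sigma> b) + d (\<sigma> b) (\<tau> t) + 2 * C)" using 1 2 by (simp add: algebra_simps)
    also have "\<dots> \<le> K * ((2 * A + 1) * ?x + (2 * B + 2 * C))" using f g K
      by (intro mult_left_mono) (auto simp: algebra_simps)
    also have "\<dots> = ?K * ?x + K * ?C" by (simp add: algebra_simps)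
    also have "\<dots> \<le> ?K * ?x + ?K * ?C" using K' B C by (intro add_left_mono mult_right_mono) auto
    finally have l: "(t - s) / ?K - ?C \<le> ?x" using K'(2) by (simp add: field_simps)
    have "?x \<le> d (\<sigma> s) (\<sigma> b) + d (\<sigma> b) (\<tau> t)" using triangle m by blast
    also have "\<dots> \<le> K * (b - s) + C + (K * (t - b) + C)"
      using qg_upper[OF \<sigma> i(1,2)] qg_upper[OF \<tau> i(4,3)] i w by (simp add: abs_if split: if_splits)
    also have "\<dots> = K * (t - s) + 2 * C" by (simp add: algebra_simps)
    also have "\<dots> \<le> ?K * (t - s) + ?C" using K' st B by (intro add_mono mult_right_mono) auto
    finally show ?thesis using l 3 by simp
  qed
qed

text \<open>A discontinuous path need not have a point nearest to a given one. Points that are nearest up to \<open>1\<close>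
  always exist and serve as well.\<close>

lemma near_minimum:
  fixes f :: "'i \<Rightarrow> real"
  assumes "I \<noteq> {}" "\<And>i. i \<in> I \<Longrightarrow> f i \<ge> 0"
  obtains i where "i \<in> I" "\<And>j. j \<in> I \<Longrightarrow> f i \<le> f j + 1"
proof -
  have b: "bdd_below (f ` I)" by (rule bdd_belowI[of _ 0]) (use assms in auto)
  have "Inf (f ` I) < Inf (f ` I) + 1" by simp
  then obtain y where "y \<in> f ` I" "y < Inf (f ` I) + 1"
    using cInf_less_iff[OF _ b] assms(1) by (metis image_is_empty)
  then obtain i where "i \<in> I" "f i < Inf (f ` I) + 1" by auto
  moreover have "Inf (f ` I) \<le> f j" if "j \<in> I" for j using cInf_lower[OF _ b] that by auto
  ultimately show ?thesis using that[of i] by (smt (verit))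
qed

lemma geodesic_qg:
  assumes geodesic_space "p \<in> M" "q \<in> M"
  obtains c where "quasi_geodesic 1 0 0 (d p q) c" "c 0 = p" "c (d p q) = q"
  using assms unfolding geodesic_space_def geodesic_segment_def quasi_geodesic_def
  by (metis (no_types, lifting) nonneg abs_ge_zero div_by_1 mult_1 diff_zero add.right_neutral order_refl)

text \<open>If \<open>\<sigma> b\<close> is almost the point of \<open>\<sigma>\<close> nearest to \<open>p\<close>, then a geodesic from \<open>\<sigma> b\<close> to \<open>p\<close> continues
  \<open>\<sigma>\<close> to a quasi-geodesic: a point \<open>v\<close> of this geodesic cannot be closer to a point \<open>u\<close> of \<open>\<sigma>\<close> than to \<open>\<sigma> b\<close>
  (up to \<open>\<epsilon>\<close>), as \<open>u\<close> would then be closer to \<open>p\<close> than \<open>\<sigma> b\<close> is. Most quasi-geodesics below arise in this way.\<close>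

lemma qg_extend:
  assumes geo: geodesic_space and \<sigma>: "quasi_geodesic K C a b \<sigma>" and K: "K \<ge> 1" and C: "C \<ge> 0"
    and p: "p \<in> M" and near: "\<And>t. t \<in> {a..b} \<Longrightarrow> d p (\<sigma> b) \<le> d p (\<sigma> t) + \<epsilon>" and e: "\<epsilon> \<ge> 0"
  obtains b' \<sigma>' where "b \<le> b'" "quasi_geodesic (5 * K) (2 * (\<epsilon> + C)) a b' \<sigma>'" "\<And>t. t \<in> {a..b} \<Longrightarrow> \<sigma>' t = \<sigma> t"
    "\<sigma>' b' = p" "\<And>t. t \<in> {b..b'} \<Longrightarrow> d (\<sigma>' t) p \<le> d (\<sigma> b) p"
proof -
  have ab: "a \<le> b" using \<sigma> qg_le by blast
  have sb: "\<sigma> b \<in> M" using qg_in[OF \<sigma>] ab by auto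
  define l where "l = d (\<sigma> b) p"
  obtain c where c: "quasi_geodesic 1 0 0 l c" "c 0 = \<sigma> b" "c l = p"
    using geodesic_qg[OF geo sb p] unfolding l_def by blast
  have l0: "l \<ge> 0" by (simp add: l_def)
  define \<tau> where "\<tau> = (\<lambda>t. c (t - b))"
  have \<tau>1: "quasi_geodesic 1 0 b (b + l) \<tau>" using qg_shift[OF c(1), of b] by (simp add: \<tau>_def add.commute)
  have \<tau>: "quasi_geodesic K C b (b + l) \<tau>" by (rule qg_mono[OF \<tau>1]) (use K C in auto)
  have \<tau>b: "\<tau> b = \<sigma> b" "\<tau> (b + l) = p" using c by (simp_all add: \<tau>_def)
  have dd: "d (\<tau> s) (\<tau> t) = \<bar>s - t\<bar>" if "s \<in> {b..b+l}" "t \<in> {b..b+l}" for s t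
    using qg_lower[OF \<tau>1 that] qg_upper[OF \<tau>1 that] by simp
  have far: "d (\<sigma> s) (\<sigma> b) \<le> 2 * d (\<sigma> s) (\<tau> t) + \<epsilon>" if "s \<in> {a..b}" "t \<in> {b..b+l}" for s t
  proof -
    have m: "\<sigma> s \<in> M" "\<tau> t \<in> M" using that \<sigma> \<tau> qg_in by blast+
    have 1: "d (\<tau> t) p = b + l - t" "d (\<tau> t) (\<sigma> b) = t - b" using dd[of t "b + l"] dd[of t b] \<tau>b that by auto
    have "l \<le> d p (\<sigma> s) + \<epsilon>" using near[OF that(1)] by (simp add: l_def commute)
    also have "d p (\<sigma> s) \<le> d (\<tau> t) p + d (\<sigma> s) (\<tau> t)" using triangle[of p "\<tau> t" "\<sigma> s"] m p by (simp add: commute)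
    finally have "d (\<tau> t) (\<sigma> b) \<le> d (\<sigma> s) (\<tau> t) + \<epsilon>" using 1 by simp
    then show ?thesis using triangle[of "\<sigma> s" "\<tau> t" "\<sigma> b"] m sb by simp
  qed
  let ?f = "\<lambda>t. if t \<le> b then \<sigma> t else \<tau> t"
  have "quasi_geodesic (K * (2 * 2 + 1)) (2 * (\<epsilon> + C)) a (b + l) ?f"
    by (rule qg_concat[OF \<sigma> \<tau> _ K C _ e far]) (use \<tau>b in auto)
  moreover have "?f (b + l) = p" using \<tau>b l0 by (cases "l = 0") auto
  moreover have "d (?f t) p \<le> d (\<sigma> b) p" if "t \<in> {b..b+l}" for t
    using dd[of t "b + l"] \<tau>b that by (auto simp: l_def)
  ultimately show ?thesis using that[of "b + l" ?f] l0 by (simp add: mult.commute)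
qed

section \<open>Morse sets\<close>

text \<open>The condition on the image of an \<open>N\<close>-Morse ray, for arbitrary sets: it is also needed for segments and for
  unions of rays.\<close>

definition morse_set :: "(real \<Rightarrow> real \<Rightarrow> real) \<Rightarrow> 'a set \<Rightarrow> bool" where
  "morse_set N A \<longleftrightarrow> A \<subseteq> M \<and> (\<forall>K\<ge>1. \<forall>C\<ge>0. \<forall>a b \<sigma>. quasi_geodesic K C a b \<sigma> \<and> \<sigma> a \<in> A \<and> \<sigma> b \<in> A
       \<longrightarrow> \<sigma> ` {a..b} \<subseteq> nbhd (N K C) A)"

lemma morse_setD:
  assumes "morse_set N A" "K \<ge> 1" "C \<ge> 0" "quasi_geodesic K C a b \<sigma>" "\<sigma> a \<in> A" "\<sigma> b \<in> A" "t \<in> {a..b}"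
  shows "\<sigma> t \<in> nbhd (N K C) A"
  using assms unfolding morse_set_def by blast

text \<open>Jump from \<open>A\<close> to the endpoints of \<open>\<sigma>\<close>.\<close>

lemma morse_near:
  assumes N: "morse_set N A" and K: "K \<ge> 1" and C: "C \<ge> 0" and \<sigma>: "quasi_geodesic K C a b \<sigma>"
    and a: "\<sigma> a \<in> nbhd R A" and b: "\<sigma> b \<in> nbhd R A" and R: "R \<ge> 0" and t: "t \<in> {a..b}"
  shows "\<sigma> t \<in> nbhd (max R (N K (C + 2 * R))) A"
proof -
  obtain p where p: "p \<in> A" "p \<in> M" "d p (\<sigma> a) \<le> R" using a by (auto simp: in_nbhd)
  obtain q where q: "q \<in> A" "q \<in> M" "d q (\<sigma> b) \<le> R" using b by (auto simp: in_nbhd)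
  consider "t = a" | "t = b" | "t \<noteq> a" "t \<noteq> b" by blast
  then show ?thesis
  proof cases
    case 1
    then show ?thesis using a nbhd_mono[of R "max R (N K (C + 2 * R))" A A] by auto
  next
    case 2
    then show ?thesis using b nbhd_mono[of R "max R (N K (C + 2 * R))" A A] by auto
  next
    case 3
    define \<sigma>' where "\<sigma>' = \<sigma>(a := p, b := q)"
    have "quasi_geodesic K (C + 2 * R) a b \<sigma>'"
      by (rule qg_perturb[OF \<sigma>]) (use p q qg_in[OF \<sigma>] R in \<open>auto simp: \<sigma>'_def commute\<close>)
    moreover have "\<sigma>' a \<in> A" "\<sigma>' b \<in> A" using p q 3 t by (auto simp: \<sigma>'_def)
    ultimately have "\<sigma>' t \<in> nbhd (N K (C + 2 * R)) A" using morse_setD[OF N K, of "C + 2 * R" a b \<sigma>' t] C R t by simp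
    then have "\<sigma> t \<in> nbhd (N K (C + 2 * R)) A" using 3 by (simp add: \<sigma>'_def)
    then show ?thesis using nbhd_mono[of "N K (C + 2 * R)" "max R (N K (C + 2 * R))" A A] by auto
  qed
qed

text \<open>The distance \<open>R'\<close> from the far endpoint to \<open>A\<close> does not enter the conclusion. For let \<open>p \<in> A\<close> be
  within \<open>R'\<close> of \<open>\<sigma> b\<close>. Leaving \<open>\<sigma>\<close> at a point almost nearest to \<open>p\<close> and going straight to \<open>p\<close> is
  a quasi-geodesic that ends in \<open>A\<close>, and it leaves \<open>\<sigma>\<close> at distance at most \<open>2 * R' + 1\<close> from \<open>\<sigma> b\<close>.
  In this way asymptotic rays, whose distance is not controlled, are compared with uniform constants.\<close>

lemma morse_cut:
  assumes geo: geodesic_space and N: "morse_set N A" and K: "K \<ge> 1" and C: "C \<ge> 0" and \<sigma>: "quasi_geodesic K C a b \<sigma>"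
    and a: "\<sigma> a \<in> nbhd R A" and R: "R \<ge> 0" and b: "\<sigma> b \<in> nbhd R' A" and t: "t \<in> {a..b}"
    and far: "\<And>s. s \<in> {a..t} \<Longrightarrow> d (\<sigma> s) (\<sigma> b) > 2 * R' + 1"
  shows "\<sigma> t \<in> nbhd (max R (N (5 * K) (2 * (1 + C) + 2 * R))) A"
proof -
  have ab: "a \<le> b" using \<sigma> qg_le by blast
  obtain p where p: "p \<in> A" "p \<in> M" "d p (\<sigma> b) \<le> R'" using b by (auto simp: in_nbhd)
  obtain b' where b': "b' \<in> {a..b}" "\<And>s. s \<in> {a..b} \<Longrightarrow> d p (\<sigma> b') \<le> d p (\<sigma> s) + 1"
    using near_minimum[of "{a..b}" "\<lambda>s. d p (\<sigma> s)"] ab by auto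
  have m: "\<sigma> b' \<in> M" "\<sigma> b \<in> M" using qg_in[OF \<sigma>] ab b' by auto
  have "d p (\<sigma> b') \<le> R' + 1" using b'(2)[of b] ab p by auto
  then have "d (\<sigma> b') (\<sigma> b) \<le> 2 * R' + 1" using triangle[of "\<sigma> b'" p "\<sigma> b"] m p by (simp add: commute)
  then have tb: "t < b'" using far[of b'] b' by force
  have \<sigma>1: "quasi_geodesic K C a b' \<sigma>" by (rule qg_subinterval[OF \<sigma>]) (use b' in auto)
  have near: "d p (\<sigma> b') \<le> d p (\<sigma> s) + 1" if "s \<in> {a..b'}" for s using b' that by auto
  obtain b'' \<sigma>' where *: "b' \<le> b''" "quasi_geodesic (5 * K) (2 * (1 + C)) a b'' \<sigma>'"
    "\<And>t. t \<in> {a..b'} \<Longrightarrow> \<sigma>' t = \<sigma> t" "\<sigma>' b'' = p"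
    using qg_extend[OF geo \<sigma>1 K C p(2) near] by (metis zero_le_one)
  have "\<sigma>' a = \<sigma> a" "\<sigma>' t = \<sigma> t" using * tb t b' by auto
  moreover have "\<sigma>' b'' \<in> nbhd R A" using * p R by (auto simp: in_nbhd)
  ultimately show ?thesis using morse_near[OF N _ _ *(2), of R t] a R K C t tb * by auto
qed

text \<open>Cut at \<open>b\<close>, and then at \<open>a\<close>. The geodesic added by the first cut stays near \<open>\<sigma> b\<close>, hence away from \<open>\<sigma> a\<close>.\<close>

lemma morse_cut2:
  assumes geo: geodesic_space and N: "morse_set N A" and K: "K \<ge> 1" and C: "C \<ge> 0" and \<sigma>: "quasi_geodesic K C a b \<sigma>"
    and a: "\<sigma> a \<in> nbhd R' A" and b: "\<sigma> b \<in> nbhd R' A" and t: "t \<in> {a..b}"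
    and fara: "\<And>s. s \<in> {t..b} \<Longrightarrow> d (\<sigma> s) (\<sigma> a) > 2 * R' + 1"
    and farb: "\<And>s. s \<in> {a..t} \<Longrightarrow> d (\<sigma> s) (\<sigma> b) > 2 * R' + 1"
    and farab: "d (\<sigma> a) (\<sigma> b) > 4 * R' + 2"
  shows "\<sigma> t \<in> nbhd (max 0 (N (25 * K) (2 * (3 + 2 * C)))) A"
proof -
  have ab: "a \<le> b" using \<sigma> qg_le by blast
  obtain p where p: "p \<in> A" "p \<in> M" "d p (\<sigma> b) \<le> R'" using b by (auto simp: in_nbhd)
  obtain b' where b': "b' \<in> {a..b}" "\<And>s. s \<in> {a..b} \<Longrightarrow> d p (\<sigma> b') \<le> d p (\<sigma> s) + 1"
    using near_minimum[of "{a..b}" "\<lambda>s. d p (\<sigma> s)"] ab by auto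
  have m: "\<sigma> b' \<in> M" "\<sigma> b \<in> M" "\<sigma> a \<in> M" using qg_in[OF \<sigma>] ab b' by auto
  have pb': "d p (\<sigma> b') \<le> R' + 1" using b'(2)[of b] ab p by auto
  then have "d (\<sigma> b') (\<sigma> b) \<le> 2 * R' + 1" using triangle[of "\<sigma> b'" p "\<sigma> b"] m p by (simp add: commute)
  then have tb: "t < b'" using farb[of b'] b' by force
  have \<sigma>1: "quasi_geodesic K C a b' \<sigma>" by (rule qg_subinterval[OF \<sigma>]) (use b' in auto)
  have near: "d p (\<sigma> b') \<le> d p (\<sigma> s) + 1" if "s \<in> {a..b'}" for s using b' that by auto
  obtain b'' \<sigma>' where *: "b' \<le> b''" "quasi_geodesic (5 * K) (2 * (1 + C)) a b'' \<sigma>'"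
    "\<And>t. t \<in> {a..b'} \<Longrightarrow> \<sigma>' t = \<sigma> t" "\<sigma>' b'' = p"
    "\<And>t. t \<in> {b'..b''} \<Longrightarrow> d (\<sigma>' t) p \<le> d (\<sigma> b') p"
    using qg_extend[OF geo \<sigma>1 K C p(2) near] by (metis zero_le_one)
  have e: "\<sigma>' a = \<sigma> a" "\<sigma>' t = \<sigma> t" using * tb t b' by auto
  have r: "quasi_geodesic (5 * K) (2 * (1 + C)) (-b'') (-a) (\<lambda>s. \<sigma>' (-s))" by (rule qg_reverse[OF *(2)])
  have far: "d (\<sigma>' s) (\<sigma> a) > 2 * R' + 1" if "s \<in> {t..b''}" for s
  proof (cases "s \<le> b'")
    case True
    then show ?thesis using fara[of s] *(3)[of s] that b' t by auto
  next
    case False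
    have ms: "\<sigma>' s \<in> M" using qg_in[OF *(2), of s] that t by auto
    have "d (\<sigma>' s) p \<le> R' + 1" using *(5)[of s] False that pb' by (auto simp: commute)
    then have "d (\<sigma>' s) (\<sigma> b) \<le> 2 * R' + 1" using triangle[OF ms p(2) m(2)] p by simp
    then show ?thesis using farab triangle[OF m(3) ms m(2)] by (simp add: commute)
  qed
  have "\<sigma>' (- (- t)) \<in> nbhd (max 0 (N (5 * (5 * K)) (2 * (1 + 2 * (1 + C)) + 2 * 0))) A"
  proof (rule morse_cut[OF geo N _ _ r, where R' = R'])
    show "\<sigma>' (- (- b'')) \<in> nbhd 0 A" using * p by (auto simp: in_nbhd)
    show "\<sigma>' (- (- a)) \<in> nbhd R' A" using a e by simp
    show "- t \<in> {- b''..- a}" using t tb * by auto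
    show "2 * R' + 1 < d (\<sigma>' (- s)) (\<sigma>' (- (- a)))" if "s \<in> {- b''..- t}" for s
      using far[of "-s"] that e by auto
  qed (use K C in auto)
  then show ?thesis using e by (simp add: algebra_simps)
qed

end

section \<open>Coarse rays\<close>

lemma coarse_IVT:
  fixes s :: "real \<Rightarrow> real"
  assumes "a \<le> b" and L: "\<And>t t'. t \<in> {a..b} \<Longrightarrow> t' \<in> {a..b} \<Longrightarrow> \<bar>s t - s t'\<bar> \<le> K * \<bar>t - t'\<bar> + C"
    and "s a \<le> v" "v \<le> s b" and K: "K \<ge> 0"
  obtains t where "t \<in> {a..b}" "\<bar>s t - v\<bar> \<le> K + C"
proof -
  define S where "S = {t \<in> {a..b}. s t \<le> v}"
  have S: "S \<noteq> {}" "bdd_above S" "a \<in> S" using assms by (auto simp: S_def intro!: bdd_aboveI)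
  obtain t1 where t1: "t1 \<in> S" "Sup S - 1/2 < t1" using less_cSup_iff[OF S(1,2), of "Sup S - 1/2"] by auto
  have le: "t \<le> Sup S" if "t \<in> S" for t using cSup_upper[OF that S(2)] .
  have "Sup S \<le> b" using cSup_least[OF S(1)] by (auto simp: S_def)
  define t2 where "t2 = min b (Sup S + 1/2)"
  have t1': "t1 \<in> {a..b}" "s t1 \<le> v" using t1 by (auto simp: S_def)
  have t2': "t2 \<in> {a..b}" "t1 \<le> t2" "t2 - t1 \<le> 1" using t1 t1' le[OF t1(1)] \<open>Sup S \<le> b\<close> \<open>a \<le> b\<close>
    by (auto simp: t2_def)
  have "v \<le> s t2"
  proof (cases "t2 = b")
    case False
    then have "t2 > Sup S" by (auto simp: t2_def min_def)
    then have "t2 \<notin> S" using le by force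
    then show ?thesis using t2' by (auto simp: S_def)
  qed (use assms in simp)
  moreover have "\<bar>s t1 - s t2\<bar> \<le> K * \<bar>t1 - t2\<bar> + C" using L t1' t2' by blast
  moreover have "K * \<bar>t1 - t2\<bar> \<le> K * 1" using t2' K by (intro mult_left_mono) auto
  ultimately show ?thesis using that[OF t1'(1)] t1'(2) by simp
qed

context Metric_space
begin

text \<open>Geodesic rays up to an additive error, so that the origin of a ray may be changed.\<close>

definition coarse_ray :: "real \<Rightarrow> (real \<Rightarrow> 'a) \<Rightarrow> bool" where
  "coarse_ray C \<rho> \<longleftrightarrow> \<rho> ` {0..} \<subseteq> M \<and> (\<forall>s\<ge>0. \<forall>t\<ge>0. \<bar>d (\<rho> s) (\<rho> t) - \<bar>s - t\<bar>\<bar> \<le> C)"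

lemma coarse_rayD:
  assumes "coarse_ray C \<rho>" "s \<ge> 0" "t \<ge> 0"
  shows "\<rho> s \<in> M" "d (\<rho> s) (\<rho> t) \<le> \<bar>s - t\<bar> + C" "\<bar>s - t\<bar> \<le> d (\<rho> s) (\<rho> t) + C"
  using assms unfolding coarse_ray_def by (force simp: abs_le_iff)+

lemma coarse_ray_nonneg: "coarse_ray C \<rho> \<Longrightarrow> C \<ge> 0"
  using order_trans[OF nonneg coarse_rayD(2)[of C \<rho> 0 0]] by simp

lemma coarse_ray_qg:
  assumes "coarse_ray C \<rho>" "0 \<le> a" "a \<le> b"
  shows "quasi_geodesic 1 C a b \<rho>"
proof (rule qgI)
  show "\<rho> t \<in> M" if "t \<in> {a..b}" for t using coarse_rayD(1)[OF assms(1)] that assms(2) by auto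
  show "(t - s) / 1 - C \<le> d (\<rho> s) (\<rho> t) \<and> d (\<rho> s) (\<rho> t) \<le> 1 * (t - s) + C"
    if "s \<in> {a..b}" "t \<in> {a..b}" "s \<le> t" for s t
    using coarse_rayD(2,3)[OF assms(1), of s t] that assms(2) by auto
qed (rule assms(3))

lemma geodesic_ray_coarse: "\<rho> \<in> geodesic_rays e \<Longrightarrow> coarse_ray 0 \<rho>"
  by (auto simp: geodesic_rays_def coarse_ray_def)

lemma N_morse_rays_iff: "\<gamma> \<in> N_morse_rays e N \<longleftrightarrow> \<gamma> \<in> geodesic_rays e \<and> morse_set N (\<gamma> ` {0..})"
  unfolding N_morse_rays_def morse_set_def geodesic_rays_def by auto

text \<open>The parameter of a point of \<open>\<alpha>\<close> close to \<open>\<sigma> t\<close> depends on \<open>t\<close> in a coarsely continuous way, so it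
  cannot skip \<open>v\<close>.\<close>

lemma qg_crossing:
  assumes \<alpha>: "coarse_ray C0 \<alpha>" and \<sigma>: "quasi_geodesic K C a b \<sigma>" and K: "K \<ge> 1" and C: "C \<ge> 0" and R: "R \<ge> 0"
    and sub: "\<And>t. t \<in> {a..b} \<Longrightarrow> \<sigma> t \<in> nbhd R (\<alpha> ` {0..})"
    and sa: "sa \<ge> 0" "d (\<sigma> a) (\<alpha> sa) \<le> R" and sb: "sb \<ge> 0" "d (\<sigma> b) (\<alpha> sb) \<le> R"
    and v: "sa \<le> v \<and> v \<le> sb \<or> sb \<le> v \<and> v \<le> sa"
  obtains t where "t \<in> {a..b}" "d (\<sigma> t) (\<alpha> v) \<le> K + C + 3 * R + 2 * C0"
proof -
  have C0: "C0 \<ge> 0" using coarse_ray_nonneg[OF \<alpha>] .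
  have ab: "a \<le> b" using qg_le[OF \<sigma>] .
  have v0: "v \<ge> 0" using v sa sb by auto
  have step: "d (\<sigma> t) (\<alpha> v) \<le> K + C + 3 * R + 2 * C0" 
    if t: "t \<in> {a..b}" "s \<ge> 0" "d (\<sigma> t) (\<alpha> s) \<le> R" "\<bar>s - v\<bar> \<le> K + (2 * R + C0 + C)" for t s
    using triangle[of "\<sigma> t" "\<alpha> s" "\<alpha> v"] coarse_rayD[OF \<alpha> t(2) v0] coarse_rayD[OF \<alpha> v0 v0] qg_in[OF \<sigma> t(1)] t by simp
  show ?thesis
  proof (cases "a = b")
    case True
    have "\<bar>sa - sb\<bar> \<le> 2 * R + C0"
      using coarse_rayD[OF \<alpha> sa(1) sb(1)] coarse_rayD[OF \<alpha> sb(1) sb(1)] sa sb True qg_in[OF \<sigma>, of a]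
       triangle[of "\<alpha> sa" "\<sigma> a" "\<alpha> sb"] by (simp add: commute)
    then have "\<bar>sa - v\<bar> \<le> K + (2 * R + C0 + C)" using v K C by auto
    then show ?thesis using step[of a sa] sa ab that[of a] by auto
  next
    case False
    have "\<exists>s\<ge>0. d (\<sigma> t) (\<alpha> s) \<le> R" if "t \<in> {a..b}" for t using sub[OF that] by (auto simp: in_nbhd commute)
    then obtain s0 where s0: "\<And>t. t \<in> {a..b} \<Longrightarrow> s0 t \<ge> 0 \<and> d (\<sigma> t) (\<alpha> (s0 t)) \<le> R" by metis
    define s where "s = s0(a := sa, b := sb)"
    have s: "s t \<ge> 0 \<and> d (\<sigma> t) (\<alpha> (s t)) \<le> R" if "t \<in> {a..b}" for t using s0[OF that] sa sb by (auto simp: s_def)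
    have L: "\<bar>s t - s t'\<bar> \<le> K * \<bar>t - t'\<bar> + (2 * R + C0 + C)" if t: "t \<in> {a..b}" "t' \<in> {a..b}" for t t'
    proof -
      have m: "\<sigma> t \<in> M" "\<sigma> t' \<in> M" "\<alpha> (s t) \<in> M" "\<alpha> (s t') \<in> M" using qg_in[OF \<sigma>] t s coarse_rayD[OF \<alpha>] by blast+
      have "\<bar>s t - s t'\<bar> \<le> d (\<alpha> (s t)) (\<alpha> (s t')) + C0" using coarse_rayD(3)[OF \<alpha>] s t by blast
      also have "d (\<alpha> (s t)) (\<alpha> (s t')) \<le> d (\<sigma> t) (\<alpha> (s t)) + d (\<sigma> t) (\<sigma> t') + d (\<sigma> t') (\<alpha> (s t'))"
        using triangle[of "\<alpha> (s t)" "\<sigma> t" "\<alpha> (s t')"] triangle[of "\<sigma> t" "\<sigma> t'" "\<alpha> (s t')"] m by (simp add: commute)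
      also have "\<dots> \<le> R + (K * \<bar>t - t'\<bar> + C) + R" using s t qg_upper[OF \<sigma> t] by (intro add_mono) auto
      finally show ?thesis by simp
    qed
    have e: "s a = sa" "s b = sb" using False by (auto simp: s_def)
    have K0: "K \<ge> 0" using K by simp
    show ?thesis
    proof (cases "sa \<le> v \<and> v \<le> sb")
      case True
      obtain t where "t \<in> {a..b}" "\<bar>s t - v\<bar> \<le> K + (2 * R + C0 + C)"
        using coarse_IVT[OF ab L _ _ K0, of v] True e by metis
      then show ?thesis using step[of t "s t"] s that by blast
    next
      case False
      have L': "\<bar>(- s t) - (- s t')\<bar> \<le> K * \<bar>t - t'\<bar> + (2 * R + C0 + C)" if "t \<in> {a..b}" "t' \<in> {a..b}" for t t'
        using L[OF that] by (simp add: abs_minus_commute)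
      obtain t where "t \<in> {a..b}" "\<bar>- s t - - v\<bar> \<le> K + (2 * R + C0 + C)"
        using coarse_IVT[OF ab L' _ _ K0, of "-v"] False v e by auto
      then show ?thesis using step[of t "s t"] s that by (auto simp: abs_minus_commute)
    qed
  qed
qed

text \<open>Of three points near a ray, one lies between the others, and the side that joins these has to pass it.\<close>

lemma triangle_along_ray:
  assumes \<alpha>: "coarse_ray C0 \<alpha>" and K: "K \<ge> 1" and C: "C \<ge> 0" and R: "R \<ge> 0"
    and \<sigma>1: "quasi_geodesic K C a1 b1 \<sigma>1" "\<sigma>1 a1 = P" "\<sigma>1 b1 = Q" "\<And>t. t \<in> {a1..b1} \<Longrightarrow> \<sigma>1 t \<in> nbhd R (\<alpha> ` {0..})"
    and \<sigma>2: "quasi_geodesic K C a2 b2 \<sigma>2" "\<sigma>2 a2 = Q" "\<sigma>2 b2 = S" "\<And>t. t \<in> {a2..b2} \<Longrightarrow> \<sigma>2 t \<in> nbhd R (\<alpha> ` {0..})"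
    and \<sigma>3: "quasi_geodesic K C a3 b3 \<sigma>3" "\<sigma>3 a3 = P" "\<sigma>3 b3 = S" "\<And>t. t \<in> {a3..b3} \<Longrightarrow> \<sigma>3 t \<in> nbhd R (\<alpha> ` {0..})"
  shows "(\<exists>t\<in>{a1..b1}. d (\<sigma>1 t) S \<le> K + C + 4 * R + 2 * C0) \<or> (\<exists>t\<in>{a2..b2}. d (\<sigma>2 t) P \<le> K + C + 4 * R + 2 * C0)
     \<or> (\<exists>t\<in>{a3..b3}. d (\<sigma>3 t) Q \<le> K + C + 4 * R + 2 * C0)"
proof -
  have ab: "a1 \<le> b1" "a2 \<le> b2" "a3 \<le> b3" using \<sigma>1 \<sigma>2 \<sigma>3 qg_le by blast+
  have mem: "P \<in> M" "Q \<in> M" "S \<in> M" using qg_in[OF \<sigma>1(1), of a1] qg_in[OF \<sigma>1(1), of b1] qg_in[OF \<sigma>2(1), of b2]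
    ab \<sigma>1 \<sigma>2 by auto
  obtain p where p: "p \<ge> 0" "d P (\<alpha> p) \<le> R" using \<sigma>1(4)[of a1] ab \<sigma>1 by (auto simp: in_nbhd commute)
  obtain q where q: "q \<ge> 0" "d Q (\<alpha> q) \<le> R" using \<sigma>1(4)[of b1] ab \<sigma>1 by (auto simp: in_nbhd commute)
  obtain s where s: "s \<ge> 0" "d S (\<alpha> s) \<le> R" using \<sigma>2(4)[of b2] ab \<sigma>2 by (auto simp: in_nbhd commute)
  have fin: "d u W \<le> K + C + 4 * R + 2 * C0" if "d u (\<alpha> w) \<le> K + C + 3 * R + 2 * C0" "d W (\<alpha> w) \<le> R" "u \<in> M" "W \<in> M"
    "w \<ge> 0" for u W w
    using triangle[of u "\<alpha> w" W] that coarse_rayD(1)[OF \<alpha>] by (simp add: commute)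
  consider "p \<le> s \<and> s \<le> q \<or> q \<le> s \<and> s \<le> p" | "q \<le> p \<and> p \<le> s \<or> s \<le> p \<and> p \<le> q" | "p \<le> q \<and> q \<le> s \<or> s \<le> q \<and> q \<le> p"
    by linarith
  then show ?thesis
  proof cases
    case 1
    obtain t where "t \<in> {a1..b1}" "d (\<sigma>1 t) (\<alpha> s) \<le> K + C + 3 * R + 2 * C0"
      using qg_crossing[OF \<alpha> \<sigma>1(1) K C R \<sigma>1(4), of p q s] p q 1 \<sigma>1 by metis
    then show ?thesis using fin[of "\<sigma>1 t" s S] s mem qg_in[OF \<sigma>1(1)] by blast
  next
    case 2
    obtain t where "t \<in> {a2..b2}" "d (\<sigma>2 t) (\<alpha> p) \<le> K + C + 3 * R + 2 * C0"
      using qg_crossing[OF \<alpha> \<sigma>2(1) K C R \<sigma>2(4), of q s p] q s 2 \<sigma>2 by metis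
    then show ?thesis using fin[of "\<sigma>2 t" p P] p mem qg_in[OF \<sigma>2(1)] by blast
  next
    case 3
    obtain t where "t \<in> {a3..b3}" "d (\<sigma>3 t) (\<alpha> q) \<le> K + C + 3 * R + 2 * C0"
      using qg_crossing[OF \<alpha> \<sigma>3(1) K C R \<sigma>3(4), of p s q] p s 3 \<sigma>3 by metis
    then show ?thesis using fin[of "\<sigma>3 t" q Q] q mem qg_in[OF \<sigma>3(1)] by blast
  qed
qed

end

section \<open>Plane triangles\<close>

definition straight :: "complex \<Rightarrow> complex \<Rightarrow> real \<Rightarrow> complex" where
  "straight u v t = u + of_real t * sgn (v - u)"

text \<open>The apex of a right-angled isosceles triangle with hypotenuse \<open>[u, v]\<close>.\<close>

definition corner :: "complex \<Rightarrow> complex \<Rightarrow> complex" where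
  "corner u v = u + (v - u) * (1 - \<i>) / 2"

lemma straight_0: "straight u v 0 = u" and straight_end: "straight u v (cmod (v - u)) = v"
  by (simp_all add: straight_def sgn_eq)

lemma straight_dist: "u \<noteq> v \<Longrightarrow> cmod (straight u v s - straight u v t) = \<bar>s - t\<bar>"
proof -
  assume "u \<noteq> v"
  have "straight u v s - straight u v t = of_real (s - t) * sgn (v - u)" by (simp add: straight_def algebra_simps)
  then show ?thesis using \<open>u \<noteq> v\<close> by (simp add: norm_mult norm_sgn del: of_real_diff)
qed

lemma straight_conv:
  assumes "t \<in> {0..cmod (v - u)}"
  obtains r where "r \<in> {0..1}" "straight u v t = u + of_real r * (v - u)"
proof (cases "u = v")
  case True
  then show ?thesis using that[of 0] by (simp add: straight_def)
next
  case False
  then show ?thesis using that[of "t / cmod (v - u)"] assms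
    by (auto simp: straight_def sgn_eq field_simps)
qed

lemma corner_dist: "cmod (corner u v - u) = cmod (v - u) / sqrt 2" "cmod (v - corner u v) = cmod (v - u) / sqrt 2"
proof -
  have a: "cmod (1 - \<i>) = sqrt 2" "cmod (1 + \<i>) = sqrt 2" by (auto simp: cmod_def)
  have e: "v - corner u v = (v - u) * (1 + \<i>) / 2" by (simp add: corner_def field_simps)
  show "cmod (corner u v - u) = cmod (v - u) / sqrt 2" 
    by (simp add: corner_def norm_mult norm_divide a) (simp add: field_simps)
  show "cmod (v - corner u v) = cmod (v - u) / sqrt 2"
    by (simp add: e norm_mult norm_divide a) (simp add: field_simps)
qed

text \<open>All the points are affine combinations of \<open>u\<close> and \<open>v\<close> with explicit complex coefficients, so each claim
  is about the modulus of such a coefficient. The last claim is what makes the route along the two legs a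
    quasi-geodesic:
  seen from the first leg, the corner is the nearest point of the second.\<close>

lemma corner_heights:
  fixes u v :: complex
  defines "c \<equiv> corner u v" and "D \<equiv> cmod (v - u)"
  shows "t \<in> {0..cmod (c - u)} \<Longrightarrow> cmod (straight u c t - v) \<ge> D / 2"
    and "t \<in> {0..cmod (v - c)} \<Longrightarrow> cmod (straight c v t - u) \<ge> D / 2"
    and "t \<in> {0..D} \<Longrightarrow> cmod (straight u v t - c) \<ge> D / 2"
    and "s \<in> {0..cmod (c - u)} \<Longrightarrow> t \<in> {0..cmod (v - c)} \<Longrightarrow> cmod (straight u c s - c) \<le> cmod (straight u c s -
      straight c v t)"
proof -
  have cu: "c - u = (1 - \<i>) / 2 * (v - u)" and vc: "v - c = (1 + \<i>) / 2 * (v - u)"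
    by (simp_all add: c_def corner_def field_simps)
  have key: "cmod z \<ge> 1 / 2" if "Re z * Re z + Im z * Im z \<ge> 1/4" for z
  proof -
    have "sqrt (1/4) \<le> sqrt ((Re z)\<^sup>2 + (Im z)\<^sup>2)" using that
      by (intro real_sqrt_le_mono) (simp add: power2_eq_square)
    moreover have "sqrt (1/4) = (1/2::real)" by (simp add: real_sqrt_divide)
    ultimately show ?thesis by (simp add: cmod_def)
  qed
  have mul: "cmod (z * (v - u)) \<ge> D / 2" if "Re z * Re z + Im z * Im z \<ge> 1/4" for z
    using mult_right_mono[OF key[OF that], of D] by (simp add: norm_mult D_def)
  have sq: "x * x + y * y \<ge> 1/4" if "x + y \<ge> 1 \<or> x \<ge> 1/2 \<or> y \<ge> 1/2 \<or> x \<le> -1/2 \<or> y \<le> -1/2 \<or> x + y \<le> -1 \<or> x - y \<ge> 1 \<or> x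
    - y \<le> -1" for x y :: real
  proof -
    have "x * x + y * y \<ge> 1/4" if "x \<ge> 1/2 \<or> x \<le> -1/2" for x y :: real
    proof -
      have "\<bar>1/2\<bar> \<le> \<bar>x\<bar>" using that by auto
      then have "(1/2)^2 \<le> x^2" using abs_le_square_iff by blast
      then show ?thesis by (simp add: power2_eq_square) (smt (verit) zero_le_square)
    qed
    from this[of x y] this[of y x] that show ?thesis by (smt (verit) field_sum_of_halves)
  qed
  {
    assume "t \<in> {0..cmod (c - u)}"
    then obtain r where r: "r \<in> {0..1}" "straight u c t = u + of_real r * (c - u)" by (rule straight_conv)
    have "straight u c t - v = of_real r * (c - u) - (v - u)" using r by simp
    also have "\<dots> = (of_real r * (1 - \<i>) / 2 - 1) * (v - u)" unfolding cu by (simp add: field_simps)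
    finally have "straight u c t - v = (of_real r * (1 - \<i>) / 2 - 1) * (v - u)" .
    then show "cmod (straight u c t - v) \<ge> D / 2" using mul[of "of_real r * (1 - \<i>) / 2 - 1"] sq[of "r/2-1" "-r/2"] r
      by simp
  }
  {
    assume "t \<in> {0..cmod (v - c)}"
    then obtain r where r: "r \<in> {0..1}" "straight c v t = c + of_real r * (v - c)" by (rule straight_conv)
    have "straight c v t - u = (c - u) + of_real r * (v - c)" using r by simp
    also have "\<dots> = ((1 - \<i>) / 2 + of_real r * (1 + \<i>) / 2) * (v - u)" unfolding cu vc by (simp add: field_simps)
    finally have "straight c v t - u = ((1 - \<i>) / 2 + of_real r * (1 + \<i>) / 2) * (v - u)" .
    then show "cmod (straight c v t - u) \<ge> D / 2" using mul[of "(1 - \<i>) / 2 + of_real r * (1 + \<i>) / 2"] sq[of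
      "1/2+r/2" "r/2-1/2"] r by simp
  }
  {
    assume "t \<in> {0..D}"
    then obtain r where r: "r \<in> {0..1}" "straight u v t = u + of_real r * (v - u)" unfolding D_def
      by (rule straight_conv)
    have "straight u v t - c = of_real r * (v - u) - (c - u)" using r by simp
    also have "\<dots> = (of_real r - (1 - \<i>) / 2) * (v - u)" unfolding cu by (simp add: field_simps)
    finally have "straight u v t - c = (of_real r - (1 - \<i>) / 2) * (v - u)" .
    then show "cmod (straight u v t - c) \<ge> D / 2" using mul[of "of_real r - (1 - \<i>) / 2"] sq[of "r-1/2" "1/2"] r
      by simp
  }
  {
    assume "s \<in> {0..cmod (c - u)}" "t \<in> {0..cmod (v - c)}"
    then obtain r r' where r: "r \<in> {0..1}" "straight u c s = u + of_real r * (c - u)"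
      and r': "straight c v t = c + of_real r' * (v - c)"
      by (metis straight_conv)
    have 1: "straight u c s - c = of_real (r - 1) * (c - u)" unfolding r by (simp add: algebra_simps)
    have cv: "v - c = \<i> * (c - u)" by (simp add: c_def corner_def field_simps)
    have 2: "straight u c s - straight c v t = (of_real (r - 1) - of_real r' * \<i>) * (c - u)" unfolding r r' cv
      by (simp add: algebra_simps)
    have "cmod (of_real (r - 1)) \<le> cmod (of_real (r - 1) - of_real r' * \<i>)"
      using abs_Re_le_cmod[of "of_real (r - 1) - of_real r' * \<i>"] by (simp only: norm_of_real) simp
    then show "cmod (straight u c s - c) \<le> cmod (straight u c s - straight c v t)"
      unfolding 1 2 norm_mult by (intro mult_right_mono) auto
  }
qed

context Metric_space
begin

section \<open>Quasi-planes and Morse rays\<close>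

definition quasi_plane :: "real \<Rightarrow> real \<Rightarrow> (complex \<Rightarrow> 'a) \<Rightarrow> bool" where
  "quasi_plane K C q \<longleftrightarrow> K \<ge> 1 \<and> C \<ge> 0 \<and> range q \<subseteq> M \<and>
     (\<forall>u v. cmod (u - v) / K - C \<le> d (q u) (q v) \<and> d (q u) (q v) \<le> K * cmod (u - v) + C)"

lemma quasi_plane_straight:
  assumes "quasi_plane K C q"
  shows "quasi_geodesic K C 0 (cmod (v - u)) (\<lambda>t. q (straight u v t))"
proof (rule qgI)
  fix s t assume st: "s \<in> {0..cmod (v - u)}" "t \<in> {0..cmod (v - u)}" "s \<le> t"
  have "cmod (straight u v s - straight u v t) = t - s" using straight_dist[of u v s t] st by (cases "u = v") auto
  then show "(t - s) / K - C \<le> d (q (straight u v s)) (q (straight u v t)) \<and>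
       d (q (straight u v s)) (q (straight u v t)) \<le> K * (t - s) + C" using assms unfolding quasi_plane_def by metis
qed (use assms in \<open>auto simp: quasi_plane_def\<close>)

text \<open>By \<open>triangle_along_ray\<close> some vertex would be close to the opposite side, but the heights of the triangle are
  at least half of its hypotenuse.\<close>

lemma plane_triangle_not_along_ray:
  assumes q: "quasi_plane K C q" and \<alpha>: "coarse_ray C0 \<alpha>" and R: "R \<ge> 0"
    and 1: "\<And>t. t \<in> {0..cmod (v - u)} \<Longrightarrow> q (straight u v t) \<in> nbhd R (\<alpha> ` {0..})"
    and 2: "\<And>t. t \<in> {0..cmod (corner u v - u)} \<Longrightarrow> q (straight u (corner u v) t) \<in> nbhd R (\<alpha> ` {0..})"
    and 3: "\<And>t. t \<in> {0..cmod (v - corner u v)} \<Longrightarrow> q (straight (corner u v) v t) \<in> nbhd R (\<alpha> ` {0..})"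
  shows "cmod (v - u) \<le> 2 * K * (K + 2 * C + 4 * R + 2 * C0)"
proof -
  have K: "K \<ge> 1" "C \<ge> 0" using q by (auto simp: quasi_plane_def)
  let ?c = "corner u v"
  have e: "(\<lambda>t. q (straight x y t)) 0 = q x" "(\<lambda>t. q (straight x y t)) (cmod (y - x)) = q y" for x y
    by (simp_all add: straight_0 straight_end)
  have fin: ?thesis if "d (q x) (q y) \<le> K + C + 4 * R + 2 * C0" "cmod (x - y) \<ge> cmod (v - u) / 2" for x y
  proof -
    have "cmod (x - y) / K - C \<le> d (q x) (q y)" using q by (auto simp: quasi_plane_def)
    then have "cmod (x - y) / K \<le> K + 2 * C + 4 * R + 2 * C0" using that by simp
    then have "cmod (x - y) \<le> K * (K + 2 * C + 4 * R + 2 * C0)" using K by (simp add: field_simps)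
    then show ?thesis using that by simp
  qed
  from triangle_along_ray[OF \<alpha> K R quasi_plane_straight[OF q] e 2 quasi_plane_straight[OF q] e 3
    quasi_plane_straight[OF q] e 1]
  show ?thesis using corner_heights[where u = u and v = v] fin by blast
qed

text \<open>The straight route and the route around the corner, both continued to \<open>p\<close>. The constants depend on those
  of the quasi-plane only, which makes the conclusions below uniform.\<close>

lemma plane_routes_to_point:
  assumes K: "K \<ge> 1" and C: "C \<ge> 0" and geo: geodesic_space
  obtains K1 C1 where "K1 \<ge> 1" "C1 \<ge> 0"
    "\<And>q u v p. quasi_plane K C q \<Longrightarrow> p \<in> M \<Longrightarrow> (\<And>v'. d p (q v) \<le> d p (q v') + 1) \<Longrightarrow>
      \<exists>b \<sigma>. cmod (v - u) \<le> b \<and> quasi_geodesic K1 C1 0 b \<sigma> \<and> \<sigma> b = p \<and> (\<forall>t\<in>{0..cmod (v - u)}. \<sigma> t = q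
        (straight u v t))"
    "\<And>q u v p. quasi_plane K C q \<Longrightarrow> p \<in> M \<Longrightarrow> (\<And>v'. d p (q v) \<le> d p (q v') + 1) \<Longrightarrow>
      \<exists>b \<sigma>. cmod (corner u v - u) + cmod (v - corner u v) \<le> b \<and> quasi_geodesic K1 C1 0 b \<sigma> \<and> \<sigma> b = p \<and>
         (\<forall>t\<in>{0..cmod (corner u v - u)}. \<sigma> t = q (straight u (corner u v) t)) \<and>
         (\<forall>t\<in>{0..cmod (v - corner u v)}. \<sigma> (cmod (corner u v - u) + t) = q (straight (corner u v) v t))"
proof -
  define B where "B = K * K * C + C"
  define K0 where "K0 = K * (2 * (K * K) + 1)"
  define C0 where "C0 = 2 * (B + C)"
  have B: "B \<ge> 0" "C0 \<ge> 0" "B \<ge> C" using K C by (auto simp: B_def C0_def)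
  have kk: "K * K \<ge> 1" using K mult_mono[of 1 K 1 K] by simp
  have "K * 1 \<le> K0" unfolding K0_def using K kk by (intro mult_left_mono) auto
  then have K0: "K0 \<ge> 1" "K \<le> K0" using K by auto
  have C0: "C \<le> C0" using B C by (auto simp: C0_def)
  show ?thesis
  proof (rule that[of "5 * K0" "2 * (1 + C0)"])
    show "5 * K0 \<ge> 1" "2 * (1 + C0) \<ge> 0" using K0 B by auto
    fix q u v p assume q: "quasi_plane K C q" and p: "p \<in> M" and near: "\<And>v'. d p (q v) \<le> d p (q v') + 1"
    have s: "quasi_geodesic K0 C0 0 (cmod (v - u)) (\<lambda>t. q (straight u v t))"
      by (rule qg_mono[OF quasi_plane_straight[OF q] K K0(2) C0])
    have n1: "d p (q (straight u v (cmod (v - u)))) \<le> d p (q (straight u v t)) + 1" for t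
      using near by (simp add: straight_end)
    obtain b' \<sigma>' where "cmod (v - u) \<le> b'" "quasi_geodesic (5 * K0) (2 * (1 + C0)) 0 b' \<sigma>'" "\<sigma>' b' = p"
      "\<And>t. t \<in> {0..cmod (v - u)} \<Longrightarrow> \<sigma>' t = q (straight u v t)"
      using qg_extend[OF geo s K0(1) B(2) p n1] by (metis zero_le_one)
    then show "\<exists>b \<sigma>. cmod (v - u) \<le> b \<and> quasi_geodesic (5 * K0) (2 * (1 + C0)) 0 b \<sigma> \<and> \<sigma> b = p \<and> (\<forall>t\<in>{0..cmod (v -
      u)}. \<sigma> t = q (straight u v t))"
      by blast
    let ?c = "corner u v"
    let ?l = "cmod (?c - u)" and ?m = "cmod (v - ?c)"
    have 1: "quasi_geodesic K C 0 ?l (\<lambda>t. q (straight u ?c t))" by (rule quasi_plane_straight[OF q])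
    have 2: "quasi_geodesic K C ?l (?l + ?m) (\<lambda>t. q (straight ?c v (t - ?l)))"
      using qg_shift[OF quasi_plane_straight[OF q, of v ?c], of ?l] by (simp add: add.commute)
    have far: "d (q (straight u ?c s)) (q (straight u ?c ?l)) \<le> K * K * d (q (straight u ?c s)) (q (straight ?c v
      (t - ?l))) + B"
      if "s \<in> {0..?l}" "t \<in> {?l..?l + ?m}" for s t
    proof -
      let ?x = "straight u ?c s" and ?y = "straight ?c v (t - ?l)"
      have h: "cmod (?x - ?c) \<le> cmod (?x - ?y)" using corner_heights(4)[of s u v "t - ?l"] that by auto
      have up: "d (q ?x) (q ?c) \<le> K * cmod (?x - ?c) + C" using q by (auto simp: quasi_plane_def)
      have "cmod (?x - ?y) / K - C \<le> d (q ?x) (q ?y)" using q by (auto simp: quasi_plane_def)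
      then have "cmod (?x - ?y) \<le> K * (d (q ?x) (q ?y) + C)" using K by (simp add: field_simps)
      then have "K * cmod (?x - ?c) \<le> K * (K * (d (q ?x) (q ?y) + C))" using K h by (intro mult_left_mono) auto
      then show ?thesis using up by (simp add: straight_end B_def algebra_simps)
    qed
    have L: "quasi_geodesic K0 C0 0 (?l + ?m) (\<lambda>t. if t \<le> ?l then q (straight u ?c t) else q (straight ?c v (t -
      ?l)))" (is "quasi_geodesic _ _ _ _ ?f")
      unfolding K0_def C0_def
      by (rule qg_concat[OF 1 2 _ K C _ B(1) far]) (use kk in \<open>auto simp: straight_end straight_0\<close>)
    have fe: "?f (?l + t) = q (straight ?c v t)" if "t \<in> {0..?m}" for t
      using that by (cases "t = 0") (auto simp: straight_end straight_0)
    have n2: "d p (?f (?l + ?m)) \<le> d p (?f t) + 1" for t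
    proof -
      have "?f (?l + ?m) = q v" using fe[of ?m] by (simp add: straight_end)
      then show ?thesis using near by (cases "t \<le> ?l") auto
    qed
    obtain b' \<sigma>' where *: "?l + ?m \<le> b'" "quasi_geodesic (5 * K0) (2 * (1 + C0)) 0 b' \<sigma>'" "\<sigma>' b' = p"
      "\<And>t. t \<in> {0..?l + ?m} \<Longrightarrow> \<sigma>' t = ?f t"
      using qg_extend[OF geo L K0(1) B(2) p n2] by (metis zero_le_one)
    have "\<sigma>' t = q (straight u ?c t)" if "t \<in> {0..?l}" for t
      using *(4)[of t] that by (simp add: add_increasing2)
    moreover have "\<sigma>' (?l + t) = q (straight ?c v t)" if "t \<in> {0..?m}" for t
      using *(4)[of "?l + t"] fe[OF that] that by simp
    ultimately show "\<exists>b \<sigma>. ?l + ?m \<le> b \<and> quasi_geodesic (5 * K0) (2 * (1 + C0)) 0 b \<sigma> \<and> \<sigma> b = p \<and>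
         (\<forall>t\<in>{0..?l}. \<sigma> t = q (straight u ?c t)) \<and> (\<forall>t\<in>{0..?m}. \<sigma> (?l + t) = q (straight ?c v t))"
      using * by blast
  qed
qed

definition isometry :: "('a \<Rightarrow> 'a) \<Rightarrow> bool" where
  "isometry \<phi> \<longleftrightarrow> \<phi> ` M \<subseteq> M \<and> (\<forall>p\<in>M. \<forall>q\<in>M. d (\<phi> p) (\<phi> q) = d p q)"

lemma isometryD: "isometry \<phi> \<Longrightarrow> p \<in> M \<Longrightarrow> \<phi> p \<in> M" "isometry \<phi> \<Longrightarrow> p \<in> M \<Longrightarrow> q \<in> M \<Longrightarrow> d (\<phi> p) (\<phi> q) = d p q"
  by (auto simp: isometry_def)

lemma isometry_qg: "isometry \<phi> \<Longrightarrow> quasi_geodesic K C a b \<sigma> \<Longrightarrow> quasi_geodesic K C a b (\<lambda>t. \<phi> (\<sigma> t))"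
  unfolding quasi_geodesic_def by (simp add: image_subset_iff isometryD)

lemma isometry_coarse_ray: "isometry \<phi> \<Longrightarrow> coarse_ray C \<sigma> \<Longrightarrow> coarse_ray C (\<lambda>t. \<phi> (\<sigma> t))"
  unfolding coarse_ray_def by (simp add: image_subset_iff isometryD)

lemma isometry_quasi_plane: "isometry \<phi> \<Longrightarrow> quasi_plane K C q \<Longrightarrow> quasi_plane K C (\<lambda>t. \<phi> (q t))"
  unfolding quasi_plane_def by (simp add: image_subset_iff isometryD(1)) (simp add: isometryD(2))

lemma isometry_nbhd: "isometry \<phi> \<Longrightarrow> v \<in> nbhd R A \<Longrightarrow> \<phi> v \<in> nbhd R (\<phi> ` A)"
  unfolding in_nbhd by (metis image_eqI isometryD)

lemma coarse_ray_image_subset: "coarse_ray C \<rho> \<Longrightarrow> \<rho> ` {0..} \<subseteq> M"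
  by (simp add: coarse_ray_def)

lemma straight_bound:
  assumes "t \<in> {0..cmod (w - u)}"
  shows "cmod (straight u w t) \<le> cmod u + cmod (w - u)"
proof -
  obtain r where r: "r \<in> {0..1}" "straight u w t = u + of_real r * (w - u)" using straight_conv[OF assms] .
  have "cmod (of_real r * (w - u)) \<le> 1 * cmod (w - u)" unfolding norm_mult using r by (intro mult_right_mono) auto
  then show ?thesis unfolding r using norm_triangle_ineq[of u "of_real r * (w - u)"] by simp
qed

text \<open>The two routes from \<open>q 0\<close> to \<open>\<sigma> T\<close> through an almost nearest point \<open>q v\<close> are quasi-geodesics that start
  near the Morse ray \<open>\<sigma>\<close> and end on it. So they stay near it, and their triangle is small.\<close>

lemma morse_ray_projects_boundedly:
  assumes geo: geodesic_space and q: "quasi_plane K C q" and \<sigma>: "coarse_ray C0 \<sigma>" and N: "morse_set N (\<sigma> ` {0..})"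
  obtains B where "\<And>T v. T \<ge> 0 \<Longrightarrow> (\<And>v'. d (\<sigma> T) (q v) \<le> d (\<sigma> T) (q v') + 1) \<Longrightarrow> cmod v \<le> B"
proof -
  have K: "K \<ge> 1" "C \<ge> 0" using q by (auto simp: quasi_plane_def)
  have qm: "q x \<in> M" for x using q by (auto simp: quasi_plane_def)
  obtain K1 C1 where K1: "K1 \<ge> 1" "C1 \<ge> 0" and
    path: "\<And>q u v p. quasi_plane K C q \<Longrightarrow> p \<in> M \<Longrightarrow> (\<And>v'. d p (q v) \<le> d p (q v') + 1) \<Longrightarrow>
      \<exists>b \<sigma>. cmod (v - u) \<le> b \<and> quasi_geodesic K1 C1 0 b \<sigma> \<and> \<sigma> b = p \<and> (\<forall>t\<in>{0..cmod (v - u)}. \<sigma> t = q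
        (straight u v t))"
    "\<And>q u v p. quasi_plane K C q \<Longrightarrow> p \<in> M \<Longrightarrow> (\<And>v'. d p (q v) \<le> d p (q v') + 1) \<Longrightarrow>
      \<exists>b \<sigma>. cmod (corner u v - u) + cmod (v - corner u v) \<le> b \<and> quasi_geodesic K1 C1 0 b \<sigma> \<and> \<sigma> b = p \<and>
         (\<forall>t\<in>{0..cmod (corner u v - u)}. \<sigma> t = q (straight u (corner u v) t)) \<and>
         (\<forall>t\<in>{0..cmod (v - corner u v)}. \<sigma> (cmod (corner u v - u) + t) = q (straight (corner u v) v t))"
    using plane_routes_to_point[OF K geo] by blast
  define R0 where "R0 = d (\<sigma> 0) (q 0)"
  define R where "R = max R0 (N K1 (C1 + 2 * R0))"
  have R0: "R0 \<ge> 0" "R \<ge> 0" by (auto simp: R0_def R_def le_max_iff_disj)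
  show ?thesis
  proof (rule that)
    fix T v assume T: "T \<ge> 0" and near: "\<And>v'. d (\<sigma> T) (q v) \<le> d (\<sigma> T) (q v') + 1"
    have m: "\<sigma> T \<in> M" "\<sigma> 0 \<in> M" using coarse_rayD[OF \<sigma>] T by auto
    have e0: "q 0 \<in> nbhd R0 (\<sigma> ` {0..})" using m qm by (auto simp: in_nbhd R0_def intro!: bexI[of _ "\<sigma> 0"])
    have e1: "\<sigma> T \<in> nbhd R0 (\<sigma> ` {0..})" using m T R0 by (auto simp: in_nbhd intro!: bexI[of _ "\<sigma> T"])
    obtain b1 \<tau>1 where 1: "cmod (v - 0) \<le> b1" "quasi_geodesic K1 C1 0 b1 \<tau>1" "\<tau>1 b1 = \<sigma> T"
      "\<forall>t\<in>{0..cmod (v - 0)}. \<tau>1 t = q (straight 0 v t)"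
      using path(1)[of q "\<sigma> T" v 0, OF q m(1) near] by blast
    obtain b2 \<tau>2 where 2: "cmod (corner 0 v - 0) + cmod (v - corner 0 v) \<le> b2"
      "quasi_geodesic K1 C1 0 b2 \<tau>2" "\<tau>2 b2 = \<sigma> T"
       "\<forall>t\<in>{0..cmod (corner 0 v - 0)}. \<tau>2 t = q (straight 0 (corner 0 v) t)"
       "\<forall>t\<in>{0..cmod (v - corner 0 v)}. \<tau>2 (cmod (corner 0 v - 0) + t) = q (straight (corner 0 v) v t)"
      using path(2)[of q "\<sigma> T" v 0, OF q m(1) near] by blast
    have t1: "\<tau>1 t \<in> nbhd R (\<sigma> ` {0..})" if "t \<in> {0..b1}" for t unfolding R_def
      by (rule morse_near[OF N K1 1(2) _ _ R0(1) that]) (use 1(3) 1(4)[rule_format, of 0] e0 e1 in \<open>auto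
        simp: straight_0\<close>)
    have t2: "\<tau>2 t \<in> nbhd R (\<sigma> ` {0..})" if "t \<in> {0..b2}" for t unfolding R_def
      by (rule morse_near[OF N K1 2(2) _ _ R0(1) that]) (use 2(3) 2(4)[rule_format, of 0] e0 e1 in \<open>auto
        simp: straight_0\<close>)
    have "cmod (v - 0) \<le> 2 * K * (K + 2 * C + 4 * R + 2 * C0)"
    proof (rule plane_triangle_not_along_ray[OF q \<sigma> R0(2)])
      show "q (straight 0 v t) \<in> nbhd R (\<sigma> ` {0..})" if "t \<in> {0..cmod (v - 0)}" for t
        using t1[of t] 1 that by auto
      show "q (straight 0 (corner 0 v) t) \<in> nbhd R (\<sigma> ` {0..})" if "t \<in> {0..cmod (corner 0 v - 0)}" for t
        using t2[of t] 2(1,4) that norm_ge_zero[of "v - corner 0 v"] by (smt (verit) atLeastAtMost_iff)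
      show "q (straight (corner 0 v) v t) \<in> nbhd R (\<sigma> ` {0..})" if "t \<in> {0..cmod (v - corner 0 v)}" for t
        using t2[of "cmod (corner 0 v - 0) + t"] 2(1,5) that norm_ge_zero[of "corner 0 v - 0"]
          by (smt (verit) atLeastAtMost_iff)
    qed
    then show "cmod v \<le> 2 * K * (K + 2 * C + 4 * R + 2 * C0)" by simp
  qed
qed

text \<open>Let \<open>q v\<close> be almost nearest to \<open>\<sigma> T\<close> for some large \<open>T\<close>; then \<open>v\<close> is bounded independently of \<open>T\<close>.
  The isometry \<open>\<phi>\<close>
  carries the two routes from \<open>q u\<close> through \<open>q v\<close> to \<open>\<sigma> T\<close> to routes that start near the origin of
  \<open>\<alpha>\<close> and end at distance at most \<open>R'\<close> from \<open>\<alpha>\<close>. By \<open>morse_cut\<close> their parts in the quasi-plane are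
  uniformly near \<open>\<alpha>\<close>, since \<open>\<sigma> T\<close> is far from the quasi-plane. So \<open>u\<close> is close to \<open>v\<close>.\<close>

lemma flat_translates_not_uniformly_morse:
  assumes geo: geodesic_space and q: "quasi_plane K C q" and \<sigma>: "coarse_ray C0 \<sigma>" and N0: "morse_set N0 (\<sigma> ` {0..})"
    and R: "R \<ge> 0"
  obtains D where "\<And>u \<phi> \<alpha> R'. isometry \<phi> \<Longrightarrow> coarse_ray C1 \<alpha> \<Longrightarrow> morse_set N (\<alpha> ` {0..}) \<Longrightarrow> \<phi> (q u) \<in> nbhd R (\<alpha> ` {0..})
     \<Longrightarrow> (\<lambda>t. \<phi> (\<sigma> t)) ` {0..} \<subseteq> nbhd R' (\<alpha> ` {0..}) \<Longrightarrow> cmod u \<le> D"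
proof -
  have K: "K \<ge> 1" "C \<ge> 0" using q by (auto simp: quasi_plane_def)
  have qm: "q x \<in> M" for x using q by (auto simp: quasi_plane_def)
  obtain B where B: "\<And>T v. T \<ge> 0 \<Longrightarrow> (\<And>v'. d (\<sigma> T) (q v) \<le> d (\<sigma> T) (q v') + 1) \<Longrightarrow> cmod v \<le> B"
    using morse_ray_projects_boundedly[OF geo q \<sigma> N0] by metis
  obtain K1 C2 where K1: "K1 \<ge> 1" "C2 \<ge> 0" and
    path: "\<And>q u v p. quasi_plane K C q \<Longrightarrow> p \<in> M \<Longrightarrow> (\<And>v'. d p (q v) \<le> d p (q v') + 1) \<Longrightarrow>
      \<exists>b \<sigma>. cmod (v - u) \<le> b \<and> quasi_geodesic K1 C2 0 b \<sigma> \<and> \<sigma> b = p \<and> (\<forall>t\<in>{0..cmod (v - u)}. \<sigma> t = q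
        (straight u v t))"
    "\<And>q u v p. quasi_plane K C q \<Longrightarrow> p \<in> M \<Longrightarrow> (\<And>v'. d p (q v) \<le> d p (q v') + 1) \<Longrightarrow>
      \<exists>b \<sigma>. cmod (corner u v - u) + cmod (v - corner u v) \<le> b \<and> quasi_geodesic K1 C2 0 b \<sigma> \<and> \<sigma> b = p \<and>
         (\<forall>t\<in>{0..cmod (corner u v - u)}. \<sigma> t = q (straight u (corner u v) t)) \<and>
         (\<forall>t\<in>{0..cmod (v - corner u v)}. \<sigma> (cmod (corner u v - u) + t) = q (straight (corner u v) v t))"
    using plane_routes_to_point[OF K geo] by blast
  define R2 where "R2 = max R (N (5 * K1) (2 * (1 + C2) + 2 * R))"
  have R2: "R2 \<ge> 0" using R by (auto simp: R2_def)
  define D where "D = 2 * K * (K + 2 * C + 4 * R2 + 2 * C1) + B"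
  show ?thesis
  proof (rule that)
    fix u \<phi> \<alpha> R' assume \<phi>: "isometry \<phi>" and \<alpha>: "coarse_ray C1 \<alpha>" and N: "morse_set N (\<alpha> ` {0..})"
      and start: "\<phi> (q u) \<in> nbhd R (\<alpha> ` {0..})" and end': "(\<lambda>t. \<phi> (\<sigma> t)) ` {0..} \<subseteq> nbhd R' (\<alpha> ` {0..})"
    have q': "quasi_plane K C (\<lambda>t. \<phi> (q t))" by (rule isometry_quasi_plane[OF \<phi> q])
    \<comment> \<open>\<open>W\<close> bounds all points of the triangle \<open>u, corner u v, v\<close>, and \<open>T\<close> is chosen so that \<open>\<sigma> T\<close> is
      farther than \<open>2 * R' + 1\<close> from the corresponding part of the quasi-plane.\<close>
    define W where "W = 3 * cmod u + 2 * B"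
    define T where "T = \<bar>2 * R' + 2 + C0 + d (\<sigma> 0) (q 0) + K * W + C\<bar>"
    have T: "T \<ge> 0" by (simp add: T_def)
    have m: "\<sigma> T \<in> M" "\<sigma> 0 \<in> M" using coarse_rayD[OF \<sigma>] T by auto
    obtain v where v: "\<And>v'. d (\<sigma> T) (q v) \<le> d (\<sigma> T) (q v') + 1"
      using near_minimum[of UNIV "\<lambda>v. d (\<sigma> T) (q v)"] by auto
    have vB: "cmod v \<le> B" using B[OF T v] .
    have vu: "cmod (v - u) \<le> B + cmod u" using norm_triangle_ineq4[of v u] vB by simp
    define p where "p = \<phi> (\<sigma> T)"
    have p: "p \<in> M" using m \<phi> by (simp add: p_def isometryD)
    have near: "d p (\<phi> (q v)) \<le> d p (\<phi> (q v')) + 1" for v'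
      using v[of v'] m qm \<phi> by (simp add: p_def isometryD)
    have pn: "p \<in> nbhd R' (\<alpha> ` {0..})" using end' T by (auto simp: p_def)
    have far: "d (\<phi> (q x)) p > 2 * R' + 1" if "cmod x \<le> W" for x
    proof -
      have "T \<le> d (\<sigma> 0) (\<sigma> T) + C0" using coarse_rayD(3)[OF \<sigma>, of 0 T] T by simp
      also have "d (\<sigma> 0) (\<sigma> T) \<le> d (\<sigma> 0) (q 0) + d (q 0) (q x) + d (q x) (\<sigma> T)"
        using triangle[of "\<sigma> 0" "q 0" "\<sigma> T"] triangle[of "q 0" "q x" "\<sigma> T"] m qm by simp
      also have "d (q 0) (q x) \<le> K * cmod (0 - x) + C" using q unfolding quasi_plane_def by blast
      also have "K * cmod (0 - x) \<le> K * W" using that K by (intro mult_left_mono) auto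
      finally have "T \<le> d (\<sigma> 0) (q 0) + (K * W + C) + d (q x) (\<sigma> T) + C0" by simp
      moreover have "T \<ge> 2 * R' + 2 + C0 + d (\<sigma> 0) (q 0) + K * W + C" by (simp add: T_def)
      moreover have "d (\<phi> (q x)) p = d (q x) (\<sigma> T)" using m qm \<phi> by (simp add: p_def isometryD)
      ultimately show ?thesis by simp
    qed
    have cd: "cmod (corner u v - u) \<le> cmod (v - u)" "cmod (v - corner u v) \<le> cmod (v - u)"
      unfolding corner_dist by (auto simp: divide_le_eq mult_le_cancel_left1)
    have Wb: "cmod u + cmod (v - u) \<le> W" using vu vB norm_ge_zero[of u] norm_ge_zero[of v] unfolding W_def by linarith
    have W1: "cmod (straight u v t) \<le> W" if "t \<in> {0..cmod (v - u)}" for t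
      using straight_bound[OF that] Wb by simp
    have W2: "cmod (straight u (corner u v) t) \<le> W" if "t \<in> {0..cmod (corner u v - u)}" for t
      using straight_bound[OF that] Wb cd by simp
    have W3: "cmod (straight (corner u v) v t) \<le> W" if "t \<in> {0..cmod (v - corner u v)}" for t
    proof -
      have "cmod (corner u v) \<le> cmod u + cmod (corner u v - u)"
        using norm_triangle_ineq[of u "corner u v - u"] by simp
      then have "cmod (straight (corner u v) v t) \<le> cmod u + cmod (v - u) + cmod (v - u)"
        using straight_bound[OF that] cd by simp
      also have "\<dots> \<le> W" using vu vB norm_ge_zero[of u] norm_ge_zero[of v] unfolding W_def by linarith
      finally show ?thesis .
    qed
    obtain b1 \<tau>1 where 1: "cmod (v - u) \<le> b1" "quasi_geodesic K1 C2 0 b1 \<tau>1" "\<tau>1 b1 = p"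
      "\<And>t. t\<in>{0..cmod (v - u)} \<Longrightarrow> \<tau>1 t = \<phi> (q (straight u v t))"
      using path(1)[of "\<lambda>t. \<phi> (q t)" p v u, OF q' p near] by blast
    obtain b2 \<tau>2 where 2: "cmod (corner u v - u) + cmod (v - corner u v) \<le> b2"
      "quasi_geodesic K1 C2 0 b2 \<tau>2" "\<tau>2 b2 = p"
       "\<And>t. t\<in>{0..cmod (corner u v - u)} \<Longrightarrow> \<tau>2 t = \<phi> (q (straight u (corner u v) t))"
       "\<And>t. t\<in>{0..cmod (v - corner u v)} \<Longrightarrow> \<tau>2 (cmod (corner u v - u) + t) = \<phi> (q (straight (corner u v) v t))"
      using path(2)[of "\<lambda>t. \<phi> (q t)" p v u, OF q' p near] by blast
    have s1: "\<tau>1 0 \<in> nbhd R (\<alpha> ` {0..})" using 1(4)[of 0] start by (simp add: straight_0)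
    have s2: "\<tau>2 0 \<in> nbhd R (\<alpha> ` {0..})" using 2(4)[of 0] start by (simp add: straight_0)
    have t1: "\<tau>1 t \<in> nbhd R2 (\<alpha> ` {0..})" if "t \<in> {0..cmod (v - u)}" for t unfolding R2_def
    proof (rule morse_cut[OF geo N K1 1(2) s1 R])
      show "\<tau>1 b1 \<in> nbhd R' (\<alpha> ` {0..})" using 1 pn by simp
      show "t \<in> {0..b1}" using that 1 by auto
      show "2 * R' + 1 < d (\<tau>1 s) (\<tau>1 b1)" if "s \<in> {0..t}" for s
        using far[OF W1, of s] 1(3,4) that \<open>t \<in> {0..cmod (v - u)}\<close> by auto
    qed
    let ?l = "cmod (corner u v - u)" and ?m = "cmod (v - corner u v)"
    have t2: "\<tau>2 t \<in> nbhd R2 (\<alpha> ` {0..})" if tt: "t \<in> {0..?l + ?m}" for t unfolding R2_def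
    proof (rule morse_cut[OF geo N K1 2(2) s2 R])
      show "\<tau>2 b2 \<in> nbhd R' (\<alpha> ` {0..})" using 2 pn by simp
      show "t \<in> {0..b2}" using tt 2 by auto
      show "2 * R' + 1 < d (\<tau>2 s) (\<tau>2 b2)" if s: "s \<in> {0..t}" for s
      proof (cases "s \<le> ?l")
        case True
        then show ?thesis using far[OF W2, of s] 2(3,4) s by auto
      next
        case False
        then have "s - ?l \<in> {0..?m}" using s tt by auto
        then show ?thesis using far[OF W3, of "s - ?l"] 2(3) 2(5)[of "s - ?l"] by simp
      qed
    qed
    have "cmod (v - u) \<le> 2 * K * (K + 2 * C + 4 * R2 + 2 * C1)"
    proof (rule plane_triangle_not_along_ray[OF q' \<alpha> R2])
      show "\<phi> (q (straight u v t)) \<in> nbhd R2 (\<alpha> ` {0..})" if "t \<in> {0..cmod (v - u)}" for t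
        using t1[of t] 1(4)[OF that] that by simp
      show "\<phi> (q (straight u (corner u v) t)) \<in> nbhd R2 (\<alpha> ` {0..})" if "t \<in> {0..?l}" for t
        using t2[of t] 2(4)[OF that] that by (simp add: add_increasing2)
      show "\<phi> (q (straight (corner u v) v t)) \<in> nbhd R2 (\<alpha> ` {0..})" if "t \<in> {0..?m}" for t
        using t2[of "?l + t"] 2(5)[OF that] that by auto
    qed
    then show "cmod u \<le> D" using norm_triangle_ineq4[of v "v - u"] vB by (simp add: D_def)
  qed
qed

section \<open>Asymptotic rays\<close>

text \<open>The ray \<open>\<alpha>\<close> runs along \<open>\<beta>\<close> to infinity, so it passes every point of \<open>\<beta>\<close> beyond its start.\<close>

lemma asymptotic_sym:
  assumes \<alpha>: "coarse_ray C \<alpha>" and \<beta>: "coarse_ray C' \<beta>" and sub: "\<alpha> ` {0..} \<subseteq> nbhd R (\<beta> ` {0..})"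
  obtains R' where "\<beta> ` {0..} \<subseteq> nbhd R' (\<alpha> ` {0..})"
proof -
  have C: "C \<ge> 0" "C' \<ge> 0" using coarse_ray_nonneg \<alpha> \<beta> by auto
  have near: "\<exists>s\<ge>0. d (\<alpha> t) (\<beta> s) \<le> R" if "t \<ge> 0" for t
    using sub that by (force simp: in_nbhd commute image_subset_iff)
  then have R: "R \<ge> 0" by (meson nonneg order_trans order_refl)
  obtain s0 where s0: "s0 \<ge> 0" "d (\<alpha> 0) (\<beta> s0) \<le> R" using near[of 0] by auto
  have m: "\<alpha> t \<in> M" "\<beta> t \<in> M" if "t \<ge> 0" for t using coarse_rayD \<alpha> \<beta> that by blast+
  define R' where "R' = max (R + s0 + C') (1 + C + 3 * R + 2 * C')"
  have "\<beta> v \<in> nbhd R' (\<alpha> ` {0..})" if v: "v \<ge> 0" for v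
  proof (cases "v \<le> s0")
    case True
    have "d (\<alpha> 0) (\<beta> v) \<le> R + s0 + C'"
      using triangle[of "\<alpha> 0" "\<beta> s0" "\<beta> v"] m s0 v coarse_rayD(2)[OF \<beta> s0(1) v] True by simp
    then have "d (\<alpha> 0) (\<beta> v) \<le> R'" by (simp add: R'_def)
    then show ?thesis using m v by (auto simp: in_nbhd)
  next
    case False
    define T where "T = R + R + v + d (\<alpha> 0) (\<beta> 0) + C + C'"
    have T: "T \<ge> 0" using R v C by (simp add: T_def)
    obtain sT where sT: "sT \<ge> 0" "d (\<alpha> T) (\<beta> sT) \<le> R" using near[OF T] by auto
    have "T \<le> d (\<alpha> 0) (\<alpha> T) + C" using coarse_rayD(3)[OF \<alpha>, of 0 T] T by simp
    also have "d (\<alpha> 0) (\<alpha> T) \<le> d (\<alpha> 0) (\<beta> 0) + d (\<beta> 0) (\<beta> sT) + d (\<alpha> T) (\<beta> sT)"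
      using triangle[of "\<alpha> 0" "\<beta> 0" "\<alpha> T"] triangle[of "\<beta> 0" "\<beta> sT" "\<alpha> T"] m sT T by (simp add: commute)
    also have "d (\<beta> 0) (\<beta> sT) \<le> sT + C'" using coarse_rayD(2)[OF \<beta>, of 0 sT] sT by simp
    finally have "v \<le> sT" using sT R by (simp add: T_def)
    moreover have "\<alpha> t \<in> nbhd R (\<beta> ` {0..})" if "t \<in> {0..T}" for t using sub that by auto
    ultimately obtain t where "t \<in> {0..T}" "d (\<alpha> t) (\<beta> v) \<le> 1 + C + 3 * R + 2 * C'"
      using qg_crossing[OF \<beta> coarse_ray_qg[OF \<alpha> order_refl T] order_refl C(1) R _ s0 sT, of v] False by auto
    then have "d (\<alpha> t) (\<beta> v) \<le> R'" "t \<ge> 0" by (simp_all add: R'_def)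
    then show ?thesis using m v by (auto simp: in_nbhd)
  qed
  then show ?thesis using that[of R'] by auto
qed

lemma asymptotic_trans:
  "A \<subseteq> nbhd R B \<Longrightarrow> B \<subseteq> nbhd R' E \<Longrightarrow> A \<subseteq> nbhd (R' + R) E"
  using nbhd_trans[of R R' E] nbhd_mono[of R R B "nbhd R' E"] by (auto simp: add.commute)

text \<open>Up to each of the times at which \<open>\<alpha>\<close> is close to \<open>B\<close>, it is a quasi-geodesic that starts and ends near \<open>B\<close>.\<close>

lemma morse_asymptotic_if_often_close:
  assumes \<alpha>: "coarse_ray C \<alpha>" and N: "morse_set N B" and a0: "\<alpha> 0 \<in> nbhd R B" and R: "R \<ge> 0"
    and often: "\<And>T. \<exists>s\<ge>T. \<alpha> s \<in> nbhd R B"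
  shows "\<alpha> ` {0..} \<subseteq> nbhd (max R (N 1 (C + 2 * R))) B"
proof (rule image_subsetI)
  fix t :: real assume "t \<in> {0..}"
  then have t: "t \<ge> 0" by simp
  obtain s where s: "s \<ge> t" "\<alpha> s \<in> nbhd R B" using often by blast
  have q: "quasi_geodesic 1 C 0 s \<alpha>" by (rule coarse_ray_qg[OF \<alpha>]) (use s t in auto)
  show "\<alpha> t \<in> nbhd (max R (N 1 (C + 2 * R))) B"
    by (rule morse_near[OF N order_refl coarse_ray_nonneg[OF \<alpha>] q a0 s(2) R]) (use s t in auto)
qed

text \<open>An instance of \<open>morse_cut\<close> with the far endpoint moved to infinity.\<close>

lemma asymptotic_uniform:
  assumes geo: geodesic_space and \<alpha>: "coarse_ray C \<alpha>" and N: "morse_set N B" and a0: "\<alpha> 0 \<in> nbhd R B" and R: "R \<ge> 0"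
    and sub: "\<alpha> ` {0..} \<subseteq> nbhd R' B"
  shows "\<alpha> ` {0..} \<subseteq> nbhd (max R (N 5 (2 * (1 + C) + 2 * R))) B"
proof (rule image_subsetI)
  fix t :: real assume "t \<in> {0..}"
  then have t: "t \<ge> 0" by simp
  define T where "T = t + \<bar>2 * R' + 2 + C\<bar>"
  have T: "T \<ge> t" "T \<ge> 0" using t by (auto simp: T_def)
  have "\<alpha> t \<in> nbhd (max R (N (5 * 1) (2 * (1 + C) + 2 * R))) B"
  proof (rule morse_cut[OF geo N order_refl coarse_ray_nonneg[OF \<alpha>] coarse_ray_qg[OF \<alpha> order_refl T(2)] a0 R,
    where R' = R'])
    show "\<alpha> T \<in> nbhd R' B" using sub T t by auto
    show "t \<in> {0..T}" using T t by auto
    show "2 * R' + 1 < d (\<alpha> s) (\<alpha> T)" if "s \<in> {0..t}" for s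
    proof -
      have "T - s \<le> d (\<alpha> s) (\<alpha> T) + C" using coarse_rayD(3)[OF \<alpha>, of s T] that T by simp
      moreover have "T \<ge> t + (2 * R' + 2 + C)" by (simp add: T_def)
      ultimately show ?thesis using that by simp
    qed
  qed
  then show "\<alpha> t \<in> nbhd (max R (N 5 (2 * (1 + C) + 2 * R))) B" by simp
qed

text \<open>Walk along \<open>\<sigma>2\<close> to the point \<open>\<sigma>2 r\<close> almost nearest to \<open>\<sigma>1 s\<close> and go straight to \<open>\<sigma>1 s\<close>. This quasi-geodesic
  has its endpoints on \<open>\<sigma>1\<close>, so it stays near \<open>\<sigma>1\<close>. As \<open>\<sigma>2\<close> is near \<open>\<sigma>1\<close> for a bounded time only, \<open>r\<close> is
  bounded, and the distance from \<open>\<sigma>1 s\<close> to \<open>\<sigma>2\<close> is \<open>s\<close> up to a constant.\<close>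

lemma morse_divergence:
  assumes geo: geodesic_space and \<sigma>1: "coarse_ray C \<sigma>1" "morse_set N1 (\<sigma>1 ` {0..})"
    and \<sigma>2: "coarse_ray C \<sigma>2" "\<sigma>1 0 = \<sigma>2 0"
    and diff: "\<And>R. \<not> \<sigma>2 ` {0..} \<subseteq> nbhd R (\<sigma>1 ` {0..})"
  obtains B where "\<And>s s'. s \<ge> 0 \<Longrightarrow> s' \<ge> 0 \<Longrightarrow> s \<le> d (\<sigma>1 s) (\<sigma>2 s') + B"
proof -
  have C: "C \<ge> 0" using coarse_ray_nonneg \<sigma>1 by blast
  define \<rho> where "\<rho> = max 0 (N1 (5 * 1) (2 * (1 + C)))"
  have m: "\<sigma>1 t \<in> M" "\<sigma>2 t \<in> M" if "t \<ge> 0" for t using coarse_rayD \<sigma>1 \<sigma>2 that by blast+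
  have o: "\<sigma>2 0 \<in> nbhd \<rho> (\<sigma>1 ` {0..})" using \<sigma>2(2) m[of 0] by (auto simp: in_nbhd \<rho>_def intro!: bexI[of _ 0])
  obtain \<kappa> where \<kappa>: "\<And>s. s \<ge> \<kappa> \<Longrightarrow> \<sigma>2 s \<notin> nbhd \<rho> (\<sigma>1 ` {0..})"
    using morse_asymptotic_if_often_close[OF \<sigma>2(1) \<sigma>1(2) o] diff by (metis \<rho>_def max.cobounded1)
  show ?thesis
  proof (rule that)
    fix s s' :: real assume s: "s \<ge> 0" "s' \<ge> 0"
    obtain r where r: "r \<in> {0..}" "\<And>r'. r' \<in> {0..} \<Longrightarrow> d (\<sigma>1 s) (\<sigma>2 r) \<le> d (\<sigma>1 s) (\<sigma>2 r') + 1"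
      using near_minimum[of "{0..}" "\<lambda>r. d (\<sigma>1 s) (\<sigma>2 r)"] by auto
    have q: "quasi_geodesic 1 C 0 r \<sigma>2" by (rule coarse_ray_qg[OF \<sigma>2(1)]) (use r in auto)
    have near: "d (\<sigma>1 s) (\<sigma>2 r) \<le> d (\<sigma>1 s) (\<sigma>2 t) + 1" if "t \<in> {0..r}" for t using r(2)[of t] that by simp
    obtain b \<tau> where *: "r \<le> b" "quasi_geodesic (5 * 1) (2 * (1 + C)) 0 b \<tau>"
      "\<And>t. t \<in> {0..r} \<Longrightarrow> \<tau> t = \<sigma>2 t" "\<tau> b = \<sigma>1 s"
      using qg_extend[OF geo q order_refl C m(1)[OF s(1)] near zero_le_one] by metis
    have o1: "\<sigma>2 0 \<in> \<sigma>1 ` {0..}" using \<sigma>2(2) by (metis atLeast_iff imageI order_refl)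
    have "\<tau> r \<in> nbhd (N1 (5 * 1) (2 * (1 + C))) (\<sigma>1 ` {0..})"
      by (rule morse_setD[OF \<sigma>1(2) _ _ *(2)]) (use * r o1 s C in auto)
    then have "\<sigma>2 r \<in> nbhd \<rho> (\<sigma>1 ` {0..})" using * r nbhd_mono[of "N1 (5 * 1) (2 * (1 + C))" \<rho>
      "\<sigma>1 ` {0..}" "\<sigma>1 ` {0..}"]
      by (auto simp: \<rho>_def)
    then have "r < \<kappa>" using \<kappa>[of r] by (meson not_le)
    moreover have "d (\<sigma>2 0) (\<sigma>2 r) \<le> r + C" using coarse_rayD(2)[OF \<sigma>2(1), of 0 r] r by simp
    moreover have "s \<le> d (\<sigma>1 0) (\<sigma>1 s) + C" using coarse_rayD(3)[OF \<sigma>1(1), of 0 s] s by simp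
    moreover have "d (\<sigma>1 0) (\<sigma>1 s) \<le> d (\<sigma>2 0) (\<sigma>2 r) + d (\<sigma>1 s) (\<sigma>2 r)"
      using triangle[of "\<sigma>1 0" "\<sigma>2 r" "\<sigma>1 s"] m r s \<sigma>2(2) by (simp add: commute)
    ultimately show "s \<le> d (\<sigma>1 s) (\<sigma>2 s') + (\<kappa> + 2 * C + 1)" using r(2)[of s'] s by simp
  qed
qed

text \<open>A path from \<open>A1\<close> to \<open>A2\<close> is split at a point almost nearest to the common point \<open>o'\<close>, and both halves are
  continued to \<open>o'\<close>.\<close>

lemma morse_union:
  assumes geo: geodesic_space and 1: "morse_set N1 A1" and 2: "morse_set N2 A2" and o: "o' \<in> A1" "o' \<in> A2"
  obtains N where "morse_set N (A1 \<union> A2)"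
proof -
  define N where "N = (\<lambda>K C. max (max (N1 K C) (N2 K C)) (max (N1 (5 * K) (2 * (1 + C))) (N2 (5 * K) (2 * (1 + C)))))"
  have sub: "A1 \<subseteq> M" "A2 \<subseteq> M" using 1 2 by (auto simp: morse_set_def)
  have mixed: "\<sigma> t \<in> nbhd (max (N1 (5 * K) (2 * (1 + C))) (N2 (5 * K) (2 * (1 + C)))) (A1 \<union> A2)"
    if N: "morse_set N1 A1" "morse_set N2 A2" and o: "o' \<in> A1" "o' \<in> A2" 
       and K: "K \<ge> 1" and C: "C \<ge> 0" and \<sigma>: "quasi_geodesic K C a b \<sigma>" "\<sigma> a \<in> A1" "\<sigma> b \<in> A2" and t: "t \<in> {a..b}" 
     for N1 N2 A1 A2 K C a b \<sigma> t
  proof -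
    have om: "o' \<in> M" using o N by (auto simp: morse_set_def)
    have up: "nbhd (N1 (5 * K) (2 * (1 + C))) A1 \<subseteq> nbhd (max (N1 (5 * K) (2 * (1 + C))) (N2 (5 * K) (2 * (1 +
      C)))) (A1 \<union> A2)"
       "nbhd (N2 (5 * K) (2 * (1 + C))) A2 \<subseteq> nbhd (max (N1 (5 * K) (2 * (1 + C))) (N2 (5 * K) (2 * (1 +
         C)))) (A1 \<union> A2)"
      by (intro nbhd_mono; simp)+
    obtain s where s: "s \<in> {a..b}" "\<And>r. r \<in> {a..b} \<Longrightarrow> d o' (\<sigma> s) \<le> d o' (\<sigma> r) + 1"
      using near_minimum[of "{a..b}" "\<lambda>r. d o' (\<sigma> r)"] t by auto
    show ?thesis
    proof (cases "t \<le> s")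
      case True
      have q: "quasi_geodesic K C a s \<sigma>" by (rule qg_subinterval[OF \<sigma>(1)]) (use s in auto)
      have near: "d o' (\<sigma> s) \<le> d o' (\<sigma> r) + 1" if "r \<in> {a..s}" for r using s that by auto
      obtain b' \<tau> where *: "s \<le> b'" "quasi_geodesic (5 * K) (2 * (1 + C)) a b' \<tau>"
        "\<And>t. t \<in> {a..s} \<Longrightarrow> \<tau> t = \<sigma> t" "\<tau> b' = o'"
        using qg_extend[OF geo q K C om near zero_le_one] by metis
      have "\<tau> t \<in> nbhd (N1 (5 * K) (2 * (1 + C))) A1"
        by (rule morse_setD[OF N(1) _ _ *(2)]) (use * s o \<sigma> C K t True in auto)
      then show ?thesis using *(3)[of t] t True up(1) by auto
    next
      case False
      have q: "quasi_geodesic K C (-b) (-s) (\<lambda>r. \<sigma> (- r))"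
        by (rule qg_reverse[OF qg_subinterval[OF \<sigma>(1)]]) (use s in auto)
      have near: "d o' (\<sigma> (- (- s))) \<le> d o' (\<sigma> (- r)) + 1" if "r \<in> {-b..-s}" for r using s that by auto
      obtain b' \<tau> where *: "-s \<le> b'" "quasi_geodesic (5 * K) (2 * (1 + C)) (-b) b' \<tau>"
        "\<And>t. t \<in> {-b..-s} \<Longrightarrow> \<tau> t = \<sigma> (-t)" "\<tau> b' = o'"
        using qg_extend[OF geo q K C om near zero_le_one] by metis
      have "\<tau> (-t) \<in> nbhd (N2 (5 * K) (2 * (1 + C))) A2"
        by (rule morse_setD[OF N(2) _ _ *(2)]) (use * s o \<sigma> C K t False in auto)
      then show ?thesis using *(3)[of "-t"] t False up(2) by auto
    qed
  qed
  have "morse_set N (A1 \<union> A2)"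
    unfolding morse_set_def
  proof (intro conjI allI impI)
    show "A1 \<union> A2 \<subseteq> M" using sub by blast
    fix K C a b \<sigma> assume K: "1 \<le> (K::real)" "0 \<le> (C::real)"
      and *: "quasi_geodesic K C a b \<sigma> \<and> \<sigma> a \<in> A1 \<union> A2 \<and> \<sigma> b \<in> A1 \<union> A2"
    have up: "nbhd r A \<subseteq> nbhd (N K C) (A1 \<union> A2)" if "r \<le> N K C" "A \<subseteq> A1 \<union> A2" for r A using nbhd_mono that by blast
    show "\<sigma> ` {a..b} \<subseteq> nbhd (N K C) (A1 \<union> A2)"
    proof
      fix y assume "y \<in> \<sigma> ` {a..b}"
      then obtain t where t: "t \<in> {a..b}" "y = \<sigma> t" by auto
      consider "\<sigma> a \<in> A1" "\<sigma> b \<in> A1" | "\<sigma> a \<in> A2" "\<sigma> b \<in> A2" | "\<sigma> a \<in> A1" "\<sigma> b \<in> A2" | "\<sigma> a \<in> A2" "\<sigma> b \<in> A1"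
        using * by blast
      then have "\<exists>r A. \<sigma> t \<in> nbhd r A \<and> r \<le> N K C \<and> A \<subseteq> A1 \<union> A2"
      proof cases
        case 1
        have "\<sigma> t \<in> nbhd (N1 K C) A1" by (rule morse_setD[OF assms(2) K _ 1 t(1)]) (use * in blast)
        then show ?thesis by (intro exI[of _ "N1 K C"] exI[of _ A1]) (auto simp: N_def)
      next
        case 2
        have "\<sigma> t \<in> nbhd (N2 K C) A2" by (rule morse_setD[OF assms(3) K _ 2 t(1)]) (use * in blast)
        then show ?thesis by (intro exI[of _ "N2 K C"] exI[of _ A2]) (auto simp: N_def)
      next
        case 3
        have "\<sigma> t \<in> nbhd (max (N1 (5 * K) (2 * (1 + C))) (N2 (5 * K) (2 * (1 + C)))) (A1 \<union> A2)"
          by (rule mixed[OF assms(2,3) o K _ 3 t(1)]) (use * in blast)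
        then show ?thesis by (intro exI[of _ "max (N1 (5 * K) (2 * (1 + C))) (N2 (5 * K) (2 * (1 + C)))"] exI[of _
          "A1 \<union> A2"]) (auto simp: N_def)
      next
        case 4
        have "\<sigma> t \<in> nbhd (max (N2 (5 * K) (2 * (1 + C))) (N1 (5 * K) (2 * (1 + C)))) (A2 \<union> A1)"
          by (rule mixed[OF assms(3,2) o(2,1) K _ 4 t(1)]) (use * in blast)
        then show ?thesis by (intro exI[of _ "max (N2 (5 * K) (2 * (1 + C))) (N1 (5 * K) (2 * (1 + C)))"] exI[of _
          "A2 \<union> A1"]) (auto simp: N_def)
      qed
      then obtain r A where r: "\<sigma> t \<in> nbhd r A" "r \<le> N K C" "A \<subseteq> A1 \<union> A2" by blast
      show "y \<in> nbhd (N K C) (A1 \<union> A2)" using up[OF r(2,3)] r(1) t(2) by blast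
    qed
  qed
  then show ?thesis using that by blast
qed

text \<open>The two rays together form a coarse bi-infinite geodesic inside the Morse set \<open>\<sigma>1 \<union> \<sigma>2\<close>. An isometry that fixes
  both endpoints carries it to another one with the same endpoints, which is uniformly near the Morse set by
  \<open>morse_cut2\<close>. In particular \<open>\<phi> o'\<close> is.\<close>

lemma fixed_pair_near:
  assumes geo: geodesic_space and \<sigma>1: "coarse_ray C \<sigma>1" "morse_set N1 (\<sigma>1 ` {0..})"
    and \<sigma>2: "coarse_ray C \<sigma>2" "morse_set N2 (\<sigma>2 ` {0..})" and o: "\<sigma>1 0 = o'" "\<sigma>2 0 = o'"
    and diff: "\<And>R. \<not> \<sigma>2 ` {0..} \<subseteq> nbhd R (\<sigma>1 ` {0..})"
  obtains R where "\<And>\<phi> R1 R2. isometry \<phi> \<Longrightarrow> (\<lambda>t. \<phi> (\<sigma>1 t)) ` {0..} \<subseteq> nbhd R1 (\<sigma>1 ` {0..})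
     \<Longrightarrow> (\<lambda>t. \<phi> (\<sigma>2 t)) ` {0..} \<subseteq> nbhd R2 (\<sigma>2 ` {0..}) \<Longrightarrow> \<phi> o' \<in> nbhd R (\<sigma>1 ` {0..} \<union> \<sigma>2 ` {0..})"
proof -
  have C: "C \<ge> 0" using coarse_ray_nonneg \<sigma>1 by blast
  have m: "\<sigma>1 t \<in> M" "\<sigma>2 t \<in> M" if "t \<ge> 0" for t using coarse_rayD \<sigma>1 \<sigma>2 that by blast+
  obtain B where B: "\<And>s s'. s \<ge> 0 \<Longrightarrow> s' \<ge> 0 \<Longrightarrow> s \<le> d (\<sigma>1 s) (\<sigma>2 s') + B"
    using morse_divergence[OF geo \<sigma>1 \<sigma>2(1) _ diff] o by metis
  let ?A = "\<sigma>1 ` {0..} \<union> \<sigma>2 ` {0..}"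
  have "o' \<in> \<sigma>1 ` {0..}" "o' \<in> \<sigma>2 ` {0..}" using o by (metis atLeast_iff imageI order_refl)+
  then obtain N where N: "morse_set N ?A" using morse_union[OF geo \<sigma>1(2) \<sigma>2(2)] by metis
  have lin1: "s \<le> d (\<sigma>1 s) (\<sigma>2 s') + B" if "s \<ge> 0" "s' \<ge> 0" for s s' using B that .
  have om: "o' \<in> M" using m(1)[of 0] o by simp
  have lin2: "s' \<le> 2 * d (\<sigma>1 s) (\<sigma>2 s') + B + 2 * C" if "s \<ge> 0" "s' \<ge> 0" for s s'
  proof -
    have "s' \<le> d (\<sigma>2 s') (\<sigma>2 0) + C" using coarse_rayD(3)[OF \<sigma>2(1), of s' 0] that by simp
    also have "d (\<sigma>2 s') (\<sigma>2 0) \<le> d (\<sigma>1 s) (\<sigma>2 s') + d (\<sigma>1 s) (\<sigma>1 0)"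
      using triangle[of "\<sigma>2 s'" "\<sigma>1 s" "\<sigma>2 0"] m that o om by (simp add: commute)
    also have "d (\<sigma>1 s) (\<sigma>1 0) \<le> s + C" using coarse_rayD(2)[OF \<sigma>1(1), of s 0] that by simp
    finally show ?thesis using B[OF that] by simp
  qed
  define B' where "B' = \<bar>B\<bar> + C"
  \<comment> \<open>The bi-infinite path: \<open>\<sigma>1\<close> backwards, and then \<open>\<sigma>2\<close>.\<close>
  define P where "P = (\<lambda>t. if t \<le> 0 then \<sigma>1 (- t) else \<sigma>2 t)"
  have P: "quasi_geodesic 3 (2 * (B' + C)) (-S) S P" if "S \<ge> 0" for S
  proof -
    have 1: "quasi_geodesic 1 C (-S) 0 (\<lambda>t. \<sigma>1 (- t))"
      using qg_reverse[OF coarse_ray_qg[OF \<sigma>1(1) order_refl that]] by simp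
    have 2: "quasi_geodesic 1 C 0 S \<sigma>2" by (rule coarse_ray_qg[OF \<sigma>2(1) order_refl that])
    have far: "d (\<sigma>1 (- s)) (\<sigma>1 (- 0)) \<le> 1 * d (\<sigma>1 (- s)) (\<sigma>2 t) + B'" if "s \<in> {-S..0}" "t \<in> {0..S}" for s t
    proof -
      have "d (\<sigma>1 (- s)) (\<sigma>1 0) \<le> -s + C" using coarse_rayD(2)[OF \<sigma>1(1), of "-s" 0] that by simp
      also have "-s \<le> d (\<sigma>1 (- s)) (\<sigma>2 t) + \<bar>B\<bar>" using lin1[of "-s" t] that by simp
      finally show ?thesis by (simp add: B'_def)
    qed
    have "quasi_geodesic (1 * (2 * 1 + 1)) (2 * (B' + C)) (-S) S P" unfolding P_def
      by (rule qg_concat[OF 1 2 _ order_refl C _ _ far]) (use o C in \<open>auto simp: B'_def\<close>)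
    then show ?thesis by simp
  qed
  define R where "R = max 0 (N (25 * 3) (2 * (3 + 2 * (2 * (B' + C)))))"
  show ?thesis
  proof (rule that)
    fix \<phi> R1 R2 assume \<phi>: "isometry \<phi>" and 1: "(\<lambda>t. \<phi> (\<sigma>1 t)) ` {0..} \<subseteq> nbhd R1 (\<sigma>1 ` {0..})"
      and 2: "(\<lambda>t. \<phi> (\<sigma>2 t)) ` {0..} \<subseteq> nbhd R2 (\<sigma>2 ` {0..})"
    define R' where "R' = max 0 (max R1 R2)"
    have mono: "nbhd R1 (\<sigma>1 ` {0..}) \<subseteq> nbhd R' ?A" "nbhd R2 (\<sigma>2 ` {0..}) \<subseteq> nbhd R' ?A"
      by (intro nbhd_mono; auto simp: R'_def)+
    define S where "S = 5 * R' + 5 + \<bar>B\<bar> + 2 * C"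
    have R'0: "R' \<ge> 0" by (simp add: R'_def)
    have S: "S > 0" using C R'0 by (simp add: S_def)
    have dphi: "d (\<phi> (\<sigma>1 s)) (\<phi> (\<sigma>2 t)) = d (\<sigma>1 s) (\<sigma>2 t)" if "s \<ge> 0" "t \<ge> 0" for s t
      using isometryD(2)[OF \<phi>] m that by blast
    have lin1': "S - \<bar>B\<bar> \<le> d (\<sigma>1 S) (\<sigma>2 s)" if "s \<ge> 0" for s using lin1[of S s] that S by simp
    have lin2': "S - \<bar>B\<bar> - 2 * C \<le> 2 * d (\<sigma>1 s) (\<sigma>2 S)" if "s \<ge> 0" for s using lin2[of s S] that S by simp
    have "\<phi> (P 0) \<in> nbhd (max 0 (N (25 * 3) (2 * (3 + 2 * (2 * (B' + C)))))) ?A"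
    proof (rule morse_cut2[OF geo N _ _ isometry_qg[OF \<phi> P[of S]], where R' = R'])
      show "0 \<le> 2 * (B' + C)" using C by (simp add: B'_def)
      have "\<phi> (\<sigma>1 S) \<in> nbhd R1 (\<sigma>1 ` {0..})" using 1 S by (simp add: image_subset_iff)
      then show "\<phi> (P (- S)) \<in> nbhd R' ?A" using mono(1) S by (auto simp: P_def)
      have "\<phi> (\<sigma>2 S) \<in> nbhd R2 (\<sigma>2 ` {0..})" using 2 S by (simp add: image_subset_iff)
      then show "\<phi> (P S) \<in> nbhd R' ?A" using mono(2) S by (auto simp: P_def)
      show "2 * R' + 1 < d (\<phi> (P s)) (\<phi> (P (- S)))" if s: "s \<in> {0..S}" for s
      proof -
        have "P s = \<sigma>2 s" using s o by (auto simp: P_def)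
        then have "d (\<phi> (P s)) (\<phi> (P (- S))) = d (\<sigma>1 S) (\<sigma>2 s)" using dphi[of S s] s S by (simp add: P_def commute)
        moreover have "S - \<bar>B\<bar> \<le> d (\<sigma>1 S) (\<sigma>2 s)" using lin1' s by simp
        ultimately show ?thesis using S_def R'0 C by linarith
      qed
      show "2 * R' + 1 < d (\<phi> (P s)) (\<phi> (P S))" if s: "s \<in> {- S..0}" for s
      proof -
        have "d (\<phi> (P s)) (\<phi> (P S)) = d (\<sigma>1 (-s)) (\<sigma>2 S)" using dphi[of "-s" S] s S by (simp add: P_def)
        moreover have "S - \<bar>B\<bar> - 2 * C \<le> 2 * d (\<sigma>1 (-s)) (\<sigma>2 S)" using lin2'[of "-s"] s by simp
        ultimately show ?thesis using S_def R'0 by linarith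
      qed
      have "d (\<phi> (P (- S))) (\<phi> (P S)) = d (\<sigma>1 S) (\<sigma>2 S)" using dphi[of S S] S by (simp add: P_def)
      moreover have "S - \<bar>B\<bar> \<le> d (\<sigma>1 S) (\<sigma>2 S)" using lin1' S by simp
      ultimately show "4 * R' + 2 < d (\<phi> (P (- S))) (\<phi> (P S))" using S_def R'0 C by linarith
    qed (use S in auto)
    then show "\<phi> o' \<in> nbhd R ?A" using o by (simp add: P_def R_def)
  qed
qed

text \<open>By \<open>fixed_pair_near\<close> the point \<open>\<phi> o'\<close> is near the union of any two of the rays, hence near two different
  ones; and diverging rays are close near their origin only.\<close>

lemma fixed_triple_bounded:
  assumes geo: geodesic_space and \<sigma>: "coarse_ray C \<sigma>1" "coarse_ray C \<sigma>2" "coarse_ray C \<sigma>3"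
    and N: "morse_set N1 (\<sigma>1 ` {0..})" "morse_set N2 (\<sigma>2 ` {0..})" "morse_set N3 (\<sigma>3 ` {0..})"
    and o: "\<sigma>1 0 = o'" "\<sigma>2 0 = o'" "\<sigma>3 0 = o'"
    and diff: "\<And>R. \<not> \<sigma>2 ` {0..} \<subseteq> nbhd R (\<sigma>1 ` {0..})" "\<And>R. \<not> \<sigma>3 ` {0..} \<subseteq> nbhd R (\<sigma>1 ` {0..})" 
      "\<And>R. \<not> \<sigma>3 ` {0..} \<subseteq> nbhd R (\<sigma>2 ` {0..})"
  obtains B where "\<And>\<phi> R1 R2 R3. isometry \<phi> \<Longrightarrow> (\<lambda>t. \<phi> (\<sigma>1 t)) ` {0..} \<subseteq> nbhd R1 (\<sigma>1 ` {0..})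
     \<Longrightarrow> (\<lambda>t. \<phi> (\<sigma>2 t)) ` {0..} \<subseteq> nbhd R2 (\<sigma>2 ` {0..}) \<Longrightarrow> (\<lambda>t. \<phi> (\<sigma>3 t)) ` {0..} \<subseteq> nbhd R3 (\<sigma>3 ` {0..})
     \<Longrightarrow> d o' (\<phi> o') \<le> B"
proof -
  obtain R12 where R12: "\<And>\<phi> R1 R2. isometry \<phi> \<Longrightarrow> (\<lambda>t. \<phi> (\<sigma>1 t)) ` {0..} \<subseteq> nbhd R1 (\<sigma>1 ` {0..})
     \<Longrightarrow> (\<lambda>t. \<phi> (\<sigma>2 t)) ` {0..} \<subseteq> nbhd R2 (\<sigma>2 ` {0..}) \<Longrightarrow> \<phi> o' \<in> nbhd R12 (\<sigma>1 ` {0..} \<union> \<sigma>2 ` {0..})"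
    using fixed_pair_near[OF geo \<sigma>(1) N(1) \<sigma>(2) N(2) o(1,2) diff(1)] by blast
  obtain R13 where R13: "\<And>\<phi> R1 R2. isometry \<phi> \<Longrightarrow> (\<lambda>t. \<phi> (\<sigma>1 t)) ` {0..} \<subseteq> nbhd R1 (\<sigma>1 ` {0..})
     \<Longrightarrow> (\<lambda>t. \<phi> (\<sigma>3 t)) ` {0..} \<subseteq> nbhd R2 (\<sigma>3 ` {0..}) \<Longrightarrow> \<phi> o' \<in> nbhd R13 (\<sigma>1 ` {0..} \<union> \<sigma>3 ` {0..})"
    using fixed_pair_near[OF geo \<sigma>(1) N(1) \<sigma>(3) N(3) o(1,3) diff(2)] by blast
  obtain R23 where R23: "\<And>\<phi> R1 R2. isometry \<phi> \<Longrightarrow> (\<lambda>t. \<phi> (\<sigma>2 t)) ` {0..} \<subseteq> nbhd R1 (\<sigma>2 ` {0..})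
     \<Longrightarrow> (\<lambda>t. \<phi> (\<sigma>3 t)) ` {0..} \<subseteq> nbhd R2 (\<sigma>3 ` {0..}) \<Longrightarrow> \<phi> o' \<in> nbhd R23 (\<sigma>2 ` {0..} \<union> \<sigma>3 ` {0..})"
    using fixed_pair_near[OF geo \<sigma>(2) N(2) \<sigma>(3) N(3) o(2,3) diff(3)] by blast
  obtain B12 where B12: "\<And>s s'. s \<ge> 0 \<Longrightarrow> s' \<ge> 0 \<Longrightarrow> s \<le> d (\<sigma>1 s) (\<sigma>2 s') + B12"
    using morse_divergence[OF geo \<sigma>(1) N(1) \<sigma>(2) _ diff(1)] o by metis
  obtain B13 where B13: "\<And>s s'. s \<ge> 0 \<Longrightarrow> s' \<ge> 0 \<Longrightarrow> s \<le> d (\<sigma>1 s) (\<sigma>3 s') + B13"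
    using morse_divergence[OF geo \<sigma>(1) N(1) \<sigma>(3) _ diff(2)] o by metis
  obtain B23 where B23: "\<And>s s'. s \<ge> 0 \<Longrightarrow> s' \<ge> 0 \<Longrightarrow> s \<le> d (\<sigma>2 s) (\<sigma>3 s') + B23"
    using morse_divergence[OF geo \<sigma>(2) N(2) \<sigma>(3) _ diff(3)] o by metis
  define R where "R = max R12 (max R13 R23)"
  define B where "B = max B12 (max B13 B23)"
  have two: "d o' z \<le> 3 * R + B + C" if z: "z \<in> nbhd R (\<alpha> ` {0..})" "z \<in> nbhd R (\<beta> ` {0..})" and
     lin: "\<And>s s'. s \<ge> 0 \<Longrightarrow> s' \<ge> 0 \<Longrightarrow> s \<le> d (\<alpha> s) (\<beta> s') + B" and r: "coarse_ray C \<alpha>" "\<alpha> 0 = o'" for z \<alpha> \<beta>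
  proof -
    obtain s where s: "s \<ge> 0" "\<alpha> s \<in> M" "z \<in> M" "d (\<alpha> s) z \<le> R" using z by (auto simp: in_nbhd)
    obtain s' where s': "s' \<ge> 0" "\<beta> s' \<in> M" "d (\<beta> s') z \<le> R" using z by (auto simp: in_nbhd)
    have o: "o' \<in> M" using coarse_rayD(1)[OF r(1), of 0] r(2) by auto
    have "d o' z \<le> d o' (\<alpha> s) + R" using triangle[OF o s(2,3)] s by simp
    also have "d o' (\<alpha> s) \<le> s + C" using coarse_rayD(2)[OF r(1), of 0 s] r(2) s by simp
    also have "s \<le> d (\<alpha> s) (\<beta> s') + B" using lin s s' by blast
    also have "d (\<alpha> s) (\<beta> s') \<le> 2 * R" using triangle[OF s(2,3) s'(2)] s s' by (simp add: commute)
    finally show ?thesis by simp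
  qed
  have b12: "s \<le> d (\<sigma>1 s) (\<sigma>2 s') + B" if "s \<ge> 0" "s' \<ge> 0" for s s'
    using B12[OF that] by (simp add: B_def)
  have b13: "s \<le> d (\<sigma>1 s) (\<sigma>3 s') + B" if "s \<ge> 0" "s' \<ge> 0" for s s'
    using B13[OF that] by (simp add: B_def)
  have b23: "s \<le> d (\<sigma>2 s) (\<sigma>3 s') + B" if "s \<ge> 0" "s' \<ge> 0" for s s'
    using B23[OF that] by (simp add: B_def)
  show ?thesis
  proof (rule that)
    fix \<phi> R1 R2 R3 assume \<phi>: "isometry \<phi>" and f: "(\<lambda>t. \<phi> (\<sigma>1 t)) ` {0..} \<subseteq> nbhd R1 (\<sigma>1 ` {0..})"
      "(\<lambda>t. \<phi> (\<sigma>2 t)) ` {0..} \<subseteq> nbhd R2 (\<sigma>2 ` {0..})" "(\<lambda>t. \<phi> (\<sigma>3 t)) ` {0..} \<subseteq> nbhd R3 (\<sigma>3 ` {0..})"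
    have un: "z \<in> nbhd R A \<or> z \<in> nbhd R A'" if "z \<in> nbhd r (A \<union> A')" "r \<le> R" for z r A A'
      using that by (force simp: in_nbhd)
    have "\<phi> o' \<in> nbhd R (\<sigma>1 ` {0..}) \<or> \<phi> o' \<in> nbhd R (\<sigma>2 ` {0..})"
      by (rule un[OF R12[OF \<phi> f(1,2)]]) (simp add: R_def)
    moreover have "\<phi> o' \<in> nbhd R (\<sigma>1 ` {0..}) \<or> \<phi> o' \<in> nbhd R (\<sigma>3 ` {0..})"
      by (rule un[OF R13[OF \<phi> f(1,3)]]) (simp add: R_def)
    moreover have "\<phi> o' \<in> nbhd R (\<sigma>2 ` {0..}) \<or> \<phi> o' \<in> nbhd R (\<sigma>3 ` {0..})"
      by (rule un[OF R23[OF \<phi> f(2,3)]]) (simp add: R_def)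
    ultimately consider "\<phi> o' \<in> nbhd R (\<sigma>1 ` {0..})" "\<phi> o' \<in> nbhd R (\<sigma>2 ` {0..})"
      | "\<phi> o' \<in> nbhd R (\<sigma>1 ` {0..})" "\<phi> o' \<in> nbhd R (\<sigma>3 ` {0..})" | "\<phi> o' \<in> nbhd R (\<sigma>2 ` {0..})"
        "\<phi> o' \<in> nbhd R (\<sigma>3 ` {0..})"
      by blast
    then show "d o' (\<phi> o') \<le> 3 * R + B + C"
    proof cases
      case 1 then show ?thesis by (rule two[OF _ _ b12 \<sigma>(1) o(1)])
    next
      case 2 then show ?thesis by (rule two[OF _ _ b13 \<sigma>(1) o(1)])
    next
      case 3 then show ?thesis by (rule two[OF _ _ b23 \<sigma>(2) o(2)])
    qed
  qed
qed

text \<open>A quasi-geodesic with endpoints on a subsegment is near the ray. Where it is near a part outside the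
  subsegment, it has passed one of its own endpoints before or passes one later, and a quasi-geodesic cannot
  spend a long time between two visits to the same place.\<close>

lemma morse_subsegments:
  assumes \<beta>: "coarse_ray 0 \<beta>" and N: "morse_set N (\<beta> ` {0..})"
  obtains N' where "\<And>a b. 0 \<le> a \<Longrightarrow> a \<le> b \<Longrightarrow> morse_set N' (\<beta> ` {a..b})"
proof -
  define D where "D = (\<lambda>K C. K + C + 3 * max 0 (N K C) + 2 * 0)"
  define N' where "N' = (\<lambda>K C. max (max 0 (N K C)) (K * (K * (D K C + C)) + C))"
  have "morse_set N' (\<beta> ` {a..b})" if ab: "0 \<le> a" "a \<le> b" for a b
    unfolding morse_set_def
  proof (intro conjI allI impI)
    show "\<beta> ` {a..b} \<subseteq> M" using coarse_rayD(1)[OF \<beta>] ab by auto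
    fix K C p q \<sigma> assume K: "1 \<le> (K::real)" and C: "0 \<le> (C::real)"
      and *: "quasi_geodesic K C p q \<sigma> \<and> \<sigma> p \<in> \<beta> ` {a..b} \<and> \<sigma> q \<in> \<beta> ` {a..b}"
    then have \<sigma>: "quasi_geodesic K C p q \<sigma>" by blast
    have pq: "p \<le> q" using qg_le[OF \<sigma>] .
    obtain x y where x: "x \<in> {a..b}" "\<sigma> p = \<beta> x" and y: "y \<in> {a..b}" "\<sigma> q = \<beta> y" using * by auto
    have x0: "x \<ge> 0" "y \<ge> 0" using x y ab by auto
    define R where "R = max 0 (N K C)"
    have R: "R \<ge> 0" by (simp add: R_def)
    have sub: "\<sigma> t \<in> nbhd R (\<beta> ` {0..})" if "t \<in> {p..q}" for t
      using morse_setD[OF N K C \<sigma> _ _ that] x y x0 nbhd_mono[of "N K C" R "\<beta> ` {0..}" "\<beta> ` {0..}"]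
        by (auto simp: R_def)
    have m: "\<beta> x \<in> M" "\<beta> y \<in> M" using x0 coarse_rayD(1)[OF \<beta>] by blast+
    have z: "d (\<sigma> p) (\<beta> x) \<le> R" "d (\<sigma> q) (\<beta> y) \<le> R" using x y m R by simp_all
    show "\<sigma> ` {p..q} \<subseteq> nbhd (N' K C) (\<beta> ` {a..b})"
    proof (rule image_subsetI)
      fix t assume t: "t \<in> {p..q}"
      have tm: "\<sigma> t \<in> M" using qg_in[OF \<sigma> t] .
      obtain s where s: "s \<ge> 0" "\<beta> s \<in> M" "d (\<sigma> t) (\<beta> s) \<le> R" using sub[OF t] by (auto simp: in_nbhd commute)
      have near: "d (\<sigma> t) (\<sigma> r') \<le> N' K C" if "r \<in> {p..q}" "r' \<in> {p..q}" "d (\<sigma> r) (\<sigma> r') \<le> D K C"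
        "\<bar>t - r'\<bar> \<le> \<bar>r - r'\<bar>" for r r'
      proof -
        have "\<bar>r - r'\<bar> \<le> K * (d (\<sigma> r) (\<sigma> r') + C)" by (rule qg_gap[OF \<sigma> K that(1,2)])
        also have "\<dots> \<le> K * (D K C + C)" using K that by (intro mult_left_mono) auto
        finally have "\<bar>t - r'\<bar> \<le> K * (D K C + C)" using that by simp
        then have "K * \<bar>t - r'\<bar> \<le> K * (K * (D K C + C))" using K by (intro mult_left_mono) auto
        then show ?thesis using qg_upper[OF \<sigma> t that(2)] by (simp add: N'_def)
      qed
      consider "s \<in> {a..b}" | "x \<le> y \<and> y \<le> s \<or> s \<le> y \<and> y \<le> x" | "s \<le> x \<and> x \<le> y \<or> y \<le> x \<and> x \<le> s"
        using x y by fastforce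
      then show "\<sigma> t \<in> nbhd (N' K C) (\<beta> ` {a..b})"
      proof cases
        case 1
        then show ?thesis using s tm by (auto simp: in_nbhd N'_def R_def commute intro!: bexI[of _ s])
      next
        case 2
        have q1: "quasi_geodesic K C p t \<sigma>" by (rule qg_subinterval[OF \<sigma>]) (use t in auto)
        have "\<sigma> t \<in> nbhd R (\<beta> ` {0..})" if "t \<in> {p..t'}" "t' \<le> q" for t t' using sub that by auto
        then obtain r where r: "r \<in> {p..t}" "d (\<sigma> r) (\<beta> y) \<le> K + C + 3 * R + 2 * 0"
          using qg_crossing[OF \<beta> q1 K C R _ x0(1) z(1) s(1,3) 2] t by (metis atLeastAtMost_iff)
        have "d (\<sigma> t) (\<sigma> q) \<le> N' K C" by (rule near[of r q]) (use r y t pq in \<open>auto simp: D_def R_def\<close>)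
        then show ?thesis using y tm m by (auto simp: in_nbhd commute intro!: bexI[of _ y])
      next
        case 3
        have q1: "quasi_geodesic K C t q \<sigma>" by (rule qg_subinterval[OF \<sigma>]) (use t in auto)
        have "\<sigma> t \<in> nbhd R (\<beta> ` {0..})" if "t \<in> {t'..q}" "p \<le> t'" for t t' using sub that by auto
        then obtain r where r: "r \<in> {t..q}" "d (\<sigma> r) (\<beta> x) \<le> K + C + 3 * R + 2 * 0"
          using qg_crossing[OF \<beta> q1 K C R _ s(1,3) x0(2) z(2) 3] t by (metis atLeastAtMost_iff)
        have "d (\<sigma> t) (\<sigma> p) \<le> N' K C" by (rule near[of r p]) (use r x t pq in \<open>auto simp: D_def R_def\<close>)
        then show ?thesis using x tm m by (auto simp: in_nbhd commute intro!: bexI[of _ x])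
      qed
    qed
  qed
  then show ?thesis using that by blast
qed

section \<open>Limits of segments and rays\<close>

definition locally_converges :: "(nat \<Rightarrow> real \<Rightarrow> 'a) \<Rightarrow> (real \<Rightarrow> 'a) \<Rightarrow> bool" where
  "locally_converges c \<gamma> \<longleftrightarrow> (\<forall>T. \<forall>\<epsilon>>0. \<forall>\<^sub>F i in sequentially. \<forall>t\<in>{0..T}. d (c i t) (\<gamma> t) < \<epsilon>)"

lemma locally_converges_subseq:
  "locally_converges c \<gamma> \<Longrightarrow> strict_mono (r :: nat \<Rightarrow> nat) \<Longrightarrow> locally_converges (\<lambda>i. c (r i)) \<gamma>"
  unfolding locally_converges_def by (auto intro: eventually_subseq[where P = "\<lambda>i. \<forall>t\<in>{0.._}. d (c i t) (\<gamma> t) < _"])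

lemma locally_convergesD:
  assumes "locally_converges c \<gamma>" "filterlim L at_top sequentially" "\<epsilon> > 0"
  obtains i0 :: nat where "\<And>i t. i \<ge> i0 \<Longrightarrow> t \<in> {0..T} \<Longrightarrow> d (c i t) (\<gamma> t) < \<epsilon>" "\<And>i. i \<ge> i0 \<Longrightarrow> (L i :: real) \<ge> T"
proof -
  have "\<forall>\<^sub>F i in sequentially. \<forall>t\<in>{0..T}. d (c i t) (\<gamma> t) < \<epsilon>" using assms by (auto simp: locally_converges_def)
  moreover have "\<forall>\<^sub>F i in sequentially. L i \<ge> T" using assms(2) by (simp add: filterlim_at_top)
  ultimately have "\<forall>\<^sub>F i in sequentially. (\<forall>t\<in>{0..T}. d (c i t) (\<gamma> t) < \<epsilon>) \<and> L i \<ge> T" by (rule eventually_conj)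
  then show ?thesis using that unfolding eventually_sequentially by blast
qed

lemma limit_of_segments_is_ray:
  assumes c: "\<And>i. quasi_geodesic 1 0 0 (L i) (c i)" and L: "filterlim L at_top sequentially"
    and \<gamma>: "\<gamma> ` {0..} \<subseteq> M" and pw: "\<And>t \<epsilon>. t \<ge> 0 \<Longrightarrow> \<epsilon> > 0 \<Longrightarrow> \<forall>\<^sub>F i in sequentially. d (c i t) (\<gamma> t) < \<epsilon>"
  shows "coarse_ray 0 \<gamma>"
  unfolding coarse_ray_def
proof (intro conjI allI impI \<gamma>)
  fix s t :: real assume st: "s \<ge> 0" "t \<ge> 0"
  have "\<bar>d (\<gamma> s) (\<gamma> t) - \<bar>s - t\<bar>\<bar> \<le> 0 + \<epsilon>" if e: "\<epsilon> > 0" for \<epsilon>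
  proof -
    have "\<forall>\<^sub>F i in sequentially. d (c i s) (\<gamma> s) < \<epsilon>/2 \<and> d (c i t) (\<gamma> t) < \<epsilon>/2 \<and> L i \<ge> max s t"
      using pw[OF st(1), of "\<epsilon>/2"] pw[OF st(2), of "\<epsilon>/2"] L e by (auto simp: filterlim_at_top intro!: eventually_conj)
    then obtain i where i: "d (c i s) (\<gamma> s) < \<epsilon>/2" "d (c i t) (\<gamma> t) < \<epsilon>/2" "L i \<ge> max s t"
      using eventually_happens'[OF sequentially_bot] by blast
    have in': "s \<in> {0..L i}" "t \<in> {0..L i}" using st i by auto
    have m: "c i s \<in> M" "c i t \<in> M" "\<gamma> s \<in> M" "\<gamma> t \<in> M" using qg_in[OF c] in' st \<gamma> by blast+
    have "d (c i s) (c i t) = \<bar>s - t\<bar>" using qg_lower[OF c in'] qg_upper[OF c in'] by simp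
    moreover have "d (\<gamma> s) (\<gamma> t) \<le> d (c i s) (\<gamma> s) + d (c i s) (c i t) + d (c i t) (\<gamma> t)"
      using triangle[of "\<gamma> s" "c i s" "\<gamma> t"] triangle[of "c i s" "c i t" "\<gamma> t"] m by (simp add: commute)
    moreover have "d (c i s) (c i t) \<le> d (c i s) (\<gamma> s) + d (\<gamma> s) (\<gamma> t) + d (c i t) (\<gamma> t)"
      using triangle[of "c i s" "\<gamma> s" "c i t"] triangle[of "\<gamma> s" "\<gamma> t" "c i t"] m by (simp add: commute)
    ultimately show ?thesis using i by linarith
  qed
  then show "\<bar>d (\<gamma> s) (\<gamma> t) - \<bar>s - t\<bar>\<bar> \<le> 0" by (rule field_le_epsilon)
qed

lemma locally_converges_coarse_ray:
  assumes "locally_converges c \<gamma>" "\<And>i. quasi_geodesic 1 0 0 (L i) (c i)" "filterlim L at_top sequentially"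
    "\<gamma> ` {0..} \<subseteq> M"
  shows "coarse_ray 0 \<gamma>"
proof (rule limit_of_segments_is_ray[OF assms(2,3,4)])
  fix t \<epsilon> :: real assume "t \<ge> 0" "\<epsilon> > 0"
  then have "\<forall>\<^sub>F i in sequentially. \<forall>t'\<in>{0..t}. d (c i t') (\<gamma> t') < \<epsilon>" using assms(1)
    by (auto simp: locally_converges_def)
  then show "\<forall>\<^sub>F i in sequentially. d (c i t) (\<gamma> t) < \<epsilon>" by (rule eventually_mono) (use \<open>t \<ge> 0\<close> in auto)
qed

text \<open>A quasi-geodesic with endpoints on \<open>\<gamma>\<close> ends within distance \<open>1\<close> of a segment \<open>c i\<close>, if \<open>i\<close> is large.\<close>

lemma limit_of_morse_segments:
  assumes lim: "locally_converges c \<gamma>" and c: "\<And>i. quasi_geodesic 1 0 0 (L i) (c i)"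
    and L: "filterlim L at_top sequentially"
    and \<gamma>: "\<gamma> ` {0..} \<subseteq> M" and N: "\<And>i S. 0 \<le> S \<Longrightarrow> S \<le> L i \<Longrightarrow> morse_set N (c i ` {0..S})"
  shows "morse_set (\<lambda>K C. max 1 (N K (C + 2)) + 1) (\<gamma> ` {0..})"
  unfolding morse_set_def
proof (intro conjI allI impI \<gamma>)
  fix K C a b \<sigma> assume K: "1 \<le> (K::real)" and C: "0 \<le> (C::real)"
    and *: "quasi_geodesic K C a b \<sigma> \<and> \<sigma> a \<in> \<gamma> ` {0..} \<and> \<sigma> b \<in> \<gamma> ` {0..}"
  then obtain s1 s2 where s: "s1 \<ge> 0" "s2 \<ge> 0" "\<sigma> a = \<gamma> s1" "\<sigma> b = \<gamma> s2" by auto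
  define S where "S = max s1 s2"
  obtain i where i: "\<And>t. t \<in> {0..S} \<Longrightarrow> d (c i t) (\<gamma> t) < 1" "L i \<ge> S"
    using locally_convergesD[OF lim L zero_less_one] by (metis order_refl)
  have S: "0 \<le> S" using s by (simp add: S_def)
  have mc: "c i t \<in> M" "\<gamma> t \<in> M" if "t \<in> {0..S}" for t using qg_in[OF c, of t i] that i \<gamma> by auto
  have e: "\<gamma> t \<in> nbhd 1 (c i ` {0..S})" if "t \<in> {0..S}" for t
    using mc[OF that] i(1)[OF that] that by (auto simp: in_nbhd intro!: bexI[of _ t])
  show "\<sigma> ` {a..b} \<subseteq> nbhd (max 1 (N K (C + 2)) + 1) (\<gamma> ` {0..})"
  proof (rule image_subsetI)
    fix t assume t: "t \<in> {a..b}"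
    have "\<sigma> t \<in> nbhd (max 1 (N K (C + 2 * 1))) (c i ` {0..S})"
      by (rule morse_near[OF N[OF S i(2)] K C _ _ _ _ t]) (use * s e in \<open>auto simp: S_def\<close>)
    then obtain r where r: "r \<in> {0..S}" "\<sigma> t \<in> M" "d (c i r) (\<sigma> t) \<le> max 1 (N K (C + 2))" by (auto simp: in_nbhd)
    have "d (\<gamma> r) (\<sigma> t) \<le> max 1 (N K (C + 2)) + 1"
      using triangle[of "\<gamma> r" "c i r" "\<sigma> t"] mc[OF r(1)] r i(1)[OF r(1)] by (simp add: commute)
    then show "\<sigma> t \<in> nbhd (max 1 (N K (C + 2)) + 1) (\<gamma> ` {0..})" using r mc[OF r(1)] by (auto simp: in_nbhd)
  qed
qed

text \<open>A diagonal sequence converges at all rational times. As the segments are isometric, it converges at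
  all other times as well, and, on comparing with a finite grid, uniformly on bounded intervals.\<close>

lemma arzela_ascoli:
  assumes pr: proper and e: "e \<in> M" and c: "\<And>i. quasi_geodesic 1 0 0 (L i) (c i)" 
    and L: "filterlim L at_top sequentially" and R: "\<And>i. d e (c i 0) \<le> R"
  obtains r \<gamma> where "strict_mono (r :: nat \<Rightarrow> nat)" "\<gamma> \<in> {0..} \<rightarrow>\<^sub>E M" "coarse_ray 0 \<gamma>"
    "locally_converges (\<lambda>i. c (r i)) \<gamma>"
proof -
  have R0: "R \<ge> 0" using R[of 0] nonneg order_trans by blast
  have L0: "L i \<ge> 0" for i using qg_le[OF c] .
  have iso: "d (c i s) (c i t) = \<bar>s - t\<bar>" if "s \<in> {0..L i}" "t \<in> {0..L i}" for i s t
    using qg_lower[OF c that] qg_upper[OF c that] by simp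
  have mc: "c i t \<in> M" if "t \<in> {0..L i}" for i t using qg_in[OF c that] .
  have ball: "c i t \<in> mcball e (R + t)" if "t \<in> {0..L i}" for i t
    using triangle[OF e mc[of 0 i] mc[OF that]] mc[OF that] iso[OF _ that, of 0] R[of i] L0[of i] that e
    by (simp add: mcball_def)
  have sub: "\<exists>r l. strict_mono (r :: nat \<Rightarrow> nat) \<and> l \<in> M \<and> (\<forall>\<epsilon>>0. \<forall>\<^sub>F i in sequentially. d (c (s (r i)) t) l < \<epsilon>)"
    if t: "t \<ge> 0" and s: "strict_mono (s :: nat \<Rightarrow> nat)" for t s
  proof -
    define \<sigma> where "\<sigma> = (\<lambda>i. if L (s i) \<ge> t then c (s i) t else e)"
    \<comment> \<open>Finitely many segments may be shorter than \<open>t\<close>; \<open>\<sigma>\<close> takes the value \<open>e\<close> for these.\<close>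
    have "compactin mtopology (mcball e (R + t))" using pr e by (simp add: proper_def)
    moreover have "range \<sigma> \<subseteq> mcball e (R + t)" using ball t e R0 by (auto simp: \<sigma>_def mcball_def)
    ultimately obtain l r where r: "l \<in> mcball e (R + t)" "strict_mono r" "limitin mtopology (\<sigma> \<circ> r) l sequentially"
      unfolding compactin_sequentially by blast
    have "filterlim (\<lambda>i. L (s (r i))) at_top sequentially"
      using filterlim_compose[OF L filterlim_subseq[OF strict_mono_o[OF s r(2)]]] by (simp add: o_def)
    then have ev: "\<forall>\<^sub>F i in sequentially. L (s (r i)) \<ge> t" by (simp add: filterlim_at_top)
    have "\<forall>\<^sub>F i in sequentially. d (c (s (r i)) t) l < \<epsilon>" if "\<epsilon> > 0" for \<epsilon>
    proof -
      have "\<forall>\<^sub>F i in sequentially. d ((\<sigma> \<circ> r) i) l < \<epsilon>"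
        using r(3) that unfolding limit_metric_sequentially eventually_sequentially by metis
      then show ?thesis using ev by eventually_elim (simp add: \<sigma>_def)
    qed
    then show ?thesis using r by (auto simp: mcball_def)
  qed
  define q where "q = (\<lambda>n. \<bar>real_of_rat (nat_to_rat_surj n)\<bar>)"
  define P where "P = (\<lambda>n (s :: nat \<Rightarrow> nat). \<exists>l\<in>M. \<forall>\<epsilon>>0. \<forall>\<^sub>F i in sequentially. d (c (s i) (q n)) l < \<epsilon>)"
  interpret subseqs P
  proof
    fix n and s :: "nat \<Rightarrow> nat" assume s: "strict_mono s"
    have "q n \<ge> 0" by (simp add: q_def)
    from sub[OF this s] obtain r' l where "strict_mono r'" "l \<in> M"
      "\<forall>\<epsilon>>0. \<forall>\<^sub>F i in sequentially. d (c (s (r' i)) (q n)) l < \<epsilon>"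
      by blast
    then show "\<exists>r'. strict_mono r' \<and> P n (s \<circ> r')" unfolding P_def o_def by blast
  qed
  define r where "r = diagseq"
  have r: "strict_mono r" by (simp add: r_def subseq_diagseq)
  have Pn: "P n r" for n
  proof -
    have "P n (diagseq \<circ> ((+) (Suc n)))"
    proof (rule diagseq_holds)
      fix r s n assume "strict_mono (r :: nat \<Rightarrow> nat)" "P n s"
      then obtain l where l: "l \<in> M" "\<And>\<epsilon>. \<epsilon> > 0 \<Longrightarrow> \<forall>\<^sub>F i in sequentially. d (c (s i) (q n)) l < \<epsilon>"
        by (auto simp: P_def)
      show "P n (s \<circ> r)" unfolding P_def o_def
        using l(1) eventually_subseq[OF \<open>strict_mono r\<close> l(2)] by blast
    qed
    then obtain l where l: "l \<in> M" "\<And>\<epsilon>. \<epsilon> > 0 \<Longrightarrow> \<forall>\<^sub>F i in sequentially. d (c (r (i + Suc n)) (q n)) l < \<epsilon>"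
      by (auto simp: P_def r_def o_def add.commute)
    have "\<forall>\<^sub>F i in sequentially. d (c (r i) (q n)) l < \<epsilon>" if "\<epsilon> > 0" for \<epsilon>
      using l(2)[OF that] eventually_sequentially_seg[of "\<lambda>i. d (c (r i) (q n)) l < \<epsilon>" "Suc n"] by blast
    then show ?thesis unfolding P_def using l(1) by blast
  qed
  have Lr: "filterlim (\<lambda>i. L (r i)) at_top sequentially"
    using filterlim_compose[OF L filterlim_subseq[OF r]] by (simp add: o_def)
  have lim: "\<exists>l\<in>M. \<forall>\<epsilon>>0. \<forall>\<^sub>F i in sequentially. d (c (r i) t) l < \<epsilon>" if t: "t \<ge> 0" for t
  proof -
    obtain r' l where r': "strict_mono (r' :: nat \<Rightarrow> nat)" "l \<in> M"
      "\<And>\<epsilon>. \<epsilon> > 0 \<Longrightarrow> \<forall>\<^sub>F i in sequentially. d (c (r (r' i)) t) l < \<epsilon>"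
      using sub[OF t r] by blast
    have "\<forall>\<^sub>F i in sequentially. d (c (r i) t) l < \<epsilon>" if e: "\<epsilon> > 0" for \<epsilon>
    proof -
      obtain x where x: "t < real_of_rat x" "real_of_rat x < t + \<epsilon>/6" using of_rat_dense[of t "t + \<epsilon>/6"] e by auto
      obtain n where n: "x = nat_to_rat_surj n" using surj_nat_to_rat_surj by (metis surjD)
      have "q n = \<bar>real_of_rat x\<bar>" by (simp only: q_def n)
      then have qn: "t < q n" "q n < t + \<epsilon>/6" using x t by linarith+
      obtain l' where l': "l' \<in> M" "\<And>\<epsilon>. \<epsilon> > 0 \<Longrightarrow> \<forall>\<^sub>F i in sequentially. d (c (r i) (q n)) l' < \<epsilon>"
        using Pn[of n] by (auto simp: P_def)
      have Lq: "\<forall>\<^sub>F i in sequentially. L (r i) \<ge> q n" using Lr by (simp add: filterlim_at_top)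
      have A: "\<forall>\<^sub>F i in sequentially. d (c (r i) (q n)) l' < \<epsilon>/6 \<and> L (r i) \<ge> q n"
        using eventually_conj[OF l'(2)[of "\<epsilon>/6"] Lq] e by simp
      then have "\<forall>\<^sub>F i in sequentially. d (c (r (r' i)) (q n)) l' < \<epsilon>/6 \<and> L (r (r' i)) \<ge> q n"
        by (rule eventually_subseq[OF r'(1)])
      moreover have "\<forall>\<^sub>F i in sequentially. d (c (r (r' i)) t) l < \<epsilon>/6" using r'(3)[of "\<epsilon>/6"] e by simp
      ultimately have "\<forall>\<^sub>F i in sequentially. (d (c (r (r' i)) (q n)) l' < \<epsilon>/6 \<and> L (r (r' i)) \<ge> q n) \<and> d (c (r (r'
        i)) t) l < \<epsilon>/6"
        by (rule eventually_conj)
      then obtain j where j: "d (c (r (r' j)) (q n)) l' < \<epsilon>/6" "L (r (r' j)) \<ge> q n" "d (c (r (r' j)) t) l < \<epsilon>/6"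
        using eventually_happens'[OF sequentially_bot] by blast
      have close: "d (c i t) (c i (q n)) < \<epsilon>/6" "c i t \<in> M" "c i (q n) \<in> M" if "L i \<ge> q n" for i
        using iso[of t i "q n"] mc[of t i] mc[of "q n" i] that qn t by auto
      have l'l: "d l' l < \<epsilon>/2"
        using triangle[of l' "c (r (r' j)) (q n)" l] triangle[of "c (r (r' j)) (q n)" "c (r (r' j)) t" l] close[OF
          j(2)] j l' r'(2)
        by (simp add: commute)
      from A show ?thesis
      proof eventually_elim
        case (elim i)
        show ?case
          using conjunct1[OF elim] close[OF conjunct2[OF elim]]
            triangle[of "c (r i) t" "c (r i) (q n)" l] triangle[of "c (r i) (q n)" l' l] l'(1) r'(2) l'l e by simp
      qed
    qed
    then show ?thesis using r' by blast
  qed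
  then obtain g where g: "\<And>t. t \<ge> 0 \<Longrightarrow> g t \<in> M" "\<And>t \<epsilon>. t \<ge> 0 \<Longrightarrow> \<epsilon> > 0 \<Longrightarrow> \<forall>\<^sub>F i in sequentially. d (c (r i) t) (g t) < \<epsilon>"
    by metis
  define \<gamma> where "\<gamma> = restrict g {0..}"
  have \<gamma>: "\<gamma> \<in> {0..} \<rightarrow>\<^sub>E M" using g by (auto simp: \<gamma>_def)
  have \<gamma>M: "\<gamma> ` {0..} \<subseteq> M" using \<gamma> by auto
  have pw: "\<forall>\<^sub>F i in sequentially. d (c (r i) t) (\<gamma> t) < \<epsilon>" if "t \<ge> 0" "\<epsilon> > 0" for t \<epsilon> using g(2)[OF that] that
    by (simp add: \<gamma>_def)
  have ray: "coarse_ray 0 \<gamma>" by (rule limit_of_segments_is_ray[OF c Lr \<gamma>M pw])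
  have "locally_converges (\<lambda>i. c (r i)) \<gamma>"
    unfolding locally_converges_def
  proof (intro allI impI)
    fix T \<epsilon> :: real assume e: "\<epsilon> > 0"
    define m where "m = nat \<lceil>T / (\<epsilon>/4)\<rceil>"
    have "\<forall>\<^sub>F i in sequentially. \<forall>k\<in>{..m}. d (c (r i) (real k * (\<epsilon>/4))) (\<gamma> (real k * (\<epsilon>/4))) < \<epsilon>/4"
    proof (rule eventually_ball_finite, simp, rule ballI)
      fix k :: nat
      show "\<forall>\<^sub>F i in sequentially. d (c (r i) (real k * (\<epsilon>/4))) (\<gamma> (real k * (\<epsilon>/4))) < \<epsilon>/4"
        by (rule pw) (use e in auto)
    qed
    moreover have "\<forall>\<^sub>F i in sequentially. L (r i) \<ge> T" using Lr by (simp add: filterlim_at_top)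
    ultimately show "\<forall>\<^sub>F i in sequentially. \<forall>t\<in>{0..T}. d (c (r i) t) (\<gamma> t) < \<epsilon>"
    proof eventually_elim
      case (elim i)
      show ?case
      proof
        fix t assume t: "t \<in> {0..T}"
        define k where "k = nat \<lfloor>t / (\<epsilon>/4)\<rfloor>"
        have "t / (\<epsilon>/4) \<ge> 0" using t e by auto
        then have fl: "real k \<le> t / (\<epsilon>/4)" "t / (\<epsilon>/4) < real k + 1" unfolding k_def by linarith+
        then have k1: "real k * (\<epsilon>/4) \<le> t" "t < real k * (\<epsilon>/4) + \<epsilon>/4" using e by (simp_all add: field_simps)
        have "t / (\<epsilon>/4) \<le> T / (\<epsilon>/4)" using t e by (intro divide_right_mono) auto
        then have "k \<le> m" unfolding k_def m_def by (intro nat_mono) linarith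
        then have 1: "d (c (r i) (real k * (\<epsilon>/4))) (\<gamma> (real k * (\<epsilon>/4))) < \<epsilon>/4" using elim(1) by blast
        let ?u = "real k * (\<epsilon>/4)"
        have u0: "?u \<ge> 0" using e by simp
        have 2: "d (c (r i) t) (c (r i) ?u) \<le> \<epsilon>/4" using iso[of t "r i" ?u] t k1 u0 elim(2) by simp
        have 3: "d (\<gamma> ?u) (\<gamma> t) \<le> \<epsilon>/4" using coarse_rayD(2)[OF ray u0, of t] t k1 by simp
        have "0 \<le> t" "t \<le> L (r i)" using t elim(2) by auto
        moreover have "?u \<le> L (r i)" using calculation(2) k1(1) by linarith
        ultimately have t0: "0 \<le> t" "t \<in> {0..L (r i)}" "?u \<in> {0..L (r i)}" using u0 by auto
        note m = mc[OF t0(2)] mc[OF t0(3)] coarse_rayD(1)[OF ray t0(1) t0(1)] coarse_rayD(1)[OF ray u0 u0]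
        show "d (c (r i) t) (\<gamma> t) < \<epsilon>"
          using triangle[OF m(1,2,3)] triangle[OF m(2,4,3)] 1 2 3 e by simp
      qed
    qed
  qed
  then show ?thesis using that[OF r \<gamma> ray] by blast
qed

section \<open>Geometric actions\<close>

lemma action_group: "geometric_action G \<phi> \<Longrightarrow> group G"
  unfolding geometric_action_def group_action_def group_hom_def by blast

lemma geometric_action_group_action: "geometric_action G \<phi> \<Longrightarrow> group_action G M \<phi>"
  unfolding geometric_action_def by blast

lemma action_isometry:
  assumes "geometric_action G \<phi>" "g \<in> carrier G"
  shows "isometry (\<phi> g)"
  using group_action.element_image[OF geometric_action_group_action[OF assms(1)] assms(2)] assms
  unfolding isometry_def geometric_action_def by (auto simp: image_subset_iff)

lemma action_mult:
  assumes "geometric_action G \<phi>" "g \<in> carrier G" "h \<in> carrier G" "p \<in> M"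
  shows "\<phi> (g \<otimes>\<^bsub>G\<^esub> h) p = \<phi> g (\<phi> h p)"
  using group_action.composition_rule[OF geometric_action_group_action[OF assms(1)] assms(4,2,3)] .

lemma action_one:
  assumes "geometric_action G \<phi>" "p \<in> M"
  shows "\<phi> \<one>\<^bsub>G\<^esub> p = p"
  using group_action.id_eq_one[OF geometric_action_group_action[OF assms(1)]] assms(2) by (metis restrict_apply')

lemma action_inv:
  assumes "geometric_action G \<phi>" "g \<in> carrier G" "p \<in> M"
  shows "\<phi> (inv\<^bsub>G\<^esub> g) (\<phi> g p) = p" "\<phi> g (\<phi> (inv\<^bsub>G\<^esub> g) p) = p"
proof -
  interpret group G using action_group[OF assms(1)] .
  show "\<phi> (inv\<^bsub>G\<^esub> g) (\<phi> g p) = p" "\<phi> g (\<phi> (inv\<^bsub>G\<^esub> g) p) = p"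
    using action_mult[OF assms(1) _ _ assms(3), of "inv\<^bsub>G\<^esub> g" g] action_mult[OF assms(1) _ _ assms(3), of
      g "inv\<^bsub>G\<^esub> g"] 
      assms action_one[OF assms(1,3)] by simp_all
qed

lemma action_cobounded:
  assumes ga: "geometric_action G \<phi>" and e: "e \<in> M"
  obtains R where "R \<ge> 0" "\<And>p. p \<in> M \<Longrightarrow> \<exists>g\<in>carrier G. d p (\<phi> g e) \<le> R"
proof -
  obtain K where K: "compactin mtopology K" "(\<Union>g\<in>carrier G. \<phi> g ` K) = M"
    using ga unfolding geometric_action_def by blast
  have KM: "K \<subseteq> M" using K(1) compactin_subset_topspace by fastforce
  have "mbounded K" using K(1) by (rule compactin_imp_mbounded)
  then obtain B where B: "\<And>p. p \<in> K \<Longrightarrow> d e p \<le> B"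
    using mbounded_alt_pos[of "insert e K"] e mbounded_insert[of e K] by (metis insertCI)
  show ?thesis
  proof (rule that)
    show "max B 0 \<ge> 0" by simp
    fix p assume p: "p \<in> M"
    then obtain g k where g: "g \<in> carrier G" "k \<in> K" "p = \<phi> g k" using K(2) by blast
    have "d p (\<phi> g e) = d k e" using isometryD(2)[OF action_isometry[OF ga g(1)]] g KM e by blast
    then show "\<exists>g\<in>carrier G. d p (\<phi> g e) \<le> max B 0" using B[OF g(2)] g(1) by (auto simp: commute intro!: bexI[of _ g])
  qed
qed

lemma action_proper:
  assumes ga: "geometric_action G \<phi>" and pr: proper and e: "e \<in> M"
  shows "finite {g \<in> carrier G. d e (\<phi> g e) \<le> R}"
proof (cases "R \<ge> 0")
  case True
  have "compactin mtopology (mcball e R)" using pr e by (simp add: proper_def)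
  then have "finite {g \<in> carrier G. \<phi> g ` mcball e R \<inter> mcball e R \<noteq> {}}"
    using ga unfolding geometric_action_def by blast
  moreover have "{g \<in> carrier G. d e (\<phi> g e) \<le> R} \<subseteq> {g \<in> carrier G. \<phi> g ` mcball e R \<inter> mcball e R \<noteq> {}}"
  proof clarsimp
    fix g assume g: "g \<in> carrier G" "d e (\<phi> g e) \<le> R" "\<phi> g ` mcball e R \<inter> mcball e R = {}"
    have "\<phi> g e \<in> mcball e R" using g e isometryD(1)[OF action_isometry[OF ga g(1)] e] by (simp add: mcball_def)
    moreover have "\<phi> g e \<in> \<phi> g ` mcball e R" using e True by (intro imageI) (simp add: mcball_def)
    ultimately show False using g by blast
  qed
  ultimately show ?thesis by (rule finite_subset[rotated])
next
  case False
  then have "\<not> d e (\<phi> g e) \<le> R" for g using nonneg[of e "\<phi> g e"] by linarith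
  then have "{g \<in> carrier G. d e (\<phi> g e) \<le> R} = {}" by blast
  then show ?thesis by (simp only: finite.emptyI)
qed

lemma action_morse:
  assumes ga: "geometric_action G \<phi>" and g: "g \<in> carrier G" and N: "morse_set N A"
  shows "morse_set N (\<phi> g ` A)"
  unfolding morse_set_def
proof (intro conjI allI impI)
  interpret group G using action_group[OF ga] .
  have AM: "A \<subseteq> M" using N by (simp add: morse_set_def)
  show "\<phi> g ` A \<subseteq> M" using isometryD(1)[OF action_isometry[OF ga g]] AM by blast
  fix K C a b \<sigma> assume K: "1 \<le> (K::real)" "0 \<le> (C::real)"
    and *: "quasi_geodesic K C a b \<sigma> \<and> \<sigma> a \<in> \<phi> g ` A \<and> \<sigma> b \<in> \<phi> g ` A"
  have gi: "inv\<^bsub>G\<^esub> g \<in> carrier G" using g by simp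
  have "quasi_geodesic K C a b (\<lambda>t. \<phi> (inv\<^bsub>G\<^esub> g) (\<sigma> t))" using isometry_qg[OF action_isometry[OF ga gi]] * by blast
  moreover have "\<phi> (inv\<^bsub>G\<^esub> g) (\<sigma> a) \<in> A" "\<phi> (inv\<^bsub>G\<^esub> g) (\<sigma> b) \<in> A" using * action_inv(1)[OF ga g] AM by auto
  ultimately have 1: "\<phi> (inv\<^bsub>G\<^esub> g) (\<sigma> t) \<in> nbhd (N K C) A" if "t \<in> {a..b}" for t
    using morse_setD[OF N K] that by blast
  show "\<sigma> ` {a..b} \<subseteq> nbhd (N K C) (\<phi> g ` A)"
  proof (rule image_subsetI)
    fix t assume t: "t \<in> {a..b}"
    have "\<sigma> t \<in> M" using * qg_in t by blast
    then show "\<sigma> t \<in> nbhd (N K C) (\<phi> g ` A)"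
      using isometry_nbhd[OF action_isometry[OF ga g] 1[OF t]] action_inv(2)[OF ga g] by simp
  qed
qed

lemma morse_hausdorff:
  assumes N: "morse_set N A" and B: "B \<subseteq> M" and r: "r \<ge> 0" "A \<subseteq> nbhd r B" "B \<subseteq> nbhd r A"
  obtains N' where "morse_set N' B"
proof (rule that)
  show "morse_set (\<lambda>K C. max r (N K (C + 2 * r)) + r) B"
    unfolding morse_set_def
  proof (intro conjI allI impI B)
    fix K C a b \<sigma> assume K: "1 \<le> (K::real)" "0 \<le> (C::real)" and *: "quasi_geodesic K C a b \<sigma> \<and> \<sigma> a \<in> B \<and> \<sigma> b \<in> B"
    show "\<sigma> ` {a..b} \<subseteq> nbhd (max r (N K (C + 2 * r)) + r) B"
    proof (rule image_subsetI)
      fix t assume t: "t \<in> {a..b}"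
      have "\<sigma> t \<in> nbhd (max r (N K (C + 2 * r))) A"
        by (rule morse_near[OF N K _ _ _ r(1) t]) (use * r in blast)+
      also have "\<dots> \<subseteq> nbhd (max r (N K (C + 2 * r))) (nbhd r B)" using r by (intro nbhd_mono) auto
      also have "\<dots> \<subseteq> nbhd (max r (N K (C + 2 * r)) + r) B" by (rule nbhd_trans)
      finally show "\<sigma> t \<in> nbhd (max r (N K (C + 2 * r)) + r) B" .
    qed
  qed
qed

text \<open>A jump to the new origin turns \<open>\<sigma>\<close> into a coarse ray from \<open>e\<close> with the same endpoint.\<close>

lemma rebase_ray:
  assumes \<sigma>: "coarse_ray C \<sigma>" and N: "morse_set N (\<sigma> ` {0..})" and e: "e \<in> M"
  defines "\<rho> \<equiv> \<sigma>(0 := e)" and "r \<equiv> d e (\<sigma> 0)"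
  shows "coarse_ray (C + r) \<rho>" "\<rho> ` {0..} \<subseteq> nbhd r (\<sigma> ` {0..})" "\<sigma> ` {0..} \<subseteq> nbhd r (\<rho> ` {0..})"
    "\<exists>N'. morse_set N' (\<rho> ` {0..})"
proof -
  have C: "C \<ge> 0" "r \<ge> 0" using coarse_ray_nonneg[OF \<sigma>] by (auto simp: r_def)
  have m: "\<sigma> t \<in> M" if "t \<ge> 0" for t using coarse_rayD(1)[OF \<sigma> that that] .
  have sh: "\<bar>d (\<sigma> s) (\<sigma> t) - \<bar>s - t\<bar>\<bar> \<le> C" if "s \<ge> 0" "t \<ge> 0" for s t using \<sigma> that by (auto simp: coarse_ray_def)
  have e0: "\<bar>d e (\<sigma> t) - t\<bar> \<le> C + r" if "t \<ge> 0" for t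
    using sh[of 0 t] triangle[of e "\<sigma> 0" "\<sigma> t"] triangle[of "\<sigma> 0" e "\<sigma> t"] m[of 0] m[OF that] e that
    by (simp add: r_def commute abs_le_iff)
  show "coarse_ray (C + r) \<rho>"
    unfolding coarse_ray_def
  proof (intro conjI allI impI)
    show "\<rho> ` {0..} \<subseteq> M" using m e by (auto simp: \<rho>_def)
    fix s t :: real assume st: "s \<ge> 0" "t \<ge> 0"
    show "\<bar>d (\<rho> s) (\<rho> t) - \<bar>s - t\<bar>\<bar> \<le> C + r"
      using sh[OF st] e0[OF st(1)] e0[OF st(2)] st C e by (auto simp: \<rho>_def commute)
  qed
  show 1: "\<rho> ` {0..} \<subseteq> nbhd r (\<sigma> ` {0..})"
  proof (rule image_subsetI)
    fix t :: real assume t: "t \<in> {0..}"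
    show "\<rho> t \<in> nbhd r (\<sigma> ` {0..})" using m[of t] t e C
      by (auto simp: \<rho>_def r_def in_nbhd commute intro!: bexI[of _ t])
  qed
  show 2: "\<sigma> ` {0..} \<subseteq> nbhd r (\<rho> ` {0..})"
  proof (rule image_subsetI)
    fix t :: real assume t: "t \<in> {0..}"
    show "\<sigma> t \<in> nbhd r (\<rho> ` {0..})" using m[of t] t e C
      by (auto simp: \<rho>_def r_def in_nbhd commute intro!: bexI[of _ t])
  qed
  have "\<rho> ` {0..} \<subseteq> M" using m e by (auto simp: \<rho>_def)
  then show "\<exists>N'. morse_set N' (\<rho> ` {0..})" using morse_hausdorff[OF N _ C(2) 2 1] by metis
qed

text \<open>Suppose that all of \<open>H\<close> fixes the endpoint of \<open>\<sigma>\<close>. As \<open>k g \<sigma> = g (g\<^sup>-\<^sup>1 k g) \<sigma>\<close>, normality gives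
  that \<open>H\<close> fixes the endpoint of every translate \<open>g \<sigma>\<close>. Let \<open>g n\<close> bring the point \<open>q n\<close> of the quasi-plane near \<open>e\<close>.
  By \<open>flat_translates_not_uniformly_morse\<close>, applied with a translate \<open>g m \<sigma>\<close> as \<open>\<alpha>\<close>, only finitely many \<open>g n \<sigma>\<close> are
  asymptotic to a given \<open>g m \<sigma>\<close>. So there are three translates, no two of them asymptotic, and by
  \<open>fixed_triple_bounded\<close> the elements of \<open>H\<close> have bounded displacement; there are only finitely many such elements.\<close>

lemma element_moving_ray:
  assumes geo: geodesic_space and pr: proper and ga: "geometric_action G \<phi>" and H: "H \<lhd> G" "infinite H"
    and q: "quasi_plane K C q" and \<sigma>: "coarse_ray 0 \<sigma>" and N: "morse_set N (\<sigma> ` {0..})"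
  obtains k where "k \<in> H" "\<And>R. \<not> (\<lambda>t. \<phi> k (\<sigma> t)) ` {0..} \<subseteq> nbhd R (\<sigma> ` {0..})"
proof (rule ccontr)
  assume "\<not> thesis"
  with that have fix1: "\<exists>R. (\<lambda>t. \<phi> k (\<sigma> t)) ` {0..} \<subseteq> nbhd R (\<sigma> ` {0..})" if "k \<in> H" for k using \<open>k \<in> H\<close> by blast
  interpret group G using action_group[OF ga] .
  interpret H: normal H G by (rule H(1))
  have qm: "q x \<in> M" for x using q by (auto simp: quasi_plane_def)
  have \<sigma>m: "\<sigma> t \<in> M" if "t \<ge> 0" for t using coarse_rayD(1)[OF \<sigma> that that] .
  define e where "e = \<sigma> 0"
  have e: "e \<in> M" by (simp add: e_def \<sigma>m)
  note iso = action_isometry[OF ga]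
  obtain R0 where R0: "R0 \<ge> 0" "\<And>p. p \<in> M \<Longrightarrow> \<exists>g\<in>carrier G. d p (\<phi> g e) \<le> R0" using action_cobounded[OF ga e] by blast
  have "\<exists>g\<in>carrier G. d (\<phi> g (q (of_nat n))) e \<le> R0" for n :: nat
  proof -
    obtain h where h: "h \<in> carrier G" "d (q (of_nat n)) (\<phi> h e) \<le> R0" using R0(2) qm by blast
    have "d (\<phi> (inv\<^bsub>G\<^esub> h) (q (of_nat n))) (\<phi> (inv\<^bsub>G\<^esub> h) (\<phi> h e)) = d (q (of_nat n)) (\<phi> h e)"
      using isometryD(2)[OF iso[of "inv\<^bsub>G\<^esub> h"]] qm h e isometryD(1)[OF iso] by simp
    then show ?thesis using h action_inv(1)[OF ga h(1) e] by (intro bexI[of _ "inv\<^bsub>G\<^esub> h"]) auto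
  qed
  then obtain g where g: "\<And>n :: nat. g n \<in> carrier G" "\<And>n. d (\<phi> (g n) (q (of_nat n))) e \<le> R0" by metis
  define \<tau> where "\<tau> = (\<lambda>n t. \<phi> (g n) (\<sigma> t))"
  have \<tau>: "coarse_ray 0 (\<tau> n)" for n unfolding \<tau>_def by (rule isometry_coarse_ray[OF iso[OF g(1)] \<sigma>])
  have \<tau>N: "morse_set N (\<tau> n ` {0..})" for n using action_morse[OF ga g(1) N] by (simp add: \<tau>_def image_image)
  have "\<exists>D. \<forall>n R'. \<tau> n ` {0..} \<subseteq> nbhd R' (\<tau> m ` {0..}) \<longrightarrow> real n \<le> D" for m
  proof -
    define R where "R = R0 + d e (\<tau> m 0)"
    have tm: "\<tau> m 0 \<in> M" using coarse_rayD(1)[OF \<tau>, of 0 0] by simp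
    have R: "R \<ge> 0" using R0 by (simp add: R_def)
    obtain D where D: "\<And>u \<phi> \<alpha> R'. isometry \<phi> \<Longrightarrow> coarse_ray 0 \<alpha> \<Longrightarrow> morse_set N (\<alpha> ` {0..}) \<Longrightarrow> \<phi> (q u) \<in> nbhd R (\<alpha> ` {0..})
     \<Longrightarrow> (\<lambda>t. \<phi> (\<sigma> t)) ` {0..} \<subseteq> nbhd R' (\<alpha> ` {0..}) \<Longrightarrow> cmod u \<le> D"
      using flat_translates_not_uniformly_morse[OF geo q \<sigma> N R] by metis
    have "real n \<le> D" if "\<tau> n ` {0..} \<subseteq> nbhd R' (\<tau> m ` {0..})" for n R'
    proof -
      have qn: "\<phi> (g n) (q (of_nat n)) \<in> M" using isometryD(1)[OF iso[OF g(1)] qm] .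
      have "d (\<tau> m 0) (\<phi> (g n) (q (of_nat n))) \<le> R"
        using triangle[OF tm e qn] g(2)[of n] by (simp add: R_def commute)
      then have "\<phi> (g n) (q (of_nat n)) \<in> nbhd R (\<tau> m ` {0..})" using tm qn by (auto simp: in_nbhd)
      then show ?thesis using D[OF iso[OF g(1)] \<tau> \<tau>N, of n "of_nat n" m R'] that by (simp add: \<tau>_def)
    qed
    then show ?thesis by blast
  qed
  then obtain D where D: "\<And>m n R'. \<tau> n ` {0..} \<subseteq> nbhd R' (\<tau> m ` {0..}) \<Longrightarrow> real n \<le> D m" by metis
  obtain n2 where n2: "real n2 > D 0" using reals_Archimedean2 by blast
  obtain n3 where n3: "real n3 > max (D 0) (D n2)" using reals_Archimedean2 by blast
  have diff: "\<not> \<tau> n2 ` {0..} \<subseteq> nbhd R' (\<tau> 0 ` {0..})" "\<not> \<tau> n3 ` {0..} \<subseteq> nbhd R' (\<tau> 0 ` {0..})"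
    "\<not> \<tau> n3 ` {0..} \<subseteq> nbhd R' (\<tau> n2 ` {0..})" for R'
    using D[of n2 R' 0] D[of n3 R' 0] D[of n3 R' n2] n2 n3 by auto
  define \<rho> where "\<rho> = (\<lambda>n. (\<tau> n)(0 := e))"
  define r where "r = (\<lambda>n. d e (\<tau> n 0))"
  note reb = rebase_ray[OF \<tau> \<tau>N e, folded \<rho>_def r_def]
  have reb2: "\<rho> n ` {0..} \<subseteq> nbhd (r n) (\<tau> n ` {0..})" "\<tau> n ` {0..} \<subseteq> nbhd (r n) (\<rho> n ` {0..})" for n
    using reb(2,3)[of n] by (simp_all add: \<rho>_def r_def)
  define C1 where "C1 = max (r 0) (max (r n2) (r n3))"
  have mono: "coarse_ray a \<alpha> \<Longrightarrow> a \<le> b \<Longrightarrow> coarse_ray b \<alpha>" for a b \<alpha> unfolding coarse_ray_def by (meson order_trans)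
  have cr: "coarse_ray (r n) (\<rho> n)" for n using reb(1)[of n] by (simp add: \<rho>_def r_def)
  have cr3: "coarse_ray C1 (\<rho> 0)" "coarse_ray C1 (\<rho> n2)" "coarse_ray C1 (\<rho> n3)"
    by (rule mono[OF cr]; simp add: C1_def)+
  obtain N1 where N1: "morse_set N1 (\<rho> 0 ` {0..})" using reb(4)[of 0] by (auto simp: \<rho>_def)
  obtain N2 where N2: "morse_set N2 (\<rho> n2 ` {0..})" using reb(4)[of n2] by (auto simp: \<rho>_def)
  obtain N3 where N3: "morse_set N3 (\<rho> n3 ` {0..})" using reb(4)[of n3] by (auto simp: \<rho>_def)
  have trans: "\<tau> n ` {0..} \<subseteq> nbhd (r m + R' + r n) (\<tau> m ` {0..})" if "\<rho> n ` {0..} \<subseteq> nbhd R' (\<rho> m ` {0..})" for n m R'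
    using asymptotic_trans[OF reb2(2)[of n] asymptotic_trans[OF that reb2(1)[of m]]] .
  have diff': "\<not> \<rho> n2 ` {0..} \<subseteq> nbhd R' (\<rho> 0 ` {0..})" "\<not> \<rho> n3 ` {0..} \<subseteq> nbhd R' (\<rho> 0 ` {0..})"
    "\<not> \<rho> n3 ` {0..} \<subseteq> nbhd R' (\<rho> n2 ` {0..})" for R'
    using trans[of n2 R' 0] diff(1)[of "r 0 + R' + r n2"] trans[of n3 R' 0] diff(2)[of "r 0 + R' + r n3"]
      trans[of n3 R' n2] diff(3)[of "r n2 + R' + r n3"] by blast+
  have \<rho>0: "\<rho> n 0 = e" for n by (simp add: \<rho>_def)
  obtain B where B: "\<And>\<phi> R1 R2 R3. isometry \<phi> \<Longrightarrow> (\<lambda>t. \<phi> (\<rho> 0 t)) ` {0..} \<subseteq> nbhd R1 (\<rho> 0 ` {0..})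
     \<Longrightarrow> (\<lambda>t. \<phi> (\<rho> n2 t)) ` {0..} \<subseteq> nbhd R2 (\<rho> n2 ` {0..}) \<Longrightarrow> (\<lambda>t. \<phi> (\<rho> n3 t)) ` {0..} \<subseteq> nbhd R3 (\<rho> n3 ` {0..})
     \<Longrightarrow> d e (\<phi> e) \<le> B"
    using fixed_triple_bounded[OF geo cr3 N1 N2 N3 \<rho>0 \<rho>0 \<rho>0 diff'] by blast
  have fixed: "\<exists>R. (\<lambda>t. \<phi> k (\<rho> n t)) ` {0..} \<subseteq> nbhd R (\<rho> n ` {0..})" if k: "k \<in> H" for k n
  proof -
    have kG: "k \<in> carrier G" using k H.subset by blast
    define k' where "k' = inv\<^bsub>G\<^esub> (g n) \<otimes>\<^bsub>G\<^esub> k \<otimes>\<^bsub>G\<^esub> g n"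
    have k': "k' \<in> H" unfolding k'_def by (rule H.inv_op_closed1[OF g(1) k])
    have k'G: "k' \<in> carrier G" using k' H.subset by blast
    have eq: "g n \<otimes>\<^bsub>G\<^esub> k' = k \<otimes>\<^bsub>G\<^esub> g n" using g(1)[of n] kG by (simp add: k'_def m_assoc[symmetric])
    obtain R where R: "(\<lambda>t. \<phi> k' (\<sigma> t)) ` {0..} \<subseteq> nbhd R (\<sigma> ` {0..})" using fix1[OF k'] by blast
    have "(\<lambda>t. \<phi> k (\<tau> n t)) ` {0..} \<subseteq> nbhd R (\<tau> n ` {0..})"
    proof (rule image_subsetI)
      fix t :: real assume t: "t \<in> {0..}"
      have "\<phi> k (\<tau> n t) = \<phi> (g n) (\<phi> k' (\<sigma> t))"
        using action_mult[OF ga kG g(1)[of n] \<sigma>m[of t]] action_mult[OF ga g(1)[of n] k'G \<sigma>m[of t]] t eq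
          by (simp add: \<tau>_def)
      moreover have "\<phi> k' (\<sigma> t) \<in> nbhd R (\<sigma> ` {0..})" using R t by blast
      ultimately show "\<phi> k (\<tau> n t) \<in> nbhd R (\<tau> n ` {0..})"
        using isometry_nbhd[OF iso[OF g(1)[of n]], of "\<phi> k' (\<sigma> t)" R "\<sigma> ` {0..}"] by (simp add: \<tau>_def image_image)
    qed
    then have 2: "(\<lambda>t. \<phi> k (\<tau> n t)) ` {0..} \<subseteq> nbhd (r n + R) (\<rho> n ` {0..})"
      by (rule asymptotic_trans[OF _ reb2(2)])
    have 1: "(\<lambda>t. \<phi> k (\<rho> n t)) ` {0..} \<subseteq> nbhd (r n) ((\<lambda>t. \<phi> k (\<tau> n t)) ` {0..})"
    proof (rule image_subsetI)
      fix t :: real assume t: "t \<in> {0..}"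
      then have "\<rho> n t \<in> nbhd (r n) (\<tau> n ` {0..})" using reb2(1) by blast
      from isometry_nbhd[OF iso[OF kG] this]
      show "\<phi> k (\<rho> n t) \<in> nbhd (r n) ((\<lambda>t. \<phi> k (\<tau> n t)) ` {0..})" by (simp only: image_image)
    qed
    show ?thesis using asymptotic_trans[OF 1 2] by blast
  qed
  have "d e (\<phi> k e) \<le> B" if "k \<in> H" for k
    using fixed[OF that, of 0] fixed[OF that, of n2] fixed[OF that, of n3] B[OF iso[of k]] that H.subset by blast
  then have "H \<subseteq> {g \<in> carrier G. d e (\<phi> g e) \<le> B}" using H.subset by blast
  then show False using action_proper[OF ga pr e] H(2) finite_subset by blast
qed

text \<open>Let \<open>s n\<close> be \<open>\<gamma>\<close> seen backwards from \<open>\<gamma> n\<close>, translated to the basepoint by the inverse of an element \<open>g n\<close> that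
  moves the basepoint near \<open>\<gamma> n\<close>. A subsequence of these segments converges to a Morse ray
  \<open>\<sigma>\<close>; choose \<open>k \<in> H\<close> that moves the endpoint of \<open>\<sigma>\<close>. Then \<open>s n\<close> and \<open>k (s n)\<close> diverge uniformly in \<open>n\<close>.
  The elements \<open>u i\<close> are the conjugates of \<open>k\<close> by \<open>g n\<close>, with \<open>n = r i\<close> in this subsequence.

  For \<open>f \<in> G\<close> the points \<open>e'\<close> and \<open>(f \<otimes> u i \<otimes> f\<^sup>-\<^sup>1) x\<close> are, up to constants, the origins of the Morse rays
  \<open>f \<gamma>\<close> and \<open>f (u i) \<gamma>\<close>. Both rays pass near \<open>m = f (\<gamma> n)\<close>. A geodesic \<open>c\<close> between the two
  origins, cut at a point \<open>c T\<close> almost nearest to \<open>m\<close>, consists of one part near \<open>f \<gamma>\<close> and another near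
  \<open>f (u i) \<gamma>\<close>. So \<open>c T\<close> is near both rays. Translated by the inverse of \<open>f \<otimes> g n\<close> these become \<open>s n\<close> and \<open>k (s n)\<close>,
  which diverge; so \<open>c T\<close> is near \<open>m\<close>, and \<open>T\<close> is at least \<open>i\<close> up to a constant.\<close>

lemma conjugates_follow_translates:
  assumes geo: geodesic_space and pr: proper and ga: "geometric_action G \<phi>" and H: "H \<lhd> G" "infinite H"
    and q: "quasi_plane K C q" and \<gamma>: "coarse_ray 0 \<gamma>" and N: "morse_set N (\<gamma> ` {0..})"
  obtains u :: "nat \<Rightarrow> 'g" where "range u \<subseteq> H"
    "\<And>g x e'. g \<in> carrier G \<Longrightarrow> x \<in> M \<Longrightarrow> e' \<in> M \<Longrightarrow> \<exists>\<rho>1 \<rho>2. \<forall>i l c. quasi_geodesic 1 0 0 l c \<longrightarrow> c 0 = e' \<longrightarrow>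
        c l = \<phi> (g \<otimes>\<^bsub>G\<^esub> u i \<otimes>\<^bsub>G\<^esub> inv\<^bsub>G\<^esub> g) x \<longrightarrow>
        (\<exists>T\<in>{0..l}. real i - \<rho>2 \<le> T \<and> c ` {0..T} \<subseteq> nbhd \<rho>1 ((\<lambda>t. \<phi> g (\<gamma> t)) ` {0..}))"
proof -
  interpret group G using action_group[OF ga] .
  interpret H: normal H G by (rule H(1))
  have \<gamma>m: "\<gamma> t \<in> M" if "t \<ge> 0" for t using coarse_rayD(1)[OF \<gamma> that that] .
  have \<gamma>d: "d (\<gamma> s) (\<gamma> t) = \<bar>s - t\<bar>" if "s \<ge> 0" "t \<ge> 0" for s t using coarse_rayD(2,3)[OF \<gamma> that] by simp
  define e where "e = \<gamma> 0"
  have e: "e \<in> M" by (simp add: e_def \<gamma>m)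
  note iso = action_isometry[OF ga]
  obtain R0 where R0: "R0 \<ge> 0" "\<And>p. p \<in> M \<Longrightarrow> \<exists>g\<in>carrier G. d p (\<phi> g e) \<le> R0" using action_cobounded[OF ga e] by blast
  have "\<exists>g\<in>carrier G. d (\<gamma> (real n)) (\<phi> g e) \<le> R0" for n using R0(2) \<gamma>m by simp
  then obtain g where g: "\<And>n :: nat. g n \<in> carrier G" "\<And>n. d (\<gamma> (real n)) (\<phi> (g n) e) \<le> R0" by metis
  have gi: "inv\<^bsub>G\<^esub> (g n) \<in> carrier G" for n using g(1) by simp
  define s where "s = (\<lambda>n t. \<phi> (inv\<^bsub>G\<^esub> (g n)) (\<gamma> (real n - t)))"
  have s0: "d e (s n 0) \<le> R0" "s n 0 \<in> M" for n
  proof -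
    have "d (s n 0) e = d (\<phi> (inv\<^bsub>G\<^esub> (g n)) (\<gamma> (real n))) (\<phi> (inv\<^bsub>G\<^esub> (g n)) (\<phi> (g n) e))"
      using action_inv(1)[OF ga g(1) e] by (simp add: s_def)
    also have "\<dots> = d (\<gamma> (real n)) (\<phi> (g n) e)" using isometryD[OF iso] gi g(1) \<gamma>m e by simp
    finally show "d e (s n 0) \<le> R0" using g(2)[of n] by (simp add: commute)
    show "s n 0 \<in> M" using isometryD(1)[OF iso[OF gi]] \<gamma>m by (simp add: s_def)
  qed
  have s_qg: "quasi_geodesic 1 0 0 (real n) (s n)" for n
  proof -
    have "quasi_geodesic 1 0 (- real n) 0 (\<lambda>t. \<gamma> (- t))"
      using qg_reverse[OF coarse_ray_qg[OF \<gamma>, of 0 "real n"]] by simp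
    from qg_shift[OF this, of "real n"] have "quasi_geodesic 1 0 0 (real n) (\<lambda>t. \<gamma> (real n - t))" by simp
    from isometry_qg[OF iso[OF gi] this] show ?thesis by (simp add: s_def)
  qed
  have sm: "s n t \<in> M" if "t \<in> {0..real n}" for n t using qg_in[OF s_qg that] .
  have sd: "d (s n t) (s n t') = \<bar>t - t'\<bar>" if "t \<in> {0..real n}" "t' \<in> {0..real n}" for n t t'
    using qg_lower[OF s_qg that] qg_upper[OF s_qg that] by simp
  obtain N2 where N2: "\<And>a b. 0 \<le> a \<Longrightarrow> a \<le> b \<Longrightarrow> morse_set N2 (\<gamma> ` {a..b})" using morse_subsegments[OF \<gamma> N] by blast
  have sN: "morse_set N2 (s n ` {0..S})" if "0 \<le> S" "S \<le> real n" for n S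
  proof -
    have "(\<lambda>t. real n - t) ` {0..S} = {real n - S..real n}" using image_diff_atLeastAtMost[of "real n" 0 S] by simp
    then have "s n ` {0..S} = \<phi> (inv\<^bsub>G\<^esub> (g n)) ` (\<gamma> ` {real n - S..real n})"
      by (simp add: s_def image_image[symmetric, of "\<lambda>t. \<phi> (inv\<^bsub>G\<^esub> (g n)) (\<gamma> t)" "\<lambda>t. real n - t"] image_image)
    then show ?thesis using action_morse[OF ga gi N2[of "real n - S" "real n"]] that by simp
  qed
  have Ln: "filterlim (\<lambda>n. real n) at_top sequentially" by (rule filterlim_real_sequentially)
  obtain r \<sigma> where r: "strict_mono (r :: nat \<Rightarrow> nat)"
    and \<sigma>: "\<sigma> \<in> {0..} \<rightarrow>\<^sub>E M" "coarse_ray 0 \<sigma>" "locally_converges (\<lambda>i. s (r i)) \<sigma>"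
    using arzela_ascoli[OF pr e s_qg Ln s0(1)] by blast
  have ri: "real i \<le> real (r i)" for i using seq_suble[OF r] by simp
  have Lr: "filterlim (\<lambda>i. real (r i)) at_top sequentially" 
    using filterlim_compose[OF Ln filterlim_subseq[OF r]] .
  have \<sigma>M: "\<sigma> ` {0..} \<subseteq> M" using \<sigma>(2) coarse_ray_image_subset by blast
  have \<sigma>N: "morse_set (\<lambda>K C. max 1 (N2 K (C + 2)) + 1) (\<sigma> ` {0..})"
    by (rule limit_of_morse_segments[OF \<sigma>(3) s_qg Lr \<sigma>M sN])
  obtain k where k: "k \<in> H" "\<And>R. \<not> (\<lambda>t. \<phi> k (\<sigma> t)) ` {0..} \<subseteq> nbhd R (\<sigma> ` {0..})"
    using element_moving_ray[OF geo pr ga H q \<sigma>(2) \<sigma>N] by blast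
  have kG: "k \<in> carrier G" using k H.subset by blast
  define Ck where "Ck = 2 * R0 + d e (\<phi> k e)"
  have ke: "\<phi> k e \<in> M" using isometryD(1)[OF iso[OF kG] e] .
  have Ck: "Ck \<ge> 0" using R0 by (simp add: Ck_def)
  have sk0: "d (s n 0) (\<phi> k (s n 0)) \<le> Ck" for n
  proof -
    have "\<phi> k (s n 0) \<in> M" using isometryD(1)[OF iso[OF kG] s0(2)] .
    moreover have "d (\<phi> k e) (\<phi> k (s n 0)) \<le> R0" using isometryD(2)[OF iso[OF kG] e s0(2)] s0(1) by simp
    ultimately show ?thesis using triangle[of "s n 0" e "\<phi> k (s n 0)"] triangle[of e "\<phi> k e"
      "\<phi> k (s n 0)"] s0[of n] e ke
      by (simp add: Ck_def commute)
  qed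
  \<comment> \<open>Otherwise \<open>k (s n)\<close> comes back to \<open>s n\<close> after an arbitrarily long time, so that it has been near \<open>s n\<close>
    until then. In the limit \<open>k \<sigma>\<close> is asymptotic to \<open>\<sigma>\<close>.\<close>
  have div: "\<exists>\<kappa>. \<forall>i t t'. t \<in> {0..real (r i)} \<longrightarrow> t' \<in> {0..real (r i)} \<longrightarrow> d (s (r i) t) (\<phi> k (s (r i) t')) \<le> \<rho> \<longrightarrow> t \<le> \<kappa>"
    for \<rho>
  proof (rule ccontr)
    assume neg: "\<not> ?thesis"
    define W where "W = max Ck \<rho>"
    define R1 where "R1 = max W (N2 1 (0 + 2 * W))"
    have W: "W \<ge> 0" using Ck by (simp add: W_def)
    have "\<phi> k (\<sigma> t0) \<in> nbhd (R1 + 2) (\<sigma> ` {0..})" if t0: "t0 \<ge> 0" for t0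
    proof -
      define S where "S = t0 + Ck + R1"
      have S: "S \<ge> t0" "S \<ge> 0" using t0 Ck W by (auto simp: S_def R1_def)
      obtain i0 where i0: "\<And>i t. i \<ge> i0 \<Longrightarrow> t \<in> {0..S} \<Longrightarrow> d (s (r i) t) (\<sigma> t) < 1" "\<And>i. i \<ge> i0 \<Longrightarrow> real (r i) \<ge> S"
        using locally_convergesD[OF \<sigma>(3) Lr zero_less_one] by metis
      obtain i t t' where it: "t \<in> {0..real (r i)}" "t' \<in> {0..real (r i)}" "d (s (r i) t) (\<phi> k (s (r i) t')) \<le> \<rho>"
         "t > max (real (r i0)) (t0 + \<rho> + Ck)" using neg by (meson not_le)
      have "real (r i0) < real (r i)" using it by auto
      then have "i \<ge> i0" using strict_mono_less[OF r] by (meson less_imp_le of_nat_less_iff)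
      define n where "n = r i"
      have cl: "d (s n x) (\<sigma> x) < 1" if "x \<in> {0..S}" for x using i0(1)[OF \<open>i \<ge> i0\<close> that] by (simp add: n_def)
      have Sn: "S \<le> real n" using i0(2)[OF \<open>i \<ge> i0\<close>] by (simp add: n_def)
      have kc: "quasi_geodesic 1 0 0 t' (\<lambda>x. \<phi> k (s n x))"
        using isometry_qg[OF iso[OF kG] qg_subinterval[OF s_qg[of n], of 0 t']] it by (simp add: n_def)
      have km: "\<phi> k (s n x) \<in> M" if "x \<in> {0..real n}" for x using isometryD(1)[OF iso[OF kG] sm[OF that]] .
      have a0: "\<phi> k (s n 0) \<in> nbhd W (s n ` {0..real n})"
        using sk0[of n] s0(2)[of n] km[of 0] by (auto simp: in_nbhd W_def intro!: bexI[of _ 0])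
      have a1: "\<phi> k (s n t') \<in> nbhd W (s n ` {0..real n})"
        using it sm[of t n] km[of t'] by (auto simp: in_nbhd W_def n_def intro!: bexI[of _ t])
      have tn: "t \<in> {0..real n}" "t' \<in> {0..real n}" using it by (auto simp: n_def)
      \<comment> \<open>Both segments start near \<open>e\<close>, so \<open>t'\<close> is about as large as \<open>t\<close>.\<close>
      have "t \<le> d (s n t) (\<phi> k (s n t')) + (d (\<phi> k (s n t')) (\<phi> k (s n 0)) + d (\<phi> k (s n 0)) (s n 0))"
        using sd[OF tn(1), of 0] tn triangle[of "s n t" "\<phi> k (s n t')" "s n 0"] triangle[of "\<phi> k (s n t')"
          "\<phi> k (s n 0)" "s n 0"]
          sm[OF tn(1)] km[OF tn(2)] km[of 0] s0(2)[of n] by simp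
      also have "d (\<phi> k (s n t')) (\<phi> k (s n 0)) = t'"
        using isometryD(2)[OF iso[OF kG] sm[OF tn(2)] s0(2)] sd[OF tn(2), of 0] tn by simp
      finally have t't0: "t0 \<le> t'" using it(3,4) sk0[of n] by (simp add: n_def commute)
      have "\<phi> k (s n t0) \<in> nbhd R1 (s n ` {0..real n})" unfolding R1_def
        by (rule morse_near[OF sN _ _ kc a0 a1 W]) (use t0 t't0 in auto)
      then obtain x where x: "x \<in> {0..real n}" "d (s n x) (\<phi> k (s n t0)) \<le> R1" by (auto simp: in_nbhd)
      have t0n: "t0 \<in> {0..real n}" using t0 t't0 tn by auto
      have "x \<le> d (s n x) (\<phi> k (s n t0)) + (d (\<phi> k (s n t0)) (\<phi> k (s n 0)) + d (\<phi> k (s n 0)) (s n 0))"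
        using sd[OF x(1), of 0] x triangle[of "s n x" "\<phi> k (s n t0)" "s n 0"] triangle[of "\<phi> k (s n t0)"
          "\<phi> k (s n 0)" "s n 0"]
          sm[OF x(1)] km[OF t0n] km[of 0] s0(2)[of n] by simp
      also have "d (\<phi> k (s n t0)) (\<phi> k (s n 0)) = t0"
        using isometryD(2)[OF iso[OF kG] sm[OF t0n] s0(2)] sd[OF t0n, of 0] t0 by simp
      finally have xS: "x \<in> {0..S}" using x sk0[of n] by (simp add: S_def commute)
      have m: "\<sigma> x \<in> M" "\<sigma> t0 \<in> M" "\<phi> k (\<sigma> t0) \<in> M"
        using \<sigma>M t0 xS isometryD(1)[OF iso[OF kG]] by auto
      have "d (\<phi> k (s n t0)) (\<phi> k (\<sigma> t0)) < 1"
        using isometryD(2)[OF iso[OF kG] sm[OF t0n] m(2)] cl[of t0] t0 S by simp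
      then have "d (\<sigma> x) (\<phi> k (\<sigma> t0)) \<le> R1 + 2"
        using triangle[OF m(1) sm[OF x(1)] m(3)] triangle[OF sm[OF x(1)] km[OF t0n] m(3)] x(2) cl[OF xS]
          by (simp add: commute)
      then show ?thesis using m xS by (auto simp: in_nbhd)
    qed
    then have "(\<lambda>t. \<phi> k (\<sigma> t)) ` {0..} \<subseteq> nbhd (R1 + 2) (\<sigma> ` {0..})" by (intro image_subsetI) simp
    then show False using k(2) by blast
  qed
  define u where "u = (\<lambda>i. g (r i) \<otimes>\<^bsub>G\<^esub> k \<otimes>\<^bsub>G\<^esub> inv\<^bsub>G\<^esub> (g (r i)))"
  have uH: "u i \<in> H" for i unfolding u_def by (rule H.inv_op_closed2[OF g(1) k(1)])
  have uG: "u i \<in> carrier G" for i using uH H.subset by blast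
  show ?thesis
  proof (rule that)
    show "range u \<subseteq> H" using uH by blast
    fix f x e' assume f: "f \<in> carrier G" and x: "x \<in> M" and e': "e' \<in> M"
    have fi: "inv\<^bsub>G\<^esub> f \<in> carrier G" using f by simp
    have fm: "\<phi> f p \<in> M" if "p \<in> M" for p using isometryD(1)[OF iso[OF f] that] .
    define r1 where "r1 = d e' (\<phi> f e) + d (\<phi> (inv\<^bsub>G\<^esub> f) x) e + Ck"
    define \<rho>0 where "\<rho>0 = max r1 (N2 (5 * 1) (2 * (1 + 0) + 2 * r1))"
    obtain \<kappa> where \<kappa>: "\<And>i t t'. t \<in> {0..real (r i)} \<Longrightarrow> t' \<in> {0..real (r i)} \<Longrightarrow> d (s (r i) t) (\<phi> k (s (r i) t')) \<le>
      2 * \<rho>0 \<Longrightarrow> t \<le> \<kappa>"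
      using div[of "2 * \<rho>0"] by blast
    have r1: "r1 \<ge> 0" "Ck \<le> r1" "d e' (\<phi> f e) \<le> r1" "d (\<phi> (inv\<^bsub>G\<^esub> f) x) e \<le> r1" using Ck by (auto simp: r1_def)
    have \<rho>0: "\<rho>0 \<ge> 0" using r1 by (simp add: \<rho>0_def)
    show "\<exists>\<rho>1 \<rho>2. \<forall>i l c. quasi_geodesic 1 0 0 l c \<longrightarrow> c 0 = e' \<longrightarrow>
        c l = \<phi> (f \<otimes>\<^bsub>G\<^esub> u i \<otimes>\<^bsub>G\<^esub> inv\<^bsub>G\<^esub> f) x \<longrightarrow>
        (\<exists>T\<in>{0..l}. real i - \<rho>2 \<le> T \<and> c ` {0..T} \<subseteq> nbhd \<rho>1 ((\<lambda>t. \<phi> f (\<gamma> t)) ` {0..}))"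
    proof (intro exI allI impI)
      fix i l c assume c: "quasi_geodesic 1 0 0 l c" and c0: "c 0 = e'" and cl: "c l = \<phi> (f \<otimes>\<^bsub>G\<^esub> u i \<otimes>\<^bsub>G\<^esub> inv\<^bsub>G\<^esub> f) x"
      define n where "n = r i"
      have l0: "0 \<le> l" using qg_le[OF c] .
      have cm: "c t \<in> M" if "t \<in> {0..l}" for t using qg_in[OF c that] .
      have cd: "d (c t) (c t') = \<bar>t - t'\<bar>" if "t \<in> {0..l}" "t' \<in> {0..l}" for t t'
        using qg_lower[OF c that] qg_upper[OF c that] by simp
      define b where "b = f \<otimes>\<^bsub>G\<^esub> u i"
      have b: "b \<in> carrier G" using f uG by (simp add: b_def)
      define A where "A = \<phi> f ` (\<gamma> ` {0..real n})"
      define A' where "A' = \<phi> b ` (\<gamma> ` {0..real n})"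
      have A: "morse_set N2 A" "morse_set N2 A'" unfolding A_def A'_def
        by (rule action_morse[OF ga _ N2]; use f b in simp)+
      define m where "m = \<phi> f (\<gamma> (real n))"
      have mM: "m \<in> M" "m \<in> A" using fm \<gamma>m by (auto simp: m_def A_def)
      have bm: "\<phi> b p \<in> M" if "p \<in> M" for p using isometryD(1)[OF iso[OF b] that] .
      \<comment> \<open>Up to \<open>m\<close>, the two rays are the translates of \<open>s n\<close> and \<open>k (s n)\<close> by \<open>f \<otimes> g n\<close>, read backwards.\<close>
      have rel: "\<phi> b (\<gamma> (real n - t)) = \<phi> (f \<otimes>\<^bsub>G\<^esub> g n) (\<phi> k (s n t))" "\<phi> f (\<gamma> (real n - t)) = \<phi> (f \<otimes>\<^bsub>G\<^esub> g n) (s n t)"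
        if "t \<in> {0..real n}" for t
      proof -
        have p: "\<gamma> (real n - t) \<in> M" using \<gamma>m that by simp
        have "b = f \<otimes>\<^bsub>G\<^esub> g n \<otimes>\<^bsub>G\<^esub> k \<otimes>\<^bsub>G\<^esub> inv\<^bsub>G\<^esub> (g n)" using f g(1) kG by (simp add: b_def u_def n_def m_assoc)
        then show "\<phi> b (\<gamma> (real n - t)) = \<phi> (f \<otimes>\<^bsub>G\<^esub> g n) (\<phi> k (s n t))"
          using action_mult[OF ga _ gi p, of "f \<otimes>\<^bsub>G\<^esub> g n \<otimes>\<^bsub>G\<^esub> k"] action_mult[OF ga _ kG sm[OF that], of "f \<otimes>\<^bsub>G\<^esub> g n"]
            f g(1) kG by (simp add: s_def)
        show "\<phi> f (\<gamma> (real n - t)) = \<phi> (f \<otimes>\<^bsub>G\<^esub> g n) (s n t)"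
          using action_mult[OF ga f g(1) sm[OF that]] action_inv(2)[OF ga g(1) p] by (simp add: s_def)
      qed
      have fg: "f \<otimes>\<^bsub>G\<^esub> g n \<in> carrier G" using f g(1) by simp
      have dist_rel: "d (\<phi> f (\<gamma> (real n - t))) (\<phi> b (\<gamma> (real n - t'))) = d (s n t) (\<phi> k (s n t'))"
        if "t \<in> {0..real n}" "t' \<in> {0..real n}" for t t'
        using isometryD(2)[OF iso[OF fg] sm[OF that(1)] isometryD(1)[OF iso[OF kG] sm[OF that(2)]]] rel that by simp
      have mA': "m \<in> nbhd r1 A'"
      proof -
        have "d m (\<phi> b (\<gamma> (real n))) \<le> r1" using dist_rel[of 0 0] sk0[of n] r1 by (simp add: m_def)
        then show ?thesis using mM bm \<gamma>m by (auto simp: in_nbhd A'_def commute intro!: bexI[of _ "\<phi> b (\<gamma> (real n))"])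
      qed
      have mA: "m \<in> nbhd r1 A" using mM r1 by (auto simp: in_nbhd intro!: bexI[of _ m])
      have startA: "c 0 \<in> nbhd r1 A"
      proof -
        have "\<phi> f e \<in> A" by (auto simp: A_def e_def)
        then show ?thesis using r1 e' fm[OF e] c0 by (auto simp: in_nbhd commute)
      qed
      have endA': "c l \<in> nbhd r1 A'"
      proof -
        have xm: "\<phi> (inv\<^bsub>G\<^esub> f) x \<in> M" using isometryD(1)[OF iso[OF fi] x] .
        have "c l = \<phi> b (\<phi> (inv\<^bsub>G\<^esub> f) x)" using cl action_mult[OF ga b fi x] by (simp add: b_def)
        then have "d (c l) (\<phi> b e) \<le> r1" using isometryD(2)[OF iso[OF b] xm e] r1 by simp
        moreover have "\<phi> b e \<in> A'" by (auto simp: A'_def e_def)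
        ultimately show ?thesis using bm[OF e] cm[of l] l0 by (auto simp: in_nbhd commute)
      qed
      obtain T where T: "T \<in> {0..l}" "\<And>t. t \<in> {0..l} \<Longrightarrow> d m (c T) \<le> d m (c t) + 1"
        using near_minimum[of "{0..l}" "\<lambda>t. d m (c t)"] l0 by auto
      have half: "c t \<in> nbhd \<rho>0 A" if t: "t \<in> {0..T}" for t
      proof -
        have qT: "quasi_geodesic 1 0 0 T c" by (rule qg_subinterval[OF c]) (use T in auto)
        have near: "d m (c T) \<le> d m (c t) + 1" if "t \<in> {0..T}" for t using T that by auto
        obtain z \<tau> where *: "T \<le> z" "quasi_geodesic (5 * 1) (2 * (1 + 0)) 0 z \<tau>"
          "\<And>t. t \<in> {0..T} \<Longrightarrow> \<tau> t = c t" "\<tau> z = m"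
          using qg_extend[OF geo qT order_refl order_refl mM(1) near zero_le_one] by metis
        have "\<tau> t \<in> nbhd \<rho>0 A" unfolding \<rho>0_def
          by (rule morse_near[OF A(1) _ _ *(2) _ _ r1(1)]) (use * t T startA mA in auto)
        then show ?thesis using *(3) t by simp
      qed
      have half': "c T \<in> nbhd \<rho>0 A'"
      proof -
        have qT: "quasi_geodesic 1 0 (-l) (-T) (\<lambda>t. c (- t))"
          by (rule qg_reverse[OF qg_subinterval[OF c]]) (use T in auto)
        have near: "d m (c (- (- T))) \<le> d m (c (- t)) + 1" if "t \<in> {-l..-T}" for t using T that by auto
        obtain z \<tau> where *: "-T \<le> z" "quasi_geodesic (5 * 1) (2 * (1 + 0)) (-l) z \<tau>"
          "\<And>t. t \<in> {-l..-T} \<Longrightarrow> \<tau> t = c (- t)" "\<tau> z = m"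
          using qg_extend[OF geo qT order_refl order_refl mM(1) near zero_le_one] by metis
        have "\<tau> (-T) \<in> nbhd \<rho>0 A'" unfolding \<rho>0_def
          by (rule morse_near[OF A(2) _ _ *(2) _ _ r1(1)]) (use *(1,4) *(3)[of "-l"] T endA' mA' in auto)
        then show ?thesis using *(3)[of "-T"] T by simp
      qed
      obtain a where a: "a \<in> {0..real n}" "d (\<phi> f (\<gamma> a)) (c T) \<le> \<rho>0" using half[of T] T by (auto simp: in_nbhd A_def)
      obtain a' where a': "a' \<in> {0..real n}" "d (\<phi> b (\<gamma> a')) (c T) \<le> \<rho>0" using half' by (auto simp: in_nbhd A'_def)
      have pts: "\<phi> f (\<gamma> a) \<in> M" "\<phi> b (\<gamma> a') \<in> M" using fm bm \<gamma>m a a' by auto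
      have "d (\<phi> f (\<gamma> a)) (\<phi> b (\<gamma> a')) \<le> 2 * \<rho>0"
        using triangle[OF pts(1) cm[OF T(1)] pts(2)] a a' by (simp add: commute)
      then have "d (s n (real n - a)) (\<phi> k (s n (real n - a'))) \<le> 2 * \<rho>0"
        using dist_rel[of "real n - a" "real n - a'"] a a' by simp
      then have ka: "real n - a \<le> \<kappa>" using \<kappa>[of "real n - a" i "real n - a'"] a a' by (simp add: n_def)
      have "a = d (\<phi> f e) (\<phi> f (\<gamma> a))" using isometryD(2)[OF iso[OF f] e \<gamma>m[of a]] \<gamma>d[of 0 a] a by (simp add: e_def)
      also have "\<dots> \<le> d (\<phi> f e) e' + (d e' (c T) + \<rho>0)"
        using triangle[OF fm[OF e] e' pts(1)] triangle[OF e' cm[OF T(1)] pts(1)] a by (simp add: commute)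
      also have "d e' (c T) = T" using cd[of 0 T] T c0 l0 by simp
      finally have "real n - (\<kappa> + r1 + \<rho>0) \<le> T" using ka r1 by (simp add: commute)
      then have "real i - (\<kappa> + r1 + \<rho>0) \<le> T" using ri[of i] by (simp add: n_def)
      moreover have "c ` {0..T} \<subseteq> nbhd \<rho>0 ((\<lambda>t. \<phi> f (\<gamma> t)) ` {0..})"
      proof (rule image_subsetI)
        fix t assume "t \<in> {0..T}"
        moreover have "nbhd \<rho>0 A \<subseteq> nbhd \<rho>0 ((\<lambda>t. \<phi> f (\<gamma> t)) ` {0..})" by (intro nbhd_mono) (auto simp: A_def)
        ultimately show "c t \<in> nbhd \<rho>0 ((\<lambda>t. \<phi> f (\<gamma> t)) ` {0..})" using half by blast
      qed
      ultimately show "\<exists>T\<in>{0..l}. real i - (\<kappa> + r1 + \<rho>0) \<le> T \<and> c ` {0..T} \<subseteq> nbhd \<rho>0 ((\<lambda>t. \<phi> f (\<gamma> t)) ` {0..})"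
        using T(1) by blast
    qed
  qed
qed

end

section \<open>Stability of quasi-geodesics in hyperbolic spaces\<close>

lemma bounded_if_le_log:
  fixes a \<delta> \<alpha> \<beta> :: real
  assumes "\<delta> > 0" "\<alpha> > 0"
  obtains D0 where "\<And>D. D \<le> a + \<delta> * log 2 (\<alpha> * D + \<beta>) \<Longrightarrow> D \<le> D0"
proof -
  have "filterlim (\<lambda>D. D - \<delta> * log 2 (\<alpha> * D + \<beta>)) at_top at_top" using assms by real_asymp
  then have "\<forall>\<^sub>F D in at_top. D - \<delta> * log 2 (\<alpha> * D + \<beta>) > a" by (simp add: filterlim_at_top_dense)
  then obtain D0 where "\<And>D. D \<ge> D0 \<Longrightarrow> D - \<delta> * log 2 (\<alpha> * D + \<beta>) > a" by (auto simp: eventually_at_top_linorder)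
  then show ?thesis using that[of D0] by (smt (verit))
qed

context Metric_space
begin

text \<open>Doubling the length of a chain costs \<open>\<delta>\<close> once, so a chain of \<open>n\<close> points loses only
  \<open>\<delta> * log 2 n\<close>.\<close>

lemma gromov_chain:
  assumes hyp: "\<And>w p q r. w \<in> M \<Longrightarrow> p \<in> M \<Longrightarrow> q \<in> M \<Longrightarrow> r \<in> M \<Longrightarrow>
        gromov_product d w p r \<ge> min (gromov_product d w p q) (gromov_product d w q r) - \<delta>"
    and w: "w \<in> M" and x: "\<And>i. x i \<in> M" and c: "\<And>i. gromov_product d w (x i) (x (Suc i)) \<ge> c" and \<delta>: "\<delta> \<ge> 0"
  shows "gromov_product d w (x m) (x (m + 2 ^ k)) \<ge> c - real k * \<delta>"
proof (induction k arbitrary: m)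
  case 0
  then show ?case using c[of m] by simp
next
  case (Suc k)
  have "gromov_product d w (x m) (x (m + 2 ^ k + 2 ^ k)) \<ge> 
      min (gromov_product d w (x m) (x (m + 2 ^ k))) (gromov_product d w (x (m + 2 ^ k)) (x (m + 2 ^ k + 2 ^ k))) - \<delta>"
    using hyp w x by blast
  moreover have "min (gromov_product d w (x m) (x (m + 2 ^ k))) (gromov_product d w (x (m + 2 ^ k)) (x (m + 2 ^ k + 2
    ^ k))) \<ge> c - real k * \<delta>"
    using Suc[of m] Suc[of "m + 2 ^ k"] by simp
  ultimately have "gromov_product d w (x m) (x (m + 2 ^ k + 2 ^ k)) \<ge> c - real k * \<delta> - \<delta>" by linarith
  moreover have "m + 2 ^ k + 2 ^ k = m + 2 ^ Suc k" by simp
  ultimately show ?case by (simp add: algebra_simps del: power_Suc)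
qed

text \<open>Word metrics take integer values, so their geodesics are finite sequences.\<close>

definition discrete_geodesic :: "(nat \<Rightarrow> 'a) \<Rightarrow> nat \<Rightarrow> bool" where
  "discrete_geodesic x n \<longleftrightarrow> (\<forall>i\<le>n. x i \<in> M) \<and> (\<forall>i\<le>n. \<forall>j\<le>n. d (x i) (x j) = \<bar>real i - real j\<bar>)"

text \<open>Let \<open>w\<close> be a point of the geodesic at the greatest distance \<open>D\<close> from \<open>\<sigma>\<close>,
  and let \<open>y\<^sub>1, y\<^sub>2\<close> be the points of the geodesic
  at distance about \<open>2 * D\<close> on both sides of \<open>w\<close> (or its ends). A jump from \<open>y\<^sub>1\<close> to \<open>\<sigma>\<close>, a walk along \<open>\<sigma>\<close>, and
  a jump to \<open>y\<^sub>2\<close> form a chain of length linear in \<open>D\<close> that keeps distance about \<open>D\<close> from \<open>w\<close>. Its Gromov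
  products at \<open>w\<close> are about \<open>D\<close>, while that of \<open>y\<^sub>1, y\<^sub>2\<close> vanishes. By \<open>gromov_chain\<close>, \<open>D\<close> is at most
  logarithmic in \<open>D\<close>.\<close>

lemma geodesic_near_quasi_geodesic:
  assumes hyp: "gromov_hyperbolic M d" and K: "K \<ge> 1" and C: "C \<ge> 0"
  obtains D0 where "\<And>x n a b \<sigma> i. discrete_geodesic x n \<Longrightarrow> quasi_geodesic K C a b \<sigma> \<Longrightarrow> \<sigma> a = x 0 \<Longrightarrow> \<sigma> b = x n \<Longrightarrow> i \<le> n \<Longrightarrow>
      \<exists>t\<in>{a..b}. d (x i) (\<sigma> t) \<le> D0"
proof -
  obtain \<delta>' where \<delta>': "\<And>w p q r. w \<in> M \<Longrightarrow> p \<in> M \<Longrightarrow> q \<in> M \<Longrightarrow> r \<in> M \<Longrightarrow>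
        gromov_product d w p r \<ge> min (gromov_product d w p q) (gromov_product d w q r) - \<delta>'"
    using hyp unfolding gromov_hyperbolic_def by blast
  define \<delta> where "\<delta> = max 1 \<delta>'"
  have \<delta>: "gromov_product d w p r \<ge> min (gromov_product d w p q) (gromov_product d w q r) - \<delta>"
    if "w \<in> M" "p \<in> M" "q \<in> M" "r \<in> M" for w p q r using \<delta>'[OF that] by (simp add: \<delta>_def)
  have \<delta>1: "\<delta> > 0" "\<delta> \<ge> 0" by (auto simp: \<delta>_def)
  obtain D0 where D0: "\<And>D. D \<le> (1 + K + C + 2 * \<delta>) + \<delta> * log 2 (6 * K * D + (K * (2 + C) + 3)) \<Longrightarrow> D \<le> D0"
    using bounded_if_le_log[OF \<delta>1(1), of "6 * K" "1 + K + C + 2 * \<delta>" "K * (2 + C) + 3"] K by auto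
  show ?thesis
  proof (rule that)
    fix x n a b \<sigma> i0 assume x: "discrete_geodesic x n" and \<sigma>: "quasi_geodesic K C a b \<sigma>"
      and ends: "\<sigma> a = x 0" "\<sigma> b = x n" and i0: "i0 \<le> n"
    have ab: "a \<le> b" using qg_le[OF \<sigma>] .
    have xm: "x i \<in> M" if "i \<le> n" for i using x that by (auto simp: discrete_geodesic_def)
    have xd: "d (x i) (x j) = \<bar>real i - real j\<bar>" if "i \<le> n" "j \<le> n" for i j using x that
      by (auto simp: discrete_geodesic_def)
    have sm: "\<sigma> t \<in> M" if "t \<in> {a..b}" for t using qg_in[OF \<sigma> that] .
    have "\<exists>t\<in>{a..b}. \<forall>s\<in>{a..b}. d (x i) (\<sigma> t) \<le> d (x i) (\<sigma> s) + 1" for i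
      using near_minimum[of "{a..b}" "\<lambda>t. d (x i) (\<sigma> t)"] ab
        by (metis atLeastatMost_empty_iff nonneg linorder_not_less)
    then obtain T where T: "\<And>i. T i \<in> {a..b}" "\<And>i s. s \<in> {a..b} \<Longrightarrow> d (x i) (\<sigma> (T i)) \<le> d (x i) (\<sigma> s) + 1" by metis
    obtain i where i: "i \<le> n" "\<And>j. j \<le> n \<Longrightarrow> d (x j) (\<sigma> (T j)) \<le> d (x i) (\<sigma> (T i))"
    proof -
      let ?I = "(\<lambda>j. d (x j) (\<sigma> (T j))) ` {..n}"
      have "Max ?I \<in> ?I" by (rule Max_in) auto
      then obtain i where i: "Max ?I = d (x i) (\<sigma> (T i))" "i \<in> {..n}" by (rule imageE)
      have "d (x j) (\<sigma> (T j)) \<le> Max ?I" if "j \<le> n" for j by (rule Max_ge) (use that in auto)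
      then show ?thesis using that[of i] i by simp
    qed
    define w where "w = x i"
    define D where "D = d w (\<sigma> (T i))"
    have w: "w \<in> M" using xm i by (simp add: w_def)
    have D: "D \<ge> 0" by (simp add: D_def)
    have far: "d w (\<sigma> s) \<ge> D - 1" if "s \<in> {a..b}" for s using T(2)[OF that, of i] by (simp add: w_def D_def)
    have Dj: "d (x j) (\<sigma> (T j)) \<le> D" if "j \<le> n" for j using i(2)[OF that] by (simp add: w_def D_def)
    define m where "m = nat \<lceil>2 * D\<rceil>"
    have m: "real m \<ge> 2 * D" "real m \<le> 2 * D + 1" using D unfolding m_def by linarith+
    define i1 where "i1 = i - m"
    define i2 where "i2 = min n (i + m)"
    define t1 where "t1 = (if i1 = 0 then a else T i1)"
    define t2 where "t2 = (if i2 = n then b else T i2)"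
    have i12: "i1 \<le> i" "i \<le> i2" "i1 \<le> n" "i2 \<le> n" using i by (auto simp: i1_def i2_def)
    have t12: "t1 \<in> {a..b}" "t2 \<in> {a..b}" using T(1) ab by (auto simp: t1_def t2_def)
    have gp: "gromov_product d w (x i') (\<sigma> t) \<ge> D - 1" "d (x i') (\<sigma> t) \<le> D" "d w (x i') \<ge> D - 1"
      if "i' \<le> n" "t \<in> {a..b}" "x i' = \<sigma> t \<or> d w (x i') \<ge> 2 * D \<and> d (x i') (\<sigma> t) \<le> D" for i' t
      using that far[of t] triangle[OF w sm[OF that(2)] xm[OF that(1)]] xm[OF that(1)] D
        by (auto simp: gromov_product_def commute)
    have e1: "x i1 = \<sigma> t1 \<or> d w (x i1) \<ge> 2 * D \<and> d (x i1) (\<sigma> t1) \<le> D"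
    proof (cases "i1 = 0")
      case False
      then have "real i - real i1 = real m" by (simp add: i1_def)
      then show ?thesis using False Dj[of i1] i12 xd[OF i(1) i12(3)] m by (simp add: t1_def w_def)
    qed (use ends in \<open>simp add: t1_def\<close>)
    have e2: "x i2 = \<sigma> t2 \<or> d w (x i2) \<ge> 2 * D \<and> d (x i2) (\<sigma> t2) \<le> D"
    proof (cases "i2 = n")
      case False
      then have "real i2 - real i = real m" by (simp add: i2_def)
      then show ?thesis using False Dj[of i2] i12 xd[OF i(1) i12(4)] m by (simp add: t2_def w_def)
    qed (use ends in \<open>simp add: t2_def\<close>)
    note g1 = gp[OF i12(3) t12(1) e1] and g2 = gp[OF i12(4) t12(2) e2]
    have "real i2 - real i1 \<le> 2 * real m" by (simp add: i1_def i2_def)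
    then have "d (x i1) (x i2) \<le> 4 * D + 2" using xd[OF i12(3,4)] i12 m by simp
    then have "d (\<sigma> t1) (\<sigma> t2) \<le> 6 * D + 2"
      using triangle[OF sm[OF t12(1)] xm[OF i12(3)] sm[OF t12(2)]] triangle[OF xm[OF i12(3)] xm[OF i12(4)] sm[OF
        t12(2)]] g1 g2 by (simp add: commute)
    then have "K * (d (\<sigma> t1) (\<sigma> t2) + C) \<le> K * (6 * D + 2 + C)" using K by (intro mult_left_mono) auto
    then have tt: "\<bar>t1 - t2\<bar> \<le> K * (6 * D + 2 + C)" using qg_gap[OF \<sigma> K t12] by simp
    define N where "N = Suc (nat \<lceil>\<bar>t1 - t2\<bar>\<rceil>)"
    have N: "real N \<ge> \<bar>t1 - t2\<bar>" "real N \<le> \<bar>t1 - t2\<bar> + 2" "N > 0" unfolding N_def by linarith+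
    \<comment> \<open>The chain: along \<open>\<sigma>\<close> in steps of at most \<open>1\<close>, with \<open>x i1\<close> in front, and constant at the end,
      since \<open>gromov_chain\<close> is about chains whose length is a power of two.\<close>
    define u where "u = (\<lambda>j. t1 + (real j / real N) * (t2 - t1))"
    have u: "u j \<in> {a..b}" if "j \<le> N" for j
    proof -
      have f: "real j / real N \<in> {0..1}" using that N by auto
      have "t1 + x * (t2 - t1) = (1 - x) * t1 + x * t2" for x by (simp add: algebra_simps)
      then have "u j = (1 - real j / real N) * t1 + (real j / real N) * t2" by (simp only: u_def)
      moreover have "(1 - real j / real N) * t1 + (real j / real N) * t2 \<in> {a..b}"
        using convexD[OF convex_real_interval(5)[of a b] t12, of "1 - real j / real N" "real j / real N"] f by simp
      ultimately show ?thesis by simp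
    qed
    have u0: "u 0 = t1" "u N = t2" using N by (auto simp: u_def)
    have ustep: "\<bar>u j - u (Suc j)\<bar> \<le> 1" for j
    proof -
      have "u j - u (Suc j) = (t1 - t2) / real N" using N by (simp add: u_def field_simps)
      then show ?thesis using N by (simp add: abs_divide divide_le_eq)
    qed
    define y where "y = (\<lambda>j. if j = 0 then x i1 else if j \<le> Suc N then \<sigma> (u (j - 1)) else x i2)"
    have ym: "y j \<in> M" for j using xm i12 sm[OF u[of "j - 1"]] by (auto simp: y_def)
    have yc: "gromov_product d w (y j) (y (Suc j)) \<ge> D - 1 - (K + C)" for j
    proof -
      consider "j = 0" | "0 < j" "j \<le> N" | "j = Suc N" | "j > Suc N" by linarith
      then show ?thesis
      proof cases
        case 1
        then show ?thesis using g1(1) K C u0 by (simp add: y_def)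
      next
        case 2
        then obtain j' where j': "j = Suc j'" "Suc j' \<le> N" by (cases j) auto
        have m: "u j' \<in> {a..b}" "u (Suc j') \<in> {a..b}" using u j' by auto
        have "d (\<sigma> (u j')) (\<sigma> (u (Suc j'))) \<le> K * \<bar>u j' - u (Suc j')\<bar> + C" by (rule qg_upper[OF \<sigma> m])
        also have "K * \<bar>u j' - u (Suc j')\<bar> \<le> K * 1" using ustep K by (intro mult_left_mono) auto
        finally show ?thesis using far[OF m(1)] far[OF m(2)] K C j' by (simp add: y_def gromov_product_def)
      next
        case 3
        then show ?thesis using g2(1) K C u0 by (simp add: y_def gromov_product_def commute)
      next
        case 4
        then show ?thesis using g2(3) K C xm[OF i12(4)] by (simp add: y_def gromov_product_def)
      qed
    qed
    define E where "E = 6 * K * D + (K * (2 + C) + 3)"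
    have E: "real N + 2 \<le> E + 1" "E > 1" 
    proof -
      have "K * (2 + C) \<ge> 0" "6 * K * D \<ge> 0" using K C D by auto
      then show "E > 1" unfolding E_def by linarith
      show "real N + 2 \<le> E + 1" using N tt by (simp add: E_def algebra_simps)
    qed
    define k where "k = nat \<lceil>log 2 E\<rceil>"
    have "log 2 E > 0" using E by simp
    then have k: "real k \<ge> log 2 E" "real k \<le> log 2 E + 1" unfolding k_def by linarith+
    have "E = 2 powr (log 2 E)" using E by simp
    also have "\<dots> \<le> 2 powr real k" using k by (intro powr_mono) auto
    also have "\<dots> = 2 ^ k" by (simp add: powr_realpow)
    finally have "real N + 1 \<le> real (2 ^ k)" using E by simp
    then have k2: "2 ^ k \<ge> Suc N" by (metis Suc_eq_plus1 of_nat_1 of_nat_add of_nat_le_iff)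
    have "gromov_product d w (y 0) (y (0 + 2 ^ Suc k)) \<ge> (D - 1 - (K + C)) - real (Suc k) * \<delta>"
      by (rule gromov_chain[where w = w and x = y and \<delta> = \<delta>]) (use \<delta> w ym yc \<delta>1(2) in auto)
    moreover have "2 ^ Suc k > Suc N" using k2 by simp
    ultimately have "gromov_product d w (x i1) (x i2) \<ge> (D - 1 - (K + C)) - real (Suc k) * \<delta>" by (simp add: y_def)
    moreover have "gromov_product d w (x i1) (x i2) = 0"
      using xd[OF i(1) i12(3)] xd[OF i(1) i12(4)] xd[OF i12(3,4)] i12 by (simp add: gromov_product_def w_def)
    ultimately have "D \<le> 1 + K + C + \<delta> + \<delta> * real k" by (simp add: algebra_simps)
    also have "\<delta> * real k \<le> \<delta> * (log 2 E + 1)" using k \<delta>1 by (intro mult_left_mono) auto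
    finally have "D \<le> (1 + K + C + 2 * \<delta>) + \<delta> * log 2 E" by (simp add: algebra_simps)
    then have "D \<le> D0" using D0 unfolding E_def by blast
    then show "\<exists>t\<in>{a..b}. d (x i0) (\<sigma> t) \<le> D0" using Dj[OF i0] T(1)[of i0] by force
  qed
qed

text \<open>Each point of the geodesic is near some \<open>\<sigma> t\<close>. Going along the geodesic, this \<open>t\<close> has to pass \<open>t0\<close> between two
  neighbours \<open>x i, x (Suc i)\<close>. Then \<open>\<sigma>\<close> is near \<open>x i\<close> shortly before and shortly after \<open>t0\<close>.\<close>

lemma quasi_geodesic_near_geodesic:
  assumes hyp: "gromov_hyperbolic M d" and K: "K \<ge> 1" and C: "C \<ge> 0"
  obtains R where "\<And>x n a b \<sigma> t. discrete_geodesic x n \<Longrightarrow> quasi_geodesic K C a b \<sigma> \<Longrightarrow> \<sigma> a = x 0 \<Longrightarrow> \<sigma> b = x n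
    \<Longrightarrow> t \<in> {a..b} \<Longrightarrow>
      \<exists>i\<le>n. d (x i) (\<sigma> t) \<le> R"
proof -
  obtain D where D: "\<And>x n a b \<sigma> i. discrete_geodesic x n \<Longrightarrow> quasi_geodesic K C a b \<sigma> \<Longrightarrow> \<sigma> a = x 0 \<Longrightarrow> \<sigma> b = x n \<Longrightarrow> i \<le> n \<Longrightarrow>
      \<exists>t\<in>{a..b}. d (x i) (\<sigma> t) \<le> D"
    using geodesic_near_quasi_geodesic[OF assms] by blast
  define D' where "D' = max D 0"
  define Q where "Q = K * (2 * D' + 1 + C)"
  show ?thesis
  proof (rule that)
    fix x n a b \<sigma> t0 assume x: "discrete_geodesic x n" and \<sigma>: "quasi_geodesic K C a b \<sigma>"
      and ends: "\<sigma> a = x 0" "\<sigma> b = x n" and t0: "t0 \<in> {a..b}"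
    have ab: "a \<le> b" using qg_le[OF \<sigma>] .
    have xm: "x i \<in> M" if "i \<le> n" for i using x that by (auto simp: discrete_geodesic_def)
    have xd: "d (x i) (x j) = \<bar>real i - real j\<bar>" if "i \<le> n" "j \<le> n" for i j using x that
      by (auto simp: discrete_geodesic_def)
    have sm: "\<sigma> t \<in> M" if "t \<in> {a..b}" for t using qg_in[OF \<sigma> that] .
    have "\<exists>t\<in>{a..b}. d (x i) (\<sigma> t) \<le> D'" if "i \<le> n" for i
      using D[OF x \<sigma> ends that] by (force simp: D'_def)
    then obtain s0 where s0: "\<And>i. i \<le> n \<Longrightarrow> s0 i \<in> {a..b} \<and> d (x i) (\<sigma> (s0 i)) \<le> D'" by metis
    \<comment> \<open>The first time must not be later than \<open>t0\<close>.\<close>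
    define s where "s = s0(0 := a)"
    have s: "s i \<in> {a..b}" "d (x i) (\<sigma> (s i)) \<le> D'" if "i \<le> n" for i
      using s0[OF that] ends ab xm by (auto simp: s_def D'_def)
    obtain i s' where i: "i \<le> n" "s i \<le> t0" "t0 \<le> s'" "s' \<in> {a..b}" "d (\<sigma> (s i)) (\<sigma> s') \<le> 2 * D' + 1"
    proof (cases "\<exists>i\<le>n. t0 < s i")
      case True
      define j where "j = (LEAST i. i \<le> n \<and> t0 < s i)"
      have j: "j \<le> n" "t0 < s j" using LeastI_ex[of "\<lambda>i. i \<le> n \<and> t0 < s i"] True by (auto simp: j_def)
      have j0: "j \<noteq> 0" using j t0 by (intro notI) (simp add: s_def)
      have "\<not> (j - 1 \<le> n \<and> t0 < s (j - 1))" using not_less_Least[of "j - 1" "\<lambda>i. i \<le> n \<and> t0 < s i"] j0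
        by (simp add: j_def)
      then have k: "j - 1 \<le> n" "s (j - 1) \<le> t0" using j by auto
      have "d (x (j - 1)) (x j) = 1" using xd[OF k(1) j(1)] j0 by simp
      then have "d (\<sigma> (s (j - 1))) (\<sigma> (s j)) \<le> 2 * D' + 1"
        using triangle[OF sm[OF s(1)[OF k(1)]] xm[OF k(1)] sm[OF s(1)[OF j(1)]]] triangle[OF xm[OF k(1)] xm[OF j(1)]
          sm[OF s(1)[OF j(1)]]]
         s(2)[OF k(1)] s(2)[OF j(1)] by (simp add: commute)
      then show ?thesis using that[OF k _ s(1)[OF j(1)]] j by simp
    next
      case False
      then have "s n \<le> t0" by auto
      moreover have "d (\<sigma> (s n)) (\<sigma> b) \<le> 2 * D' + 1" using s(2)[of n] ends by (simp add: commute D'_def)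
      ultimately show ?thesis using that[of n b] t0 ab by auto
    qed
    have "\<bar>s i - s'\<bar> \<le> K * (d (\<sigma> (s i)) (\<sigma> s') + C)" by (rule qg_gap[OF \<sigma> K s(1)[OF i(1)] i(4)])
    also have "\<dots> \<le> Q" unfolding Q_def using i K by (intro mult_left_mono) auto
    finally have "\<bar>s i - t0\<bar> \<le> Q" using i by simp
    then have "K * \<bar>s i - t0\<bar> \<le> K * Q" using K by (intro mult_left_mono) auto
    then have "d (\<sigma> (s i)) (\<sigma> t0) \<le> K * Q + C" using qg_upper[OF \<sigma> s(1)[OF i(1)] t0] by simp
    then have "d (x i) (\<sigma> t0) \<le> D' + (K * Q + C)"
      using triangle[OF xm[OF i(1)] sm[OF s(1)[OF i(1)]] sm[OF t0]] s(2)[OF i(1)] by simp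
    then show "\<exists>i\<le>n. d (x i) (\<sigma> t0) \<le> D' + (K * Q + C)" using i by blast
  qed
qed

text \<open>Compare both paths with a geodesic.\<close>

lemma hyperbolic_quasi_geodesics_close:
  assumes hyp: "gromov_hyperbolic M d" and K: "K \<ge> 1" and C: "C \<ge> 0"
    and geo: "\<And>p q. p \<in> M \<Longrightarrow> q \<in> M \<Longrightarrow> \<exists>x n. discrete_geodesic x n \<and> x 0 = p \<and> x n = q"
  obtains R where "\<And>a b \<sigma> a' b' \<tau> t. quasi_geodesic K C a b \<sigma> \<Longrightarrow> quasi_geodesic K C a' b' \<tau> \<Longrightarrow> \<sigma> a = \<tau> a' \<Longrightarrow> \<sigma> b = \<tau> b' \<Longrightarrow>
     t \<in> {a..b} \<Longrightarrow> \<exists>t'\<in>{a'..b'}. d (\<sigma> t) (\<tau> t') \<le> R"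
proof -
  obtain D where D: "\<And>x n a b \<sigma> i. discrete_geodesic x n \<Longrightarrow> quasi_geodesic K C a b \<sigma> \<Longrightarrow> \<sigma> a = x 0 \<Longrightarrow> \<sigma> b = x n \<Longrightarrow> i \<le> n \<Longrightarrow>
      \<exists>t\<in>{a..b}. d (x i) (\<sigma> t) \<le> D"
    using geodesic_near_quasi_geodesic[OF hyp K C] by blast
  obtain R where R: "\<And>x n a b \<sigma> t. discrete_geodesic x n \<Longrightarrow> quasi_geodesic K C a b \<sigma> \<Longrightarrow> \<sigma> a = x 0 \<Longrightarrow> \<sigma> b = x n
    \<Longrightarrow> t \<in> {a..b} \<Longrightarrow>
      \<exists>i\<le>n. d (x i) (\<sigma> t) \<le> R"
    using quasi_geodesic_near_geodesic[OF hyp K C] by blast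
  show ?thesis
  proof (rule that)
    fix a b \<sigma> a' b' \<tau> t assume \<sigma>: "quasi_geodesic K C a b \<sigma>" and \<tau>: "quasi_geodesic K C a' b' \<tau>"
      and e: "\<sigma> a = \<tau> a'" "\<sigma> b = \<tau> b'" and t: "t \<in> {a..b}"
    have "\<sigma> a \<in> M" "\<sigma> b \<in> M" using qg_in[OF \<sigma>] qg_le[OF \<sigma>] by auto
    then obtain x n where x: "discrete_geodesic x n" "x 0 = \<sigma> a" "x n = \<sigma> b" using geo by blast
    obtain i where i: "i \<le> n" "d (x i) (\<sigma> t) \<le> R" using R[OF x(1) \<sigma> _ _ t] x by auto
    obtain t' where t': "t' \<in> {a'..b'}" "d (x i) (\<tau> t') \<le> D" using D[OF x(1) \<tau> _ _ i(1)] x e by auto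
    have m: "x i \<in> M" using x(1) i(1) by (auto simp: discrete_geodesic_def)
    have "d (\<sigma> t) (\<tau> t') \<le> R + D"
      using triangle[OF qg_in[OF \<sigma> t] m qg_in[OF \<tau> t'(1)]] i t' by (simp add: commute)
    then show "\<exists>t'\<in>{a'..b'}. d (\<sigma> t) (\<tau> t') \<le> R + D" using t' by blast
  qed
qed

end

section \<open>Word metrics\<close>

context group
begin

lemma foldr_mult_closed: "set ws \<subseteq> carrier G \<Longrightarrow> foldr (\<otimes>) ws \<one> \<in> carrier G"
  by (induction ws) auto

lemma foldr_mult_append:
  "set ws \<subseteq> carrier G \<Longrightarrow> set vs \<subseteq> carrier G \<Longrightarrow> foldr (\<otimes>) (ws @ vs) \<one> = foldr (\<otimes>) ws \<one> \<otimes> foldr (\<otimes>) vs \<one>"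
proof (induction ws)
  case (Cons a ws)
  then show ?case using foldr_mult_closed[of vs] foldr_mult_closed[of ws] by (simp add: m_assoc del: foldr_append)
qed (use foldr_mult_closed in simp)

lemma foldr_mult_inv:
  "set ws \<subseteq> carrier G \<Longrightarrow> foldr (\<otimes>) (rev (map (m_inv G) ws)) \<one> = inv (foldr (\<otimes>) ws \<one>)"
proof (induction ws)
  case (Cons a ws)
  have "set (rev (map (m_inv G) ws)) \<subseteq> carrier G" using Cons.prems by auto
  then have "foldr (\<otimes>) (rev (map (m_inv G) ws) @ [inv a]) \<one> = foldr (\<otimes>) (rev (map (m_inv G) ws)) \<one> \<otimes> foldr
    (\<otimes>) [inv a] \<one>"
    using Cons.prems by (intro foldr_mult_append) auto
  then show ?case using Cons foldr_mult_closed[of ws] by (simp add: inv_mult_group del: foldr_append)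
qed simp

context
  fixes S assumes S: "S \<subseteq> carrier G" and gen: "generate G S = carrier G"
begin

lemma letters_closed: "S \<union> m_inv G ` S \<subseteq> carrier G"
  using S by auto

lemma generate_word:
  assumes "g \<in> generate G S"
  shows "\<exists>ws. set ws \<subseteq> S \<union> m_inv G ` S \<and> foldr (\<otimes>) ws \<one> = g"
  using assms
proof (induction rule: generate.induct)
  case one
  then show ?case by (intro exI[of _ "[]"]) simp
next
  case (incl h)
  then show ?case using S by (intro exI[of _ "[h]"]) auto
next
  case (inv h)
  then show ?case using S by (intro exI[of _ "[inv h]"]) auto
next
  case (eng h1 h2)
  then obtain ws vs where "set ws \<subseteq> S \<union> m_inv G ` S" "foldr (\<otimes>) ws \<one> = h1" "set vs \<subseteq> S \<union> m_inv G ` S"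
    "foldr (\<otimes>) vs \<one> = h2" by blast
  then show ?case using foldr_mult_append[of ws vs] letters_closed by (intro exI[of _ "ws @ vs"]) auto
qed

lemma word_length_witness:
  assumes "g \<in> carrier G"
  obtains ws where "length ws = word_length G S g" "set ws \<subseteq> S \<union> m_inv G ` S" "foldr (\<otimes>) ws \<one> = g"
proof -
  have "\<exists>n ws. length ws = n \<and> set ws \<subseteq> S \<union> m_inv G ` S \<and> foldr (\<otimes>) ws \<one> = g"
    using generate_word[of g] gen assms by auto
  from LeastI_ex[OF this] show ?thesis using that unfolding word_length_def by blast
qed

lemma word_length_le:
  assumes "set ws \<subseteq> S \<union> m_inv G ` S" "foldr (\<otimes>) ws \<one> = g"
  shows "word_length G S g \<le> length ws"
  unfolding word_length_def by (rule Least_le) (use assms in blast)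

lemma word_length_mult:
  assumes "g \<in> carrier G" "h \<in> carrier G"
  shows "word_length G S (g \<otimes> h) \<le> word_length G S g + word_length G S h"
proof -
  obtain ws where ws: "length ws = word_length G S g" "set ws \<subseteq> S \<union> m_inv G ` S" "foldr (\<otimes>) ws \<one> = g"
    using word_length_witness[OF assms(1)] .
  obtain vs where vs: "length vs = word_length G S h" "set vs \<subseteq> S \<union> m_inv G ` S" "foldr (\<otimes>) vs \<one> = h"
    using word_length_witness[OF assms(2)] .
  have "set ws \<subseteq> carrier G" "set vs \<subseteq> carrier G" using ws(2) vs(2) letters_closed by blast+
  then have "foldr (\<otimes>) (ws @ vs) \<one> = g \<otimes> h" using foldr_mult_append[of ws vs] ws vs by (simp del: foldr_append)
  from word_length_le[OF _ this] show ?thesis using ws vs by simp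
qed

lemma word_length_inv:
  assumes "g \<in> carrier G"
  shows "word_length G S (inv g) \<le> word_length G S g"
proof -
  obtain ws where ws: "length ws = word_length G S g" "set ws \<subseteq> S \<union> m_inv G ` S" "foldr (\<otimes>) ws \<one> = g"
    using word_length_witness[OF assms(1)] .
  have "set ws \<subseteq> carrier G" using ws letters_closed by blast
  then have "foldr (\<otimes>) (rev (map (m_inv G) ws)) \<one> = inv g" using foldr_mult_inv[of ws] ws by simp
  moreover have "set (rev (map (m_inv G) ws)) \<subseteq> S \<union> m_inv G ` S"
  proof
    fix z assume "z \<in> set (rev (map (m_inv G) ws))"
    then obtain a where a: "a \<in> set ws" "z = inv a" by auto
    then have "a \<in> S \<union> m_inv G ` S" using ws(2) by blast
    then show "z \<in> S \<union> m_inv G ` S" using S a(2) by (auto simp: subset_iff)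
  qed
  ultimately show ?thesis using word_length_le ws(1) by fastforce
qed

lemma word_length_0:
  assumes "g \<in> carrier G"
  shows "word_length G S g = 0 \<longleftrightarrow> g = \<one>"
proof
  assume "word_length G S g = 0"
  then show "g = \<one>" using word_length_witness[OF assms] by auto
next
  assume "g = \<one>"
  then show "word_length G S g = 0" using word_length_le[of "[]" g] by simp
qed

lemma word_metric_left_invariant:
  assumes "g \<in> carrier G" "h \<in> carrier G" "k \<in> carrier G"
  shows "word_metric G S (g \<otimes> h) (g \<otimes> k) = word_metric G S h k"
proof -
  have "inv (g \<otimes> h) \<otimes> (g \<otimes> k) = inv h \<otimes> (inv g \<otimes> (g \<otimes> k))" using assms by (simp add: inv_mult_group m_assoc)
  also have "inv g \<otimes> (g \<otimes> k) = k" using assms by (simp add: m_assoc[symmetric])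
  finally show ?thesis by (simp add: word_metric_def)
qed

text \<open>The axioms of \<^locale>\<open>Metric_space\<close> include symmetry outside the carrier, where the
  word metric need not be symmetric.\<close>

definition carrier_metric :: "'a \<Rightarrow> 'a \<Rightarrow> real" where
  "carrier_metric g h = (if g \<in> carrier G \<and> h \<in> carrier G then word_metric G S g h else 0)"

lemma carrier_metric_eq: "g \<in> carrier G \<Longrightarrow> h \<in> carrier G \<Longrightarrow> carrier_metric g h = word_metric G S g h"
  by (simp add: carrier_metric_def)

lemma word_metric_space: "Metric_space (carrier G) carrier_metric"
proof
  show "0 \<le> carrier_metric g h" for g h by (simp add: carrier_metric_def word_metric_def)
  have le: "word_metric G S h g \<le> word_metric G S g h" if "g \<in> carrier G" "h \<in> carrier G" for g h
    using word_length_inv[of "inv g \<otimes> h"] that by (simp add: word_metric_def inv_mult_group)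
  show "carrier_metric g h = carrier_metric h g" for g h
    using le[of g h] le[of h g] by (auto simp: carrier_metric_def)
  show "(carrier_metric g h = 0) = (g = h)" if "g \<in> carrier G" "h \<in> carrier G" for g h
  proof -
    have "(inv g \<otimes> h = \<one>) = (g = h)" using that inv_solve_left[of \<one> g h] by (metis inv_solve_left one_closed r_one)
    then show ?thesis using word_length_0[of "inv g \<otimes> h"] that by (simp add: carrier_metric_eq word_metric_def)
  qed
  show "carrier_metric g k \<le> carrier_metric g h + carrier_metric h k"
    if "g \<in> carrier G" "h \<in> carrier G" "k \<in> carrier G" for g h k
  proof -
    have "inv g \<otimes> k = (inv g \<otimes> h) \<otimes> (inv h \<otimes> k)"
      using that by (metis inv_closed inv_solve_left m_assoc m_closed)
    then show ?thesis using word_length_mult[of "inv g \<otimes> h" "inv h \<otimes> k"] that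
      by (simp add: carrier_metric_eq word_metric_def)
  qed
qed

text \<open>The prefixes of a shortest word for the quotient of \<open>g\<close> and \<open>h\<close>.\<close>

lemma word_geodesic:
  assumes "g \<in> carrier G" "h \<in> carrier G"
  shows "\<exists>x n. Metric_space.discrete_geodesic (carrier G) carrier_metric x n \<and> x 0 = g \<and> x n = h"
proof -
  interpret W: Metric_space "carrier G" carrier_metric by (rule word_metric_space)
  have gh: "inv g \<otimes> h \<in> carrier G" using assms by simp
  obtain ws where ws: "length ws = word_length G S (inv g \<otimes> h)" "set ws \<subseteq> S \<union> m_inv G ` S"
    "foldr (\<otimes>) ws \<one> = inv g \<otimes> h"
    using word_length_witness[OF gh] .
  define n where "n = length ws"
  define x where "x = (\<lambda>i. g \<otimes> foldr (\<otimes>) (take i ws) \<one>)"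
  have sub: "set (take i ws) \<subseteq> carrier G" "set (drop i (take j ws)) \<subseteq> S \<union> m_inv G ` S" for i j
    using ws(2) letters_closed set_take_subset[of i ws] set_take_subset[of j ws] set_drop_subset[of i "take j ws"]
      by blast+
  have xc: "x i \<in> carrier G" for i using assms foldr_mult_closed[OF sub(1)] by (simp add: x_def)
  have x0: "x 0 = g" using assms by (simp add: x_def)
  have xn: "x n = h" using assms ws(3) by (simp add: x_def n_def m_assoc[symmetric])
  have dn: "carrier_metric (x 0) (x n) = real n"
    unfolding x0 xn using assms ws(1) by (simp add: carrier_metric_eq word_metric_def n_def)
  have up: "carrier_metric (x i) (x j) \<le> real j - real i" if "i \<le> j" "j \<le> n" for i j
  proof -
    let ?a = "foldr (\<otimes>) (take i ws) \<one>" and ?b = "foldr (\<otimes>) (drop i (take j ws)) \<one>"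
    have c: "?a \<in> carrier G" "?b \<in> carrier G" using foldr_mult_closed sub letters_closed by blast+
    have "take j ws = take i ws @ drop i (take j ws)" using that
      by (metis append_take_drop_id min.absorb2 take_take min.commute)
    then have "foldr (\<otimes>) (take j ws) \<one> = ?a \<otimes> ?b"
      using foldr_mult_append[of "take i ws" "drop i (take j ws)"] sub letters_closed by (metis subset_trans)
    then have "x j = x i \<otimes> ?b" using c assms by (simp add: x_def m_assoc)
    then have "inv (x i) \<otimes> x j = ?b" using xc[of i] c by (simp add: m_assoc[symmetric])
    then have "word_length G S (inv (x i) \<otimes> x j) \<le> length (drop i (take j ws))"
      using word_length_le[OF sub(2)] by metis
    moreover have "length (drop i (take j ws)) = j - i" using that by (simp add: n_def)
    ultimately show ?thesis using that xc by (simp add: carrier_metric_eq word_metric_def)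
  qed
  have eq: "carrier_metric (x i) (x j) = real j - real i" if "i \<le> j" "j \<le> n" for i j
    using up[OF that] up[of 0 i] up[of j n] dn W.triangle[OF xc[of 0] xc[of i] xc[of n]] W.triangle[OF xc[of i] xc[of
      j] xc[of n]] that by simp
  have "W.discrete_geodesic x n"
    unfolding W.discrete_geodesic_def
  proof (intro conjI allI impI xc)
    fix i j assume "i \<le> n" "j \<le> n"
    then show "carrier_metric (x i) (x j) = \<bar>real i - real j\<bar>"
      using eq[of i j] eq[of j i] W.commute[of "x i" "x j"] by (cases "i \<le> j") auto
  qed
  then show ?thesis using x0 xn by blast
qed

end
end

section \<open>Orbit maps\<close>

context Metric_space
begin

text \<open>The Milnor--Svarc argument: step along a geodesic between two points of the orbit. Neighbouring steps are
  near orbit points that differ by one of finitely many group elements. The comparison is with an arbitrary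
    left-invariant
  \<open>\<nu>\<close>, so that it applies to word metrics and to the orbits in another space.\<close>

lemma orbit_control:
  assumes geo: geodesic_space and pr: proper and ga: "geometric_action G \<phi>" and e: "e \<in> M"
    and inv: "\<And>g h k. g \<in> carrier G \<Longrightarrow> h \<in> carrier G \<Longrightarrow> k \<in> carrier G \<Longrightarrow> \<nu> (g \<otimes>\<^bsub>G\<^esub> h) (g \<otimes>\<^bsub>G\<^esub> k) = (\<nu> h k :: real)"
    and tri: "\<And>g h k. g \<in> carrier G \<Longrightarrow> h \<in> carrier G \<Longrightarrow> k \<in> carrier G \<Longrightarrow> \<nu> g k \<le> \<nu> g h + \<nu> h k"
  obtains A where "A \<ge> 0" "\<And>g h. g \<in> carrier G \<Longrightarrow> h \<in> carrier G \<Longrightarrow> \<nu> g h \<le> A * d (\<phi> g e) (\<phi> h e) + A"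
proof -
  interpret group G using action_group[OF ga] .
  note iso = action_isometry[OF ga]
  obtain R0 where R0: "R0 \<ge> 0" "\<And>p. p \<in> M \<Longrightarrow> \<exists>g\<in>carrier G. d p (\<phi> g e) \<le> R0" using action_cobounded[OF ga e] by blast
  define F where "F = {g \<in> carrier G. d e (\<phi> g e) \<le> 2 * R0 + 1}"
  have F: "finite F" unfolding F_def by (rule action_proper[OF ga pr e])
  define A where "A = Max (insert 0 (\<nu> \<one>\<^bsub>G\<^esub> ` F))"
  have A0: "A \<ge> 0" using F by (simp add: A_def)
  have orb: "\<phi> g e \<in> M" if "g \<in> carrier G" for g using isometryD(1)[OF iso[OF that] e] .
  have step: "\<nu> g h \<le> A" if g: "g \<in> carrier G" "h \<in> carrier G" "d (\<phi> g e) (\<phi> h e) \<le> 2 * R0 + 1" for g h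
  proof -
    let ?k = "inv\<^bsub>G\<^esub> g \<otimes>\<^bsub>G\<^esub> h"
    have k: "?k \<in> carrier G" "g \<otimes>\<^bsub>G\<^esub> ?k = h" using g by (simp_all add: m_assoc[symmetric])
    have "d e (\<phi> ?k e) = d (\<phi> g e) (\<phi> g (\<phi> ?k e))" using isometryD(2)[OF iso[OF g(1)] e orb[OF k(1)]] by simp
    also have "\<phi> g (\<phi> ?k e) = \<phi> h e" using action_mult[OF ga g(1) k(1) e] k by simp
    finally have "?k \<in> F" using g k by (simp add: F_def)
    then have "\<nu> \<one>\<^bsub>G\<^esub> ?k \<le> A" unfolding A_def using F by (intro Max_ge) auto
    moreover have "\<nu> (g \<otimes>\<^bsub>G\<^esub> \<one>\<^bsub>G\<^esub>) (g \<otimes>\<^bsub>G\<^esub> ?k) = \<nu> \<one>\<^bsub>G\<^esub> ?k" by (rule inv) (use g k in auto)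
    ultimately show ?thesis using g k by simp
  qed
  have main: "\<nu> g h \<le> (3 * A) * d (\<phi> g e) (\<phi> h e) + 3 * A" if g: "g \<in> carrier G" and h: "h \<in> carrier G" for g h
  proof -
    define l where "l = d (\<phi> g e) (\<phi> h e)"
    obtain c where c: "quasi_geodesic 1 0 0 l c" "c 0 = \<phi> g e" "c l = \<phi> h e"
      using geodesic_qg[OF geo orb[OF g] orb[OF h]] by (metis l_def)
    have l0: "l \<ge> 0" by (simp add: l_def)
    define p where "p = (\<lambda>j::nat. c (min (real j) l))"
    have mn: "min (real j) l \<in> {0..l}" for j :: nat using l0 by auto
    have pm: "p j \<in> M" for j using qg_in[OF c(1) mn] by (simp add: p_def)
    have pd: "d (p j) (p (Suc j)) \<le> 1" for j
      using qg_upper[OF c(1) mn mn, of j "Suc j"] by (simp add: p_def min_def split: if_splits)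
    have "\<exists>k\<in>carrier G. d (p j) (\<phi> k e) \<le> R0" for j using R0(2)[OF pm] .
    then obtain k0 where k0: "\<And>j. k0 j \<in> carrier G" "\<And>j. d (p j) (\<phi> (k0 j) e) \<le> R0" by metis
    define k where "k = k0(0 := g)"
    have p0: "p 0 = \<phi> g e" using c l0 by (simp add: p_def)
    have k: "k j \<in> carrier G" "d (p j) (\<phi> (k j) e) \<le> R0" for j using k0 g p0 R0(1) orb[OF g] by (auto simp: k_def)
    have ks: "\<nu> (k j) (k (Suc j)) \<le> A" for j
    proof (rule step[OF k(1) k(1)])
      show "d (\<phi> (k j) e) (\<phi> (k (Suc j)) e) \<le> 2 * R0 + 1"
        using triangle[OF orb[OF k(1)[of j]] pm[of j] orb[OF k(1)[of "Suc j"]]] triangle[OF pm[of j] pm[of "Suc j"]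
          orb[OF k(1)[of "Suc j"]]] pd[of j] k(2)[of j] k(2)[of "Suc j"]
        by (simp add: commute)
    qed
    have sum: "\<nu> g (k j) \<le> real (Suc j) * A" for j
    proof (induction j)
      case 0
      show ?case using step[OF g g] R0(1) orb[OF g] by (simp add: k_def)
    next
      case (Suc j)
      have "\<nu> g (k (Suc j)) \<le> \<nu> g (k j) + \<nu> (k j) (k (Suc j))" by (rule tri[OF g k(1) k(1)])
      then show ?case using Suc ks[of j] by (simp add: algebra_simps)
    qed
    define n where "n = nat \<lceil>l\<rceil>"
    have n: "real n \<ge> l" "real n \<le> l + 1" using l0 unfolding n_def by linarith+
    have "p n = \<phi> h e" using n c by (simp add: p_def min_def)
    then have "\<nu> (k n) h \<le> A" using k(2)[of n] R0(1) by (intro step[OF k(1) h]) (simp add: commute)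
    then have "\<nu> g h \<le> real (Suc n) * A + A" using tri[OF g k(1) h, of n] sum[of n] by simp
    also have "\<dots> = (real n + 2) * A" by (simp add: algebra_simps)
    also have "\<dots> \<le> (l + 3) * A" using n A0 by (intro mult_right_mono) auto
    also have "\<dots> \<le> (3 * l + 3) * A" using l0 A0 by (intro mult_right_mono) auto
    finally show ?thesis by (simp add: l_def algebra_simps)
  qed
  then show ?thesis using that[of "3 * A"] A0 by auto
qed

text \<open>Stability of quasi-geodesics: one gauge for all geodesic segments.\<close>

definition uniformly_morse :: "(real \<Rightarrow> real \<Rightarrow> real) \<Rightarrow> bool" where
  "uniformly_morse N \<longleftrightarrow> gauge_fun N \<and> (\<forall>K\<ge>1. \<forall>C\<ge>0. \<forall>a b \<sigma> l c. quasi_geodesic K C a b \<sigma> \<longrightarrow> quasi_geodesic 1 0 0 l c \<longrightarrow>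
      \<sigma> a = c 0 \<longrightarrow> \<sigma> b = c l \<longrightarrow> (\<forall>t\<in>{a..b}. \<exists>s\<in>{0..l}. d (\<sigma> t) (c s) \<le> N K C))"

lemma uniformly_morseD:
  assumes "uniformly_morse N" "K \<ge> 1" "C \<ge> 0" "quasi_geodesic K C a b \<sigma>" "quasi_geodesic 1 0 0 l c" "\<sigma> a = c 0"
    "\<sigma> b = c l" "t \<in> {a..b}"
  obtains s where "s \<in> {0..l}" "d (\<sigma> t) (c s) \<le> N K C"
  using assms unfolding uniformly_morse_def by blast

text \<open>A coarse inverse \<open>\<pi>\<close> of the orbit map carries quasi-geodesics to quasi-geodesics of the word
  metric with the same
  endpoints. There they are close to each other, and the orbit map carries this back.\<close>

lemma hyperbolic_action_uniformly_morse:
  assumes geo: geodesic_space and pr: proper and ga: "geometric_action G \<phi>" and hyp: "hyperbolic_group G"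
    and e: "e \<in> M"
  obtains N where "uniformly_morse N"
proof -
  interpret group G using action_group[OF ga] .
  obtain S where S: "finite S" "S \<subseteq> carrier G" "generate G S = carrier G"
    "gromov_hyperbolic (carrier G) (word_metric G S)"
    using hyp unfolding hyperbolic_group_def by blast
  define dW where "dW = carrier_metric S"
  interpret W: Metric_space "carrier G" dW unfolding dW_def by (rule word_metric_space[OF S(2,3)])
  have dWeq: "dW g h = word_metric G S g h" if "g \<in> carrier G" "h \<in> carrier G" for g h
    using carrier_metric_eq[OF S(2,3) that] by (simp add: dW_def)
  have hypW: "gromov_hyperbolic (carrier G) dW"
    using S(4) unfolding gromov_hyperbolic_def gromov_product_def by (simp add: dWeq cong: ball_cong)
  have geoW: "\<exists>x n. W.discrete_geodesic x n \<and> x 0 = g \<and> x n = h" if "g \<in> carrier G" "h \<in> carrier G" for g h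
    using word_geodesic[OF S(2,3) that] by (simp add: dW_def)
  note iso = action_isometry[OF ga]
  have orb: "\<phi> g e \<in> M" if "g \<in> carrier G" for g using isometryD(1)[OF iso[OF that] e] .
  \<comment> \<open>The orbit map is a quasi-isometric embedding: \<open>A\<close> gives one inequality, \<open>low\<close> the other.\<close>
  obtain A where A: "A \<ge> 0" "\<And>g h. g \<in> carrier G \<Longrightarrow> h \<in> carrier G \<Longrightarrow> dW g h \<le> A * d (\<phi> g e) (\<phi> h e) + A"
  proof (rule orbit_control[OF geo pr ga e, of dW])
    show "dW (g \<otimes>\<^bsub>G\<^esub> h) (g \<otimes>\<^bsub>G\<^esub> k) = dW h k" if "g \<in> carrier G" "h \<in> carrier G" "k \<in> carrier G" for g h k
      using word_metric_left_invariant[OF S(2,3) that] that by (simp add: dWeq)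
    show "dW g k \<le> dW g h + dW h k" if "g \<in> carrier G" "h \<in> carrier G" "k \<in> carrier G" for g h k
      using W.triangle that .
  qed blast
  let ?L = "S \<union> m_inv G ` S"
  define B where "B = Max (insert 1 ((\<lambda>s. d e (\<phi> s e)) ` ?L))"
  have fL: "finite ?L" using S(1) by simp
  have B: "B \<ge> 1" "\<And>s. s \<in> ?L \<Longrightarrow> d e (\<phi> s e) \<le> B" using fL by (auto simp: B_def intro!: Max_ge)
  have LG: "?L \<subseteq> carrier G" using letters_closed[OF S(2,3)] .
  have word: "d e (\<phi> (foldr (\<otimes>\<^bsub>G\<^esub>) ws \<one>\<^bsub>G\<^esub>) e) \<le> B * real (length ws)" if "set ws \<subseteq> ?L" for ws
    using that
  proof (induction ws)
    case Nil
    then show ?case using action_one[OF ga e] e by simp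
  next
    case (Cons s ws)
    have s: "s \<in> carrier G" "s \<in> ?L" using Cons.prems LG by auto
    have w: "foldr (\<otimes>\<^bsub>G\<^esub>) ws \<one>\<^bsub>G\<^esub> \<in> carrier G" using foldr_mult_closed[of ws] Cons.prems LG by auto
    let ?w = "foldr (\<otimes>\<^bsub>G\<^esub>) ws \<one>\<^bsub>G\<^esub>"
    have "d e (\<phi> (s \<otimes>\<^bsub>G\<^esub> ?w) e) \<le> d e (\<phi> s e) + d (\<phi> s e) (\<phi> s (\<phi> ?w e))"
      unfolding action_mult[OF ga s(1) w e] using triangle[OF e orb[OF s(1)]] isometryD(1)[OF iso[OF s(1)] orb[OF w]]
        by blast
    also have "d (\<phi> s e) (\<phi> s (\<phi> ?w e)) = d e (\<phi> ?w e)" by (rule isometryD(2)[OF iso[OF s(1)] e orb[OF w]])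
    also have "d e (\<phi> s e) + d e (\<phi> ?w e) \<le> B + B * real (length ws)" using B(2)[OF s(2)] Cons
      by (intro add_mono) auto
    finally show ?case by (simp add: algebra_simps)
  qed
  have low: "d (\<phi> g e) (\<phi> h e) \<le> B * dW g h" if gh: "g \<in> carrier G" "h \<in> carrier G" for g h
  proof -
    let ?k = "inv\<^bsub>G\<^esub> g \<otimes>\<^bsub>G\<^esub> h"
    have k: "?k \<in> carrier G" "g \<otimes>\<^bsub>G\<^esub> ?k = h" using gh by (simp_all add: m_assoc[symmetric])
    obtain ws where ws: "length ws = word_length G S ?k" "set ws \<subseteq> ?L" "foldr (\<otimes>\<^bsub>G\<^esub>) ws \<one>\<^bsub>G\<^esub> = ?k"
      using word_length_witness[OF S(2,3) k(1)] .
    have "d (\<phi> g e) (\<phi> h e) = d (\<phi> g e) (\<phi> g (\<phi> ?k e))" using action_mult[OF ga gh(1) k(1) e] k by simp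
    also have "\<dots> = d e (\<phi> ?k e)" by (rule isometryD(2)[OF iso[OF gh(1)] e orb[OF k(1)]])
    also have "\<dots> \<le> B * real (length ws)" using word[OF ws(2)] ws(3) by simp
    finally show ?thesis using ws(1) gh by (simp add: dWeq word_metric_def)
  qed
  obtain R0 where R0: "R0 \<ge> 0" "\<And>p. p \<in> M \<Longrightarrow> \<exists>g\<in>carrier G. d p (\<phi> g e) \<le> R0" using action_cobounded[OF ga e] by blast
  then obtain \<pi> where \<pi>: "\<And>p. p \<in> M \<Longrightarrow> \<pi> p \<in> carrier G" "\<And>p. p \<in> M \<Longrightarrow> d p (\<phi> (\<pi> p) e) \<le> R0" by metis
  have lower: "d p q \<le> 2 * R0 + B * dW (\<pi> p) (\<pi> q)" if pq: "p \<in> M" "q \<in> M" for p q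
    using triangle[OF pq(1) orb[OF \<pi>(1)[OF pq(1)]] pq(2)] triangle[OF orb[OF \<pi>(1)[OF pq(1)]] orb[OF \<pi>(1)[OF
      pq(2)]] pq(2)]
      low[OF \<pi>(1)[OF pq(1)] \<pi>(1)[OF pq(2)]] \<pi>(2)[OF pq(1)] \<pi>(2)[OF pq(2)] by (simp add: commute)
  define A1 where "A1 = max A B"
  define A2 where "A2 = A1 * (2 * R0 + 1)"
  have A1: "A1 \<ge> 1" "A \<le> A1" "B \<le> A1" "A1 \<ge> 0" using B by (auto simp: A1_def)
  have "1 * (2 * R0 + 1) \<le> A2" unfolding A2_def using A1 R0 by (intro mult_right_mono) auto
  then have A2: "A2 \<ge> 0" "2 * R0 \<le> A2" using R0 by auto
  have upper: "dW (\<pi> p) (\<pi> q) \<le> A1 * d p q + A2" if pq: "p \<in> M" "q \<in> M" for p q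
  proof -
    have "d (\<phi> (\<pi> p) e) (\<phi> (\<pi> q) e) \<le> d p q + 2 * R0"
      using triangle[OF orb[OF \<pi>(1)[OF pq(1)]] pq(1) orb[OF \<pi>(1)[OF pq(2)]]] triangle[OF pq(1,2) orb[OF
        \<pi>(1)[OF pq(2)]]]
        \<pi>(2)[OF pq(1)] \<pi>(2)[OF pq(2)] by (simp add: commute)
    then have "dW (\<pi> p) (\<pi> q) \<le> A * (d p q + 2 * R0) + A"
      using A(2)[OF \<pi>(1)[OF pq(1)] \<pi>(1)[OF pq(2)]] mult_left_mono[OF _ A(1), of "d (\<phi> (\<pi> p) e) (\<phi> (\<pi> q) e)"
        "d p q + 2 * R0"] by simp
    also have "\<dots> = A * (d p q + 2 * R0 + 1)" by (simp add: algebra_simps)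
    also have "\<dots> \<le> A1 * (d p q + 2 * R0 + 1)" using A1 R0 by (intro mult_right_mono) auto
    finally show ?thesis by (simp add: A2_def algebra_simps)
  qed
  have qgW: "W.quasi_geodesic (A1 * K) (A1 * C + A2) a b (\<lambda>t. \<pi> (\<sigma> t))"
    if \<sigma>: "quasi_geodesic K C a b \<sigma>" and K: "K \<ge> 1" and C: "C \<ge> 0" for K C a b \<sigma>
  proof (rule W.qgI)
    show "a \<le> b" using qg_le[OF \<sigma>] .
    show "\<pi> (\<sigma> t) \<in> carrier G" if "t \<in> {a..b}" for t using \<pi>(1) qg_in[OF \<sigma> that] by blast
    fix s t assume st: "s \<in> {a..b}" "t \<in> {a..b}" "s \<le> t"
    have m: "\<sigma> s \<in> M" "\<sigma> t \<in> M" using qg_in[OF \<sigma>] st by auto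
    have "t - s \<le> K * (d (\<sigma> s) (\<sigma> t) + C)" using qg_gap[OF \<sigma> K st(1,2)] st by simp
    also have "d (\<sigma> s) (\<sigma> t) \<le> A2 + A1 * dW (\<pi> (\<sigma> s)) (\<pi> (\<sigma> t))"
      using lower[OF m] A2 mult_right_mono[OF A1(3) W.nonneg[of "\<pi> (\<sigma> s)" "\<pi> (\<sigma> t)"]] by linarith
    also have "C \<le> A1 * C" using A1 C mult_right_mono[of 1 A1 C] by simp
    finally have "t - s \<le> K * (A2 + A1 * dW (\<pi> (\<sigma> s)) (\<pi> (\<sigma> t)) + A1 * C)" using K by (simp add: mult_left_mono)
    also have "\<dots> = A1 * K * dW (\<pi> (\<sigma> s)) (\<pi> (\<sigma> t)) + K * (A1 * C + A2)" by (simp add: algebra_simps)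
    also have "\<dots> \<le> A1 * K * dW (\<pi> (\<sigma> s)) (\<pi> (\<sigma> t)) + A1 * K * (A1 * C + A2)"
      using A1 A2 K C mult_right_mono[of 1 A1 K] by (intro add_left_mono mult_right_mono) auto
    finally have lo: "t - s \<le> A1 * K * (dW (\<pi> (\<sigma> s)) (\<pi> (\<sigma> t)) + (A1 * C + A2))" by (simp add: algebra_simps)
    have pos: "A1 * K > 0" using A1 K by simp
    have "(t - s) / (A1 * K) \<le> dW (\<pi> (\<sigma> s)) (\<pi> (\<sigma> t)) + (A1 * C + A2)"
      using lo pos by (simp add: pos_divide_le_eq mult.commute)
    moreover have "dW (\<pi> (\<sigma> s)) (\<pi> (\<sigma> t)) \<le> A1 * K * (t - s) + (A1 * C + A2)"
    proof -
      have "dW (\<pi> (\<sigma> s)) (\<pi> (\<sigma> t)) \<le> A1 * d (\<sigma> s) (\<sigma> t) + A2" by (rule upper[OF m])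
      also have "A1 * d (\<sigma> s) (\<sigma> t) \<le> A1 * (K * (t - s) + C)" using qg_upper[OF \<sigma> st(1,2)] st A1
        by (intro mult_left_mono) auto
      finally show ?thesis by (simp add: algebra_simps)
    qed
    ultimately show "(t - s) / (A1 * K) - (A1 * C + A2) \<le> dW (\<pi> (\<sigma> s)) (\<pi> (\<sigma> t)) \<and>
       dW (\<pi> (\<sigma> s)) (\<pi> (\<sigma> t)) \<le> A1 * K * (t - s) + (A1 * C + A2)" by simp
  qed
  have "\<exists>R\<ge>0. \<forall>a b \<sigma> l c. quasi_geodesic K C a b \<sigma> \<longrightarrow> quasi_geodesic 1 0 0 l c \<longrightarrow>
      \<sigma> a = c 0 \<longrightarrow> \<sigma> b = c l \<longrightarrow> (\<forall>t\<in>{a..b}. \<exists>s\<in>{0..l}. d (\<sigma> t) (c s) \<le> R)" if K: "K \<ge> 1" and C: "C \<ge> 0" for K C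
  proof -
    have K': "A1 * K \<ge> 1" "A1 * C + A2 \<ge> 0" using A1 A2 K C mult_mono[of 1 A1 1 K] by auto
    obtain R where R: "\<And>a b \<sigma> a' b' \<tau> t. W.quasi_geodesic (A1 * K) (A1 * C + A2) a b \<sigma> \<Longrightarrow> W.quasi_geodesic (A1 * K) (A1
      * C + A2) a' b' \<tau> \<Longrightarrow>
       \<sigma> a = \<tau> a' \<Longrightarrow> \<sigma> b = \<tau> b' \<Longrightarrow> t \<in> {a..b} \<Longrightarrow> \<exists>t'\<in>{a'..b'}. dW (\<sigma> t) (\<tau> t') \<le> R"
      using W.hyperbolic_quasi_geodesics_close[OF hypW K' geoW] by blast
    show ?thesis
    proof (intro exI[of _ "2 * R0 + B * max R 0"] conjI allI impI ballI)
      show "0 \<le> 2 * R0 + B * max R 0" using R0 B by simp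
      fix a b \<sigma> l c t assume \<sigma>: "quasi_geodesic K C a b \<sigma>" and c: "quasi_geodesic 1 0 0 l c"
        and ends: "\<sigma> a = c 0" "\<sigma> b = c l"
        and t: "t \<in> {a..b}"
      have c': "quasi_geodesic K C 0 l c" by (rule qg_mono[OF c order_refl K C])
      obtain s where s: "s \<in> {0..l}" "dW (\<pi> (\<sigma> t)) (\<pi> (c s)) \<le> R"
        using R[OF qgW[OF \<sigma> K C] qgW[OF c' K C] _ _ t] ends by auto
      have "d (\<sigma> t) (c s) \<le> 2 * R0 + B * dW (\<pi> (\<sigma> t)) (\<pi> (c s))" by (rule lower[OF qg_in[OF \<sigma> t] qg_in[OF c s(1)]])
      also have "\<dots> \<le> 2 * R0 + B * max R 0" using s(2) B by (intro add_left_mono mult_left_mono) auto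
      finally show "\<exists>s\<in>{0..l}. d (\<sigma> t) (c s) \<le> 2 * R0 + B * max R 0" using s(1) by blast
    qed
  qed
  then obtain N where "\<And>K C. K \<ge> 1 \<Longrightarrow> C \<ge> 0 \<Longrightarrow> N K C \<ge> 0 \<and> (\<forall>a b \<sigma> l c. quasi_geodesic K C a b \<sigma> \<longrightarrow>
    quasi_geodesic 1 0 0 l c \<longrightarrow>
      \<sigma> a = c 0 \<longrightarrow> \<sigma> b = c l \<longrightarrow> (\<forall>t\<in>{a..b}. \<exists>s\<in>{0..l}. d (\<sigma> t) (c s) \<le> N K C))" by metis
  then have "uniformly_morse N" unfolding uniformly_morse_def gauge_fun_def by blast
  then show ?thesis by (rule that)
qed

section \<open>The Morse boundary\<close>

lemma segment_qg: "geodesic_segment c p q \<Longrightarrow> quasi_geodesic 1 0 0 (d p q) c"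
  unfolding geodesic_segment_def quasi_geodesic_def by auto

lemma uniformly_morse_ray:
  assumes N: "uniformly_morse N" and \<gamma>: "\<gamma> \<in> geodesic_rays e"
  shows "\<gamma> \<in> N_morse_rays e N"
proof -
  have \<gamma>c: "coarse_ray 0 \<gamma>" using \<gamma> by (rule geodesic_ray_coarse)
  have m: "\<gamma> t \<in> M" if "t \<ge> 0" for t using coarse_rayD(1)[OF \<gamma>c that that] .
  have key: "\<sigma> t \<in> nbhd (N K C) (\<gamma> ` {0..})"
    if K: "K \<ge> 1" "C \<ge> 0" and \<sigma>: "quasi_geodesic K C a b \<sigma>" "\<sigma> a = \<gamma> x" "\<sigma> b = \<gamma> y" and xy: "0 \<le> x" "x \<le> y"
      and t: "t \<in> {a..b}" for K C a b \<sigma> x y t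
  proof -
    have "quasi_geodesic 1 0 (x + (- x)) (y + (- x)) (\<lambda>t. \<gamma> (t - (- x)))"
      by (rule qg_shift[OF coarse_ray_qg[OF \<gamma>c xy]])
    then have c: "quasi_geodesic 1 0 0 (y - x) (\<lambda>t. \<gamma> (t + x))" by simp
    obtain s where s: "s \<in> {0..y - x}" "d (\<sigma> t) (\<gamma> (s + x)) \<le> N K C"
      by (rule uniformly_morseD[OF N K \<sigma>(1) c _ _ t]) (use \<sigma> in auto)
    then show ?thesis using m[of "s + x"] qg_in[OF \<sigma>(1) t] xy
      by (auto simp: in_nbhd commute intro!: bexI[of _ "s + x"])
  qed
  have "morse_set N (\<gamma> ` {0..})"
    unfolding morse_set_def
  proof (intro conjI allI impI)
    show "\<gamma> ` {0..} \<subseteq> M" using m by auto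
    fix K C a b \<sigma> assume K: "1 \<le> (K::real)" "0 \<le> (C::real)"
      and *: "quasi_geodesic K C a b \<sigma> \<and> \<sigma> a \<in> \<gamma> ` {0..} \<and> \<sigma> b \<in> \<gamma> ` {0..}"
    then obtain x y where xy: "x \<ge> 0" "y \<ge> 0" "\<sigma> a = \<gamma> x" "\<sigma> b = \<gamma> y" by auto
    show "\<sigma> ` {a..b} \<subseteq> nbhd (N K C) (\<gamma> ` {0..})"
    proof (rule image_subsetI)
      fix t assume t: "t \<in> {a..b}"
      show "\<sigma> t \<in> nbhd (N K C) (\<gamma> ` {0..})"
      proof (cases "x \<le> y")
        case True
        then show ?thesis using key[OF K _ xy(3,4) xy(1) _ t] * by blast
      next
        case False
        have "quasi_geodesic K C (-b) (-a) (\<lambda>t. \<sigma> (-t))" using qg_reverse * by blast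
        from key[OF K this _ _ xy(2), of x "-t"] False xy t show ?thesis by simp
      qed
    qed
  qed
  then show ?thesis using \<gamma> by (simp add: N_morse_rays_iff)
qed

lemma ray_rel_refl: "\<gamma> \<in> morse_rays e \<Longrightarrow> (\<gamma>, \<gamma>) \<in> ray_rel e"
proof -
  assume g: "\<gamma> \<in> morse_rays e"
  then have "\<gamma> ` {0..} \<subseteq> M" by (auto simp: morse_rays_def N_morse_rays_def geodesic_rays_def)
  then have "\<gamma> t \<in> nbhd 0 (\<gamma> ` {0..})" if "t \<ge> 0" for t using that by (auto simp: in_nbhd intro!: bexI[of _ t])
  then have "\<gamma> ` {0..} \<subseteq> nbhd 0 (\<gamma> ` {0..})" by auto
  then show ?thesis using g unfolding ray_rel_def by blast
qed

lemma ray_rel_equiv: "equiv (morse_rays e) (ray_rel e)"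
proof (rule equivI)
  show "ray_rel e \<subseteq> morse_rays e \<times> morse_rays e" by (auto simp: ray_rel_def)
  show "refl_on (morse_rays e) (ray_rel e)" using ray_rel_refl by (auto simp: refl_on_def ray_rel_def)
  show "sym (ray_rel e)" unfolding sym_def ray_rel_def by blast
  show "trans (ray_rel e)"
  proof (rule transI)
    fix x y z assume "(x, y) \<in> ray_rel e" "(y, z) \<in> ray_rel e"
    then obtain R R' where *: "x \<in> morse_rays e" "z \<in> morse_rays e" "x ` {0..} \<subseteq> nbhd R (y ` {0..})"
      "y ` {0..} \<subseteq> nbhd R (x ` {0..})"
      "y ` {0..} \<subseteq> nbhd R' (z ` {0..})" "z ` {0..} \<subseteq> nbhd R' (y ` {0..})" unfolding ray_rel_def by blast
    have "x ` {0..} \<subseteq> nbhd (R' + R) (z ` {0..})" "z ` {0..} \<subseteq> nbhd (R' + R) (x ` {0..})"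
      using asymptotic_trans[OF *(3,5)] asymptotic_trans[OF *(6,4)] by (simp_all add: add.commute)
    then show "(x, z) \<in> ray_rel e" using * unfolding ray_rel_def by blast
  qed
qed

lemma ray_relI:
  assumes "\<alpha> \<in> morse_rays e" "\<beta> \<in> morse_rays e" "\<alpha> ` {0..} \<subseteq> nbhd R (\<beta> ` {0..})"
  shows "(\<alpha>, \<beta>) \<in> ray_rel e"
proof -
  have "coarse_ray 0 \<alpha>" "coarse_ray 0 \<beta>" using assms geodesic_ray_coarse
    by (auto simp: morse_rays_def N_morse_rays_def)
  then obtain R' where "\<beta> ` {0..} \<subseteq> nbhd R' (\<alpha> ` {0..})" using asymptotic_sym[OF _ _ assms(3)] by blast
  then have "\<alpha> ` {0..} \<subseteq> nbhd (max R R') (\<beta> ` {0..})" "\<beta> ` {0..} \<subseteq> nbhd (max R R') (\<alpha> ` {0..})"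
    using assms(3) nbhd_mono[of R "max R R'" "\<beta> ` {0..}" "\<beta> ` {0..}"] nbhd_mono[of R' "max R R'" "\<alpha> ` {0..}"
      "\<alpha> ` {0..}"] by auto
  then show ?thesis using assms unfolding ray_rel_def by blast
qed

lemma close_rays_related:
  assumes "\<alpha> \<in> morse_rays e" "\<beta> \<in> morse_rays e" "\<And>t. t \<ge> 0 \<Longrightarrow> d (\<alpha> t) (\<beta> t) \<le> R"
  shows "(\<alpha>, \<beta>) \<in> ray_rel e"
proof (rule ray_relI[OF assms(1,2)])
  have "\<alpha> t \<in> M" "\<beta> t \<in> M" if "t \<ge> 0" for t using assms(1,2) that
    by (auto simp: morse_rays_def N_morse_rays_def geodesic_rays_def)
  then have "\<alpha> t \<in> nbhd R (\<beta> ` {0..})" if "t \<ge> 0" for t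
    using assms(3)[OF that] that by (auto simp: in_nbhd commute intro!: bexI[of _ t])
  then show "\<alpha> ` {0..} \<subseteq> nbhd R (\<beta> ` {0..})" by auto
qed

lemma limit_ray_from_base:
  assumes "locally_converges c \<gamma>" "\<And>i. quasi_geodesic 1 0 0 (L i) (c i)" "filterlim L at_top sequentially" 
    "\<gamma> \<in> {0..} \<rightarrow>\<^sub>E M" "\<And>i. c i 0 = e" "e \<in> M"
  shows "\<gamma> \<in> geodesic_rays e"
proof -
  have \<gamma>M: "\<gamma> ` {0..} \<subseteq> M" using assms(4) by auto
  have ray: "coarse_ray 0 \<gamma>" by (rule locally_converges_coarse_ray[OF assms(1,2,3) \<gamma>M])
  have g0: "\<gamma> 0 \<in> M" using \<gamma>M by auto
  have "d e (\<gamma> 0) \<le> 0 + \<epsilon>" if pos: "\<epsilon> > 0" for \<epsilon>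
  proof -
    obtain i0 where "\<And>i t. i \<ge> i0 \<Longrightarrow> t \<in> {0..0} \<Longrightarrow> d (c i t) (\<gamma> t) < \<epsilon>"
      using locally_convergesD[OF assms(1,3) pos, where T = 0] by metis
    then show ?thesis using assms(5)[of i0] by force
  qed
  then have "d e (\<gamma> 0) \<le> 0" by (rule field_le_epsilon)
  then have "\<gamma> 0 = e" using g0 assms(6) nonneg[of e "\<gamma> 0"] by (metis antisym zero)
  moreover have "d (\<gamma> s) (\<gamma> t) = \<bar>s - t\<bar>" if "s \<ge> 0" "t \<ge> 0" for s t using coarse_rayD(2,3)[OF ray that] by simp
  ultimately show ?thesis using assms(4) by (simp add: geodesic_rays_def)
qed

text \<open>By Arzela--Ascoli, geodesics from \<open>e\<close> to \<open>p i\<close>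
  have a limit. All other choices of geodesics from \<open>e\<close> to \<open>p i\<close> are
  uniformly close to these by stability, so their limits are in the same class.\<close>

lemma uniformly_morse_subconvergence:
  assumes geo: geodesic_space and pr: proper and N: "uniformly_morse N" and e: "e \<in> M"
    and p: "range p \<subseteq> M" and inf: "filterlim (\<lambda>i. d e (p i)) at_top sequentially"
  obtains r \<xi> where "strict_mono (r :: nat \<Rightarrow> nat)" "morse_converges e (\<lambda>i. p (r i)) \<xi>"
proof -
  have pm: "p i \<in> M" for i using p by blast
  have "\<exists>c. geodesic_segment c e (p i)" for i using geo e pm unfolding geodesic_space_def by blast
  then obtain c where c: "\<And>i. geodesic_segment (c i) e (p i)" by metis
  have cq: "quasi_geodesic 1 0 0 (d e (p i)) (c i)" and c0: "c i 0 = e" and cl: "c i (d e (p i)) = p i" for i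
    using segment_qg[OF c] c by (auto simp: geodesic_segment_def)
  have "d e (c i 0) \<le> 0" for i using c0 e by simp
  from arzela_ascoli[OF pr e cq inf this] obtain r \<gamma>
    where r: "strict_mono (r :: nat \<Rightarrow> nat)" "\<gamma> \<in> {0..} \<rightarrow>\<^sub>E M" "coarse_ray 0 \<gamma>"
    "locally_converges (\<lambda>i. c (r i)) \<gamma>" by metis
  have infr: "filterlim (\<lambda>i. d e (p (r i))) at_top sequentially"
    by (rule filterlim_compose[OF inf filterlim_subseq[OF r(1)]])
  have gr: "\<gamma> \<in> geodesic_rays e" by (rule limit_ray_from_base[OF r(4) cq infr r(2) c0 e])
  have gN: "gauge_fun N" using N by (simp add: uniformly_morse_def)
  have mor: "\<gamma> \<in> morse_rays e" if "\<gamma> \<in> geodesic_rays e" for \<gamma> using uniformly_morse_ray[OF N that] gN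
    by (auto simp: morse_rays_def)
  define \<xi> where "\<xi> = ray_rel e `` {\<gamma>}"
  have "morse_converges e (\<lambda>i. p (r i)) \<xi>"
    unfolding morse_converges_def
  proof (intro conjI allI impI ballI)
    show "range (\<lambda>i. p (r i)) \<subseteq> M" using pm by auto
    show "\<xi> \<in> morse_boundary e" using mor[OF gr] by (auto simp: \<xi>_def morse_boundary_def quotientI)
    show "filterlim (\<lambda>i. d e (p (r i))) at_top sequentially" by (rule infr)
    fix c' r' \<gamma>' assume \<gamma>': "\<gamma>' \<in> {0..} \<rightarrow>\<^sub>E M"
      and a: "(\<forall>i. geodesic_segment (c' i) e (p (r i))) \<and> strict_mono (r' :: nat \<Rightarrow> nat) \<and>
        (\<forall>T. \<forall>\<epsilon>>0. \<forall>\<^sub>F i in sequentially. \<forall>t\<in>{0..T}. d (c' (r' i) t) (\<gamma>' t) < \<epsilon>)"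
    have r': "strict_mono r'" using a by blast
    have lc': "locally_converges (\<lambda>i. c' (r' i)) \<gamma>'" unfolding locally_converges_def using a by blast
    have cq': "quasi_geodesic 1 0 0 (d e (p (r (r' i)))) (c' (r' i))" and c0': "c' (r' i) 0 = e"
      and cl': "c' (r' i) (d e (p (r (r' i)))) = p (r (r' i))" for i
      using segment_qg[of "c' (r' i)"] a by (auto simp: geodesic_segment_def)
    have infr': "filterlim (\<lambda>i. d e (p (r (r' i)))) at_top sequentially"
      by (rule filterlim_compose[OF infr filterlim_subseq[OF r']])
    have gr': "\<gamma>' \<in> geodesic_rays e" by (rule limit_ray_from_base[OF lc' cq' infr' \<gamma>' c0' e])
    have lc: "locally_converges (\<lambda>i. c (r (r' i))) \<gamma>" using locally_converges_subseq[OF r(4) r'] .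
    have "d (\<gamma> T) (\<gamma>' T) \<le> 2 * N 1 0 + 2" if T: "T \<ge> 0" for T
    proof -
      obtain i0 where i0: "\<And>i t. i \<ge> i0 \<Longrightarrow> t \<in> {0..T} \<Longrightarrow> d (c (r (r' i)) t) (\<gamma> t) < 1"
        "\<And>i. i \<ge> i0 \<Longrightarrow> T \<le> d e (p (r (r' i)))"
        using locally_convergesD[OF lc infr' zero_less_one, where T = T] by metis
      obtain i1 where i1: "\<And>i t. i \<ge> i1 \<Longrightarrow> t \<in> {0..T} \<Longrightarrow> d (c' (r' i) t) (\<gamma>' t) < 1"
        using locally_convergesD[OF lc' infr' zero_less_one, where T = T] by metis
      define i where "i = max i0 i1"
      define l where "l = d e (p (r (r' i)))"
      let ?c = "c (r (r' i))" and ?c' = "c' (r' i)"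
      have Tl: "T \<in> {0..l}" using i0(2)[of i] T by (simp add: i_def l_def)
      have q1: "quasi_geodesic 1 0 0 l ?c" and q2: "quasi_geodesic 1 0 0 l ?c'" using cq cq' by (simp_all add: l_def)
      obtain s where s: "s \<in> {0..l}" "d (?c T) (?c' s) \<le> N 1 0"
        by (rule uniformly_morseD[OF N order_refl order_refl q1 q2 _ _ Tl]) (use c0 c0' cl cl' in \<open>auto simp: l_def\<close>)
      have m: "?c T \<in> M" "?c' s \<in> M" "?c' T \<in> M" using qg_in[OF q1 Tl] qg_in[OF q2 s(1)] qg_in[OF q2 Tl] by auto
      have z: "0 \<in> {0..l}" by (simp add: l_def)
      have dT: "d e (?c T) = T" "d e (?c' s) = s"
        using qg_lower[OF q1 z Tl] qg_upper[OF q1 z Tl] qg_lower[OF q2 z s(1)] qg_upper[OF q2 z s(1)] c0 c0' T s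
          by auto
      have "\<bar>s - T\<bar> \<le> N 1 0" using dT s(2) triangle[OF e m(1,2)] triangle[OF e m(2,1)] by (simp add: commute)
      moreover have "d (?c' s) (?c' T) = \<bar>s - T\<bar>" using qg_lower[OF q2 s(1) Tl] qg_upper[OF q2 s(1) Tl] by simp
      ultimately have "d (?c T) (?c' T) \<le> 2 * N 1 0" using triangle[OF m] s(2) by simp
      moreover have "d (?c T) (\<gamma> T) < 1" "d (?c' T) (\<gamma>' T) < 1" using i0(1)[of i T] i1[of i T] T by (auto simp: i_def)
      moreover have "\<gamma> T \<in> M" "\<gamma>' T \<in> M" using gr gr' T by (auto simp: geodesic_rays_def)
      ultimately show ?thesis using triangle[of "\<gamma> T" "?c T" "\<gamma>' T"] triangle[of "?c T" "?c' T" "\<gamma>' T"] m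
        by (simp add: commute)
    qed
    then have "(\<gamma>, \<gamma>') \<in> ray_rel e" by (rule close_rays_related[OF mor[OF gr] mor[OF gr']])
    then show "\<gamma>' \<in> \<xi>" by (simp add: \<xi>_def)
  qed
  then show ?thesis using that[OF r(1)] by blast
qed

lemma N_morse_class_in_stratum:
  assumes "gauge_fun N" "\<gamma> \<in> N_morse_rays e N"
  shows "ray_rel e `` {\<gamma>} \<in> morse_stratum e N"
proof -
  have m: "\<gamma> \<in> morse_rays e" using assms by (auto simp: morse_rays_def)
  then show ?thesis using ray_rel_refl[OF m] assms(2) by (auto simp: morse_stratum_def morse_boundary_def quotientI)
qed

text \<open>The \<open>N\<close>-Morse rays of one class are at a uniform distance from each other, pointwise. If they came close to \<open>\<gamma>\<close>
  on all compact intervals, then \<open>\<gamma>\<close> would be in the class. So classes are closed in each stratum.\<close>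

lemma morse_classes_separated:
  assumes geo: geodesic_space and e: "e \<in> M" and N: "gauge_fun N" and \<gamma>: "\<gamma> \<in> N_morse_rays e N"
    and \<beta>0: "\<beta>0 \<in> N_morse_rays e N"
    and diff: "(\<gamma>, \<beta>0) \<notin> ray_rel e"
  obtains T where "\<And>\<beta>. \<beta> \<in> N_morse_rays e N \<Longrightarrow> (\<beta>, \<beta>0) \<in> ray_rel e \<Longrightarrow> \<exists>t\<in>{0..T}. d (\<gamma> t) (\<beta> t) \<ge> 1"
proof (rule ccontr)
  assume "\<not> thesis"
  with that have near: "\<exists>\<beta>. \<beta> \<in> N_morse_rays e N \<and> (\<beta>, \<beta>0) \<in> ray_rel e \<and> (\<forall>t\<in>{0..T}. d (\<gamma> t) (\<beta> t) < 1)" for T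
    by (meson not_le)
  define \<delta> where "\<delta> = max 0 (N 5 (2 * (1 + 0) + 2 * 0))"
  have geoR: "\<gamma> \<in> geodesic_rays e" "\<beta>0 \<in> geodesic_rays e" using \<gamma> \<beta>0 by (auto simp: N_morse_rays_def)
  have pt: "\<beta> t \<in> M" "d e (\<beta> t) = t" if "\<beta> \<in> geodesic_rays e" "t \<ge> 0" for \<beta> t
  proof -
    show "\<beta> t \<in> M" using that by (auto simp: geodesic_rays_def)
    have "d (\<beta> 0) (\<beta> t) = \<bar>0 - t\<bar>" "\<beta> 0 = e" using that unfolding geodesic_rays_def by blast+
    then show "d e (\<beta> t) = t" using that by simp
  qed
  have "d (\<gamma> T) (\<beta>0 T) \<le> 1 + 2 * \<delta>" if T: "T \<ge> 0" for T
  proof -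
    obtain \<beta> where \<beta>: "\<beta> \<in> N_morse_rays e N" "(\<beta>, \<beta>0) \<in> ray_rel e" "\<forall>t\<in>{0..T}. d (\<gamma> t) (\<beta> t) < 1" using near by blast
    have \<beta>g: "\<beta> \<in> geodesic_rays e" using \<beta>(1) by (auto simp: N_morse_rays_def)
    obtain R where R: "\<beta> ` {0..} \<subseteq> nbhd R (\<beta>0 ` {0..})" using \<beta>(2) by (auto simp: ray_rel_def)
    have "\<beta> 0 = e" "\<beta>0 0 = e" using \<beta>g geoR(2) by (auto simp: geodesic_rays_def)
    then have st: "\<beta> 0 \<in> nbhd 0 (\<beta>0 ` {0..})" using e by (auto simp: in_nbhd intro!: bexI[of _ 0])
    have "morse_set N (\<beta>0 ` {0..})" using \<beta>0 by (simp add: N_morse_rays_iff)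
    from asymptotic_uniform[OF geo geodesic_ray_coarse[OF \<beta>g] this st order_refl R]
    have "\<beta> T \<in> nbhd \<delta> (\<beta>0 ` {0..})" using T by (auto simp: \<delta>_def)
    then obtain s where s: "s \<ge> 0" "d (\<beta>0 s) (\<beta> T) \<le> \<delta>" by (auto simp: in_nbhd)
    note m = pt[OF geoR(2) s(1)] pt[OF \<beta>g T] pt[OF geoR(2) T] pt[OF geoR(1) T]
    have "\<bar>s - T\<bar> \<le> \<delta>" using triangle[OF e m(1,3)] triangle[OF e m(3,1)] m s(2) by (simp add: commute)
    moreover have "d (\<beta>0 s) (\<beta>0 T) = \<bar>s - T\<bar>" using geoR(2) s T by (simp add: geodesic_rays_def)
    ultimately have "d (\<beta> T) (\<beta>0 T) \<le> 2 * \<delta>" using triangle[OF m(3,1,5)] s(2) by (simp add: commute)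
    moreover have "d (\<gamma> T) (\<beta> T) < 1" using \<beta>(3) T by simp
    ultimately show ?thesis using triangle[OF m(7,3,5)] by simp
  qed
  moreover have "\<gamma> \<in> morse_rays e" "\<beta>0 \<in> morse_rays e" using \<gamma> \<beta>0 N by (auto simp: morse_rays_def)
  ultimately show False using close_rays_related diff by blast
qed

text \<open>If each stratum contained only finitely many \<open>\<xi> i\<close>, then those different from \<open>\<eta>\<close> would form a closed set: its
  intersection with each stratum is a finite union of closed classes. Its complement \<open>W\<close> is a neighbourhood of
  \<open>\<eta>\<close>, so almost all \<open>\<xi> i\<close> would be equal to \<open>\<eta>\<close>, and lie in a stratum of \<open>\<eta>\<close>.\<close>

lemma morse_limit_in_stratum:
  fixes \<xi> :: "nat \<Rightarrow> (real \<Rightarrow> 'a) set"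
  assumes geo: geodesic_space and e: "e \<in> M" and \<eta>: "\<eta> \<in> morse_boundary e"
    and conv: "\<And>U. openin (morse_topology e) U \<Longrightarrow> \<eta> \<in> U \<Longrightarrow> \<forall>\<^sub>F i in sequentially. \<xi> i \<in> U"
  obtains N where "gauge_fun N" "infinite {i. \<xi> i \<in> morse_stratum e N}"
proof (rule ccontr)
  assume "\<not> thesis"
  with that have fin: "finite {i. \<xi> i \<in> morse_stratum e N}" if "gauge_fun N" for N using \<open>gauge_fun N\<close> by blast
  obtain \<gamma>0 N0 where \<gamma>0: "\<eta> = ray_rel e `` {\<gamma>0}" "gauge_fun N0" "\<gamma>0 \<in> N_morse_rays e N0"
    using \<eta> by (auto simp: morse_boundary_def quotient_def morse_rays_def)
  have \<eta>0: "\<eta> \<in> morse_stratum e N0" using N_morse_class_in_stratum[OF \<gamma>0(2,3)] \<gamma>0(1) by simp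
  define W where "W = morse_boundary e - {\<xi> i | i. \<xi> i \<noteq> \<eta>}"
  have "openin (morse_topology e) W"
    unfolding openin_morse_topology
  proof (intro conjI allI impI)
    show "W \<subseteq> morse_boundary e" by (auto simp: W_def)
    fix N :: "real \<Rightarrow> real \<Rightarrow> real" assume N: "gauge_fun N"
    let ?P = "{\<gamma> \<in> N_morse_rays e N. ray_rel e `` {\<gamma>} \<in> W \<inter> morse_stratum e N}"
    show "openin (stratum_topology e N) (W \<inter> morse_stratum e N)"
      unfolding openin_stratum_topology openin_ray_topology
    proof (intro conjI ballI)
      show "W \<inter> morse_stratum e N \<subseteq> morse_stratum e N" by blast
      show "?P \<subseteq> N_morse_rays e N" by blast
      fix \<gamma> assume "\<gamma> \<in> ?P"
      then have \<gamma>: "\<gamma> \<in> N_morse_rays e N" "ray_rel e `` {\<gamma>} \<in> W" by auto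
      have \<gamma>m: "\<gamma> \<in> morse_rays e" using \<gamma> N by (auto simp: morse_rays_def)
      define F where "F = \<xi> ` {i. \<xi> i \<in> morse_stratum e N} - {\<eta>}"
      have F: "finite F" using fin[OF N] by (simp add: F_def)
      have "\<exists>T. \<forall>\<beta>\<in>N_morse_rays e N. ray_rel e `` {\<beta>} = c \<longrightarrow> (\<exists>t\<in>{0..T}. d (\<gamma> t) (\<beta> t) \<ge> 1)" if c: "c \<in> F" for c
      proof -
        obtain \<beta>0 where \<beta>0: "\<beta>0 \<in> c" "\<beta>0 \<in> N_morse_rays e N" "c \<in> morse_boundary e" using c
          by (auto simp: F_def morse_stratum_def)
        have \<beta>0m: "\<beta>0 \<in> morse_rays e" using \<beta>0 N by (auto simp: morse_rays_def)
        obtain \<omega> where \<omega>: "c = ray_rel e `` {\<omega>}" using \<beta>0(3) unfolding morse_boundary_def by (rule quotientE)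
        have ceq: "c = ray_rel e `` {\<beta>0}"
          unfolding \<omega> by (rule equiv_class_eq[OF ray_rel_equiv]) (use \<beta>0(1) \<omega> in blast)
        have "ray_rel e `` {\<gamma>} \<noteq> c" using \<gamma>(2) c by (auto simp: W_def F_def)
        then have "(\<gamma>, \<beta>0) \<notin> ray_rel e" using ceq equiv_class_eq[OF ray_rel_equiv, of \<gamma> \<beta>0] by blast
        then obtain T where T: "\<And>\<beta>. \<beta> \<in> N_morse_rays e N \<Longrightarrow> (\<beta>, \<beta>0) \<in> ray_rel e \<Longrightarrow> \<exists>t\<in>{0..T}. d (\<gamma> t) (\<beta> t) \<ge> 1"
          using morse_classes_separated[OF geo e N \<gamma>(1) \<beta>0(2)] by metis
        have "(\<beta>, \<beta>0) \<in> ray_rel e" if "ray_rel e `` {\<beta>} = c" for \<beta> using that \<beta>0(1) by blast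
        then show ?thesis using T by blast
      qed
      then obtain T0 where T0: "\<And>c \<beta>. c \<in> F \<Longrightarrow> \<beta> \<in> N_morse_rays e N \<Longrightarrow> ray_rel e `` {\<beta>} = c \<Longrightarrow> \<exists>t\<in>{0..T0 c}. d
        (\<gamma> t) (\<beta> t) \<ge> 1"
        by metis
      define T where "T = Max (insert 0 (T0 ` F))"
      have T: "T0 c \<le> T" if "c \<in> F" for c using that F by (simp add: T_def)
      have "{\<beta> \<in> N_morse_rays e N. \<forall>t\<in>{0..T}. d (\<gamma> t) (\<beta> t) < 1} \<subseteq> ?P"
      proof (rule subsetI)
        fix \<beta> assume "\<beta> \<in> {\<beta> \<in> N_morse_rays e N. \<forall>t\<in>{0..T}. d (\<gamma> t) (\<beta> t) < 1}"
        then have \<beta>: "\<beta> \<in> N_morse_rays e N" "\<forall>t\<in>{0..T}. d (\<gamma> t) (\<beta> t) < 1" by simp_all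
        have str: "ray_rel e `` {\<beta>} \<in> morse_stratum e N" by (rule N_morse_class_in_stratum[OF N \<beta>(1)])
        have "ray_rel e `` {\<beta>} \<notin> F"
        proof
          assume c: "ray_rel e `` {\<beta>} \<in> F"
          obtain t where "t \<in> {0..T0 (ray_rel e `` {\<beta>})}" "d (\<gamma> t) (\<beta> t) \<ge> 1" using T0[OF c \<beta>(1) refl] by blast
          then show False using \<beta>(2) T[OF c] by force
        qed
        moreover have "ray_rel e `` {\<beta>} \<in> F" if "ray_rel e `` {\<beta>} = \<xi> i" "\<xi> i \<noteq> \<eta>" for i
        proof -
          have "\<xi> i \<in> morse_stratum e N" using str that(1) by simp
          then have "\<xi> i \<in> F" using that(2) by (simp add: F_def)
          then show ?thesis using that(1) by simp
        qed
        moreover have "ray_rel e `` {\<beta>} \<in> morse_boundary e" using str by (simp add: morse_stratum_def)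
        ultimately have "ray_rel e `` {\<beta>} \<in> W" unfolding W_def by (intro DiffI) (simp_all, metis)
        then show "\<beta> \<in> ?P" using \<beta>(1) str by simp
      qed
      then show "\<exists>T. \<exists>\<epsilon>>0. {\<beta> \<in> N_morse_rays e N. \<forall>t\<in>{0..T}. d (\<gamma> t) (\<beta> t) < \<epsilon>} \<subseteq> ?P"
        by (intro exI[of _ T] exI[of _ 1]) simp
    qed
  qed
  moreover have "\<eta> \<in> W" using \<eta> by (auto simp: W_def)
  ultimately have "\<forall>\<^sub>F i in sequentially. \<xi> i \<in> W" by (rule conv)
  then have "\<forall>\<^sub>F i in sequentially. \<xi> i \<in> morse_stratum e N0" by (rule eventually_mono) (use \<eta>0 in \<open>auto simp: W_def\<close>)
  then obtain i0 where "{i0..} \<subseteq> {i. \<xi> i \<in> morse_stratum e N0}" by (auto simp: eventually_sequentially)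
  then have "finite {i0..}" using fin[OF \<gamma>0(2)] by (rule finite_subset)
  then show False using infinite_Ici[of i0] by blast
qed

text \<open>Under uniform stability the stratum of the gauge \<open>N\<close> is the whole boundary, so it is enough that the
  rays converge.\<close>

lemma boundary_limit:
  assumes N: "uniformly_morse N" and \<beta>: "\<And>i. \<beta> i \<in> geodesic_rays e" and \<beta>': "\<beta>' \<in> geodesic_rays e"
    and lim: "locally_converges \<beta> \<beta>'" and U: "openin (morse_topology e) U" "ray_rel e `` {\<beta>'} \<in> U"
  shows "\<forall>\<^sub>F i in sequentially. ray_rel e `` {\<beta> i} \<in> U"
proof -
  have gN: "gauge_fun N" using N by (simp add: uniformly_morse_def)
  note mor = uniformly_morse_ray[OF N]
  let ?P = "{\<gamma> \<in> N_morse_rays e N. ray_rel e `` {\<gamma>} \<in> U \<inter> morse_stratum e N}"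
  have "openin (stratum_topology e N) (U \<inter> morse_stratum e N)" using U(1) gN by (simp add: openin_morse_topology)
  then have op: "openin (ray_topology (N_morse_rays e N)) ?P" by (simp add: openin_stratum_topology)
  have "\<beta>' \<in> ?P" using mor[OF \<beta>'] U(2) N_morse_class_in_stratum[OF gN] by blast
  then obtain T \<epsilon> where T: "\<epsilon> > 0" "{\<gamma> \<in> N_morse_rays e N. \<forall>t\<in>{0..T}. d (\<beta>' t) (\<gamma> t) < \<epsilon>} \<subseteq> ?P"
    using op unfolding openin_ray_topology by blast
  have "\<forall>\<^sub>F i in sequentially. \<forall>t\<in>{0..T}. d (\<beta> i t) (\<beta>' t) < \<epsilon>" using lim T(1) by (simp add: locally_converges_def)
  then show ?thesis
  proof (rule eventually_mono)
    fix i assume "\<forall>t\<in>{0..T}. d (\<beta> i t) (\<beta>' t) < \<epsilon>"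
    then have "\<beta> i \<in> ?P" using T(2) mor[OF \<beta>[of i]] by (force simp: commute)
    then show "ray_rel e `` {\<beta> i} \<in> U" by blast
  qed
qed

lemma orbit_escapes:
  assumes ga: "geometric_action G \<phi>" and pr: proper and e: "e \<in> M" and y: "y \<in> M"
    and h: "range h \<subseteq> carrier G" and fin: "\<And>g. finite {j :: nat. h j = g}"
  shows "filterlim (\<lambda>j. d e (\<phi> (h j) y)) at_top sequentially"
  unfolding filterlim_at_top
proof
  fix Z :: real
  let ?F = "{g \<in> carrier G. d y (\<phi> g y) \<le> Z + d e y}"
  have "finite ?F" by (rule action_proper[OF ga pr y])
  then have "finite (\<Union>g\<in>?F. {j. h j = g})" using fin by blast
  moreover have "{j. \<not> Z \<le> d e (\<phi> (h j) y)} \<subseteq> (\<Union>g\<in>?F. {j. h j = g})"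
  proof clarify
    fix j assume j: "\<not> Z \<le> d e (\<phi> (h j) y)"
    have hj: "h j \<in> carrier G" using h by blast
    have "d y (\<phi> (h j) y) \<le> Z + d e y"
      using triangle[OF y e isometryD(1)[OF action_isometry[OF ga hj] y]] j by (simp add: commute)
    then show "j \<in> (\<Union>g\<in>?F. {j. h j = g})" using hj by blast
  qed
  ultimately have "finite {j. \<not> Z \<le> d e (\<phi> (h j) y)}" by (rule rev_finite_subset)
  then show "\<forall>\<^sub>F j in sequentially. Z \<le> d e (\<phi> (h j) y)"
    using eventually_cofinite[of "\<lambda>j. Z \<le> d e (\<phi> (h j) y)"] by (simp add: cofinite_eq_sequentially)
qed

section \<open>From flats to quasi-planes\<close>

lemma isolated_flats_flat: "isolated_flats G \<phi> \<Longrightarrow> \<exists>F. flat F"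
  unfolding isolated_flats_def
  by (elim conjE exE) (drule ex_in_conv[THEN iffD2], elim exE, rule exI, erule (1) bspec)

lemma flat_plane:
  assumes "flat F"
  obtains p :: "complex \<Rightarrow> 'a" where "range p \<subseteq> M" "\<And>u v. d (p u) (p v) = cmod (u - v)"
proof -
  obtain k f where k: "k \<ge> 2" and f: "f ` topspace (Euclidean_space k) = F" "F \<subseteq> M" and
     iso: "\<forall>u\<in>topspace (Euclidean_space k). \<forall>v\<in>topspace (Euclidean_space k). d (f u) (f v) = euclid_dist k u v"
    using assms unfolding flat_def by blast
  define j :: "complex \<Rightarrow> nat \<Rightarrow> real" where "j = (\<lambda>u i. if i = 0 then Re u else if i = 1 then Im u else 0)"
  have j: "j u \<in> topspace (Euclidean_space k)" for u using k by (auto simp: topspace_Euclidean_space j_def)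
  have dist: "euclid_dist k (j u) (j v) = cmod (u - v)" for u v
  proof -
    have "(\<Sum>i<k. (j u i - j v i)\<^sup>2) = (\<Sum>i\<in>{0, 1}. (j u i - j v i)\<^sup>2)"
      by (rule sum.mono_neutral_right) (use k in \<open>auto simp: j_def\<close>)
    also have "\<dots> = (Re (u - v))\<^sup>2 + (Im (u - v))\<^sup>2" by (simp add: j_def)
    finally show ?thesis by (simp add: euclid_dist_def L2_set_def cmod_def)
  qed
  show ?thesis
  proof (rule that[of "\<lambda>u. f (j u)"])
    show "range (\<lambda>u. f (j u)) \<subseteq> M" using j f by blast
    show "d (f (j u)) (f (j v)) = cmod (u - v)" for u v using iso j dist by metis
  qed
qed

end

text \<open>Send a point of the plane to the orbit point in \<open>X\<close> of a group element whose orbit point in \<open>Z\<close> is close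
  to it.\<close>

lemma transport_plane:
  assumes Z: "Metric_space Z dZ" "Metric_space.geodesic_space Z dZ" "Metric_space.proper Z dZ"
    "Metric_space.geometric_action Z dZ G \<theta>"
    and X: "Metric_space X dX" "Metric_space.geodesic_space X dX" "Metric_space.proper X dX"
      "Metric_space.geometric_action X dX G \<phi>"
    and p: "range p \<subseteq> Z" "\<And>u v. dZ (p u) (p v) = cmod (u - v)" and x: "x \<in> X"
  obtains K C q where "Metric_space.quasi_plane X dX K C q"
proof -
  interpret Z: Metric_space Z dZ by (rule Z(1))
  interpret X: Metric_space X dX by (rule X(1))
  interpret group G by (rule Z.action_group[OF Z(4)])
  have pm: "p u \<in> Z" for u using p by blast
  define z where "z = p 0"
  have z: "z \<in> Z" by (simp add: z_def pm)
  obtain R0 where R0: "R0 \<ge> 0" "\<And>w. w \<in> Z \<Longrightarrow> \<exists>g\<in>carrier G. dZ w (\<theta> g z) \<le> R0"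
    using Z.action_cobounded[OF Z(4) z] by blast
  have "\<exists>h. h \<in> carrier G \<and> dZ (p u) (\<theta> h z) \<le> R0" for u using R0(2)[OF pm] by blast
  then obtain g where g: "\<And>u. g u \<in> carrier G" "\<And>u. dZ (p u) (\<theta> (g u) z) \<le> R0" by metis
  have orbX: "\<phi> h x \<in> X" if "h \<in> carrier G" for h using X.isometryD(1)[OF X.action_isometry[OF X(4) that] x] .
  have orbZ: "\<theta> h z \<in> Z" if "h \<in> carrier G" for h using Z.isometryD(1)[OF Z.action_isometry[OF Z(4) that] z] .
  obtain A where A: "A \<ge> 0" "\<And>g h. g \<in> carrier G \<Longrightarrow> h \<in> carrier G \<Longrightarrow> dX (\<phi> g x) (\<phi> h x) \<le> A * dZ (\<theta> g z) (\<theta> h z) + A"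
  proof (rule Z.orbit_control[OF Z(2,3,4) z, of "\<lambda>g h. dX (\<phi> g x) (\<phi> h x)"])
    show "dX (\<phi> (g \<otimes>\<^bsub>G\<^esub> h) x) (\<phi> (g \<otimes>\<^bsub>G\<^esub> k) x) = dX (\<phi> h x) (\<phi> k x)"
      if "g \<in> carrier G" "h \<in> carrier G" "k \<in> carrier G" for g h k
      using X.action_mult[OF X(4) that(1,2) x] X.action_mult[OF X(4) that(1,3) x] X.isometryD(2)[OF
        X.action_isometry[OF X(4) that(1)] orbX orbX] that by simp
    show "dX (\<phi> g x) (\<phi> k x) \<le> dX (\<phi> g x) (\<phi> h x) + dX (\<phi> h x) (\<phi> k x)"
      if "g \<in> carrier G" "h \<in> carrier G" "k \<in> carrier G" for g h k by (rule X.triangle) (use orbX that in auto)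
  qed blast
  obtain B where B: "B \<ge> 0" "\<And>g h. g \<in> carrier G \<Longrightarrow> h \<in> carrier G \<Longrightarrow> dZ (\<theta> g z) (\<theta> h z) \<le> B * dX (\<phi> g x) (\<phi> h x) + B"
  proof (rule X.orbit_control[OF X(2,3,4) x, of "\<lambda>g h. dZ (\<theta> g z) (\<theta> h z)"])
    show "dZ (\<theta> (g \<otimes>\<^bsub>G\<^esub> h) z) (\<theta> (g \<otimes>\<^bsub>G\<^esub> k) z) = dZ (\<theta> h z) (\<theta> k z)"
      if "g \<in> carrier G" "h \<in> carrier G" "k \<in> carrier G" for g h k
      using Z.action_mult[OF Z(4) that(1,2) z] Z.action_mult[OF Z(4) that(1,3) z] Z.isometryD(2)[OF
        Z.action_isometry[OF Z(4) that(1)] orbZ orbZ] that by simp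
    show "dZ (\<theta> g z) (\<theta> k z) \<le> dZ (\<theta> g z) (\<theta> h z) + dZ (\<theta> h z) (\<theta> k z)"
      if "g \<in> carrier G" "h \<in> carrier G" "k \<in> carrier G" for g h k by (rule Z.triangle) (use orbZ that in auto)
  qed blast
  define K where "K = max 1 (max A B)"
  define C where "C = K * (2 * R0 + 1)"
  have K: "K \<ge> 1" "A \<le> K" "B \<le> K" "K \<ge> 0" by (auto simp: K_def)
  have C: "C \<ge> 0" "2 * R0 + 1 \<le> C" using K R0 mult_right_mono[OF K(1), of "2 * R0 + 1"] by (auto simp: C_def)
  have close: "\<bar>dZ (\<theta> (g u) z) (\<theta> (g v) z) - cmod (u - v)\<bar> \<le> 2 * R0" for u v
    using Z.triangle[OF pm[of u] orbZ[OF g(1)[of u]] pm[of v]] Z.triangle[OF orbZ[OF g(1)[of u]] orbZ[OF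
      g(1)[of v]] pm[of v]]
      Z.triangle[OF orbZ[OF g(1)[of u]] pm[of u] orbZ[OF g(1)[of v]]] Z.triangle[OF pm[of u] pm[of v]
        orbZ[OF g(1)[of v]]]
      g(2)[of u] g(2)[of v] p(2)[of u v] by (simp add: Z.commute abs_le_iff)
  have "X.quasi_plane K C (\<lambda>u. \<phi> (g u) x)"
    unfolding X.quasi_plane_def
  proof (intro conjI allI)
    show "1 \<le> K" "0 \<le> C" using K C by auto
    show "range (\<lambda>u. \<phi> (g u) x) \<subseteq> X" using orbX g by auto
    fix u v
    let ?x = "dX (\<phi> (g u) x) (\<phi> (g v) x)" and ?z = "dZ (\<theta> (g u) z) (\<theta> (g v) z)"
    have "?x \<le> A * ?z + A" by (rule A(2)[OF g(1) g(1)])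
    also have "\<dots> = A * (?z + 1)" by (simp add: algebra_simps)
    also have "\<dots> \<le> K * (?z + 1)" using K by (intro mult_right_mono) auto
    also have "\<dots> \<le> K * (cmod (u - v) + (2 * R0 + 1))" using K close[of u v] by (intro mult_left_mono) auto
    finally show "?x \<le> K * cmod (u - v) + C" by (simp add: C_def algebra_simps)
    have "cmod (u - v) \<le> ?z + 2 * R0" using close[of u v] by linarith
    also have "?z \<le> B * ?x + B" by (rule B(2)[OF g(1) g(1)])
    also have "B * ?x + B = B * (?x + 1)" by (simp add: algebra_simps)
    also have "\<dots> \<le> K * (?x + 1)" using K by (intro mult_right_mono) auto
    finally have "cmod (u - v) \<le> K * (?x + 1) + 1 * (2 * R0)" by simp
    also have "1 * (2 * R0) \<le> K * (2 * R0)" using K R0 by (intro mult_right_mono) auto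
    finally have "cmod (u - v) \<le> K * (?x + (2 * R0 + 1))" by (simp add: algebra_simps)
    then have "cmod (u - v) / K \<le> ?x + (2 * R0 + 1)" using K by (simp add: divide_le_eq mult.commute)
    then show "cmod (u - v) / K - C \<le> ?x" using C by simp
  qed
  then show ?thesis by (rule that)
qed

theorem proposition5p5:
  fixes G :: "'g monoid" and H :: "'g set"
    and Z :: "'z set" and dZ :: "'z \<Rightarrow> 'z \<Rightarrow> real" and \<theta> :: "'g \<Rightarrow> 'z \<Rightarrow> 'z"
    and X :: "'x set" and dX :: "'x \<Rightarrow> 'x \<Rightarrow> real" and \<phi> :: "'g \<Rightarrow> 'x \<Rightarrow> 'x"
    and Y :: "'y set" and dY :: "'y \<Rightarrow> 'y \<Rightarrow> real" and \<psi> :: "'g \<Rightarrow> 'y \<Rightarrow> 'y"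
    and eX x :: 'x and eY y :: 'y
  assumes "group G"
    \<comment> \<open>\<open>G\<close> is a CAT(0) group with isolated flats, as witnessed by its action on \<open>Z\<close>\<close>
    and "Metric_space Z dZ" "Metric_space.proper Z dZ" "Metric_space.cat0 Z dZ"
    and "Metric_space.geometric_action Z dZ G \<theta>"
    and "Metric_space.isolated_flats Z dZ G \<theta>"
    and "H \<lhd> G" "infinite H" "hyperbolic_group (G\<lparr>carrier := H\<rparr>)"
    \<comment> \<open>arbitrary spaces, basepoints and orbits for the Cannon--Thurston map of \<open>(H, G)\<close>\<close>
    and "Metric_space X dX" "Metric_space.proper X dX" "Metric_space.geodesic_space X dX"
    and "Metric_space.geometric_action X dX G \<phi>"
    and "Metric_space Y dY" "Metric_space.proper Y dY" "Metric_space.geodesic_space Y dY"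
    and "Metric_space.geometric_action Y dY (G\<lparr>carrier := H\<rparr>) \<psi>"
    and "eX \<in> X" "x \<in> X" "eY \<in> Y" "y \<in> Y"
  shows "\<not> (\<exists>f. cannon_thurston_map H Y dY \<psi> eY y X dX \<phi> eX x f)"
proof
  assume "\<exists>f. cannon_thurston_map H Y dY \<psi> eY y X dX \<phi> eX x f"
  then obtain f where ct: "cannon_thurston_map H Y dY \<psi> eY y X dX \<phi> eX x f" by blast
  note H = assms(7,8)
  note geoX = assms(12) and prX = assms(11) and gaX = assms(13)
  note geoY = assms(16) and prY = assms(15) and gaY = assms(17)
  note base = assms(18-21)
  interpret group G by (rule assms(1))
  interpret H: normal H G by (rule assms(7))
  interpret Z: Metric_space Z dZ by (rule assms(2))
  interpret X: Metric_space X dX by (rule assms(10))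
  interpret Y: Metric_space Y dY by (rule assms(14))
  have cont: "continuous_map (Y.morse_topology eY) (X.morse_topology eX) f"
    using ct unfolding cannon_thurston_map_def by (rule conjunct1)
  have "\<forall>h \<xi>. range h \<subseteq> H \<and> Y.morse_converges eY (\<lambda>i. \<psi> (h i) y) \<xi> \<longrightarrow> X.morse_converges eX (\<lambda>i. \<phi> (h i) x) (f \<xi>)"
    using ct unfolding cannon_thurston_map_def by (rule conjunct2)
  then have ctD: "X.morse_converges eX (\<lambda>i. \<phi> (h i) x) (f \<xi>)"
    if "range h \<subseteq> H" "Y.morse_converges eY (\<lambda>i. \<psi> (h i) y) \<xi>" for h \<xi>
    using that by simp
  note iso = X.action_isometry[OF gaX]

  obtain F where "Z.flat F" using Z.isolated_flats_flat[OF assms(6)] by blast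
  then obtain p :: "complex \<Rightarrow> 'z" where p: "range p \<subseteq> Z" "\<And>u v. dZ (p u) (p v) = cmod (u - v)"
    using Z.flat_plane by blast
  have geoZ: "Z.geodesic_space" using assms(4) by (simp add: Z.cat0_def)
  obtain K C q where q: "X.quasi_plane K C q"
    using transport_plane[OF assms(2) geoZ assms(3,5) assms(10) geoX prX gaX p base(2)] by blast
  have qm: "q u \<in> X" for u using q by (auto simp: X.quasi_plane_def)

  \<comment> \<open>Distinct elements of \<open>H\<close> subconverge in \<open>Y\<close>, hence, by the assumption on \<open>f\<close>, in \<open>X\<close>.\<close>
  obtain NY where NY: "Y.uniformly_morse NY"
    using Y.hyperbolic_action_uniformly_morse[OF geoY prY gaY assms(9) base(3)] by blast
  have sub: "\<exists>r \<xi>. strict_mono (r :: nat \<Rightarrow> nat) \<and> X.morse_converges eX (\<lambda>i. \<phi> (h (r i)) x) (f \<xi>) \<and> \<xi> \<in>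
    Y.morse_boundary eY"
    if h: "range h \<subseteq> H" "\<And>g. finite {j :: nat. h j = g}" for h
  proof -
    have hm: "\<psi> (h i) y \<in> Y" for i
      using Y.isometryD(1)[OF Y.action_isometry[OF gaY] base(4)] h(1) by (auto simp: image_subset_iff)
    have "filterlim (\<lambda>j. dY eY (\<psi> (h j) y)) at_top sequentially"
      by (rule Y.orbit_escapes[OF gaY prY base(3,4)]) (use h in auto)
    then obtain r \<xi> where r: "strict_mono (r :: nat \<Rightarrow> nat)" "Y.morse_converges eY (\<lambda>i. \<psi> (h (r i)) y) \<xi>"
      using Y.uniformly_morse_subconvergence[OF geoY prY NY base(3), of "\<lambda>i. \<psi> (h i) y"] hm by auto
    have "X.morse_converges eX (\<lambda>i. \<phi> (h (r i)) x) (f \<xi>)" by (rule ctD) (use h(1) r(2) in auto)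
    then show ?thesis using r by (auto simp: Y.morse_converges_def)
  qed

  \<comment> \<open>As \<open>H\<close> is infinite, this yields a point of the Morse boundary of \<open>X\<close>.\<close>
  obtain h0 :: "nat \<Rightarrow> 'g" where h0: "inj h0" "range h0 \<subseteq> H" using infinite_countable_subset[OF H(2)] by blast
  have "finite {j. h0 j = g}" for g
  proof -
    have "{j. h0 j = g} = h0 -` {g}" by auto
    then show ?thesis using finite_vimageI[OF _ h0(1), of "{g}"] by simp
  qed
  then obtain \<xi>0 where \<xi>0: "f \<xi>0 \<in> X.morse_boundary eX" using sub[OF h0(2)] by (auto simp: X.morse_converges_def)
  then obtain \<gamma> N where \<gamma>: "X.gauge_fun N" "\<gamma> \<in> X.N_morse_rays eX N"
    by (auto simp: X.morse_boundary_def quotient_def X.morse_rays_def)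
  have \<gamma>c: "X.coarse_ray 0 \<gamma>" using \<gamma>(2) X.geodesic_ray_coarse[of \<gamma> eX] by (simp add: X.N_morse_rays_iff)
  have \<gamma>N: "X.morse_set N (\<gamma> ` {0..})" using \<gamma>(2) by (simp add: X.N_morse_rays_iff)

  obtain u :: "nat \<Rightarrow> 'g" where u: "range u \<subseteq> H"
    and follow: "\<And>g x e'. g \<in> carrier G \<Longrightarrow> x \<in> X \<Longrightarrow> e' \<in> X \<Longrightarrow> \<exists>\<rho>1 \<rho>2. \<forall>i l c. X.quasi_geodesic 1 0 0 l c \<longrightarrow> c 0 = e' \<longrightarrow>
        c l = \<phi> (g \<otimes>\<^bsub>G\<^esub> u i \<otimes>\<^bsub>G\<^esub> inv\<^bsub>G\<^esub> g) x \<longrightarrow>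
        (\<exists>T\<in>{0..l}. real i - \<rho>2 \<le> T \<and> c ` {0..T} \<subseteq> X.nbhd \<rho>1 ((\<lambda>t. \<phi> g (\<gamma> t)) ` {0..}))"
    using X.conjugates_follow_translates[OF geoX prX gaX H q \<gamma>c \<gamma>N] by metis

  \<comment> \<open>The conjugates of the \<open>u j\<close> by \<open>g\<close> subconverge to some \<open>\<zeta>\<close> in \<open>Y\<close>. In \<open>X\<close> the geodesics to their
    orbit points follow \<open>g \<gamma>\<close> for longer and longer times, so that a limit \<open>\<alpha>\<close> of these, which represents
    \<open>f \<zeta>\<close>, is asymptotic to \<open>g \<gamma>\<close>.\<close>
  have hit: "\<exists>\<zeta> \<alpha> R. \<zeta> \<in> Y.morse_boundary eY \<and> f \<zeta> \<in> X.morse_boundary eX \<and> \<alpha> \<in> f \<zeta> \<and> \<alpha> \<in> X.geodesic_rays eX \<and> \<alpha> `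
    {0..} \<subseteq> X.nbhd R ((\<lambda>t. \<phi> g (\<gamma> t)) ` {0..})"
    if g: "g \<in> carrier G" for g
  proof -
    define v where "v = (\<lambda>j. g \<otimes>\<^bsub>G\<^esub> u j \<otimes>\<^bsub>G\<^esub> inv\<^bsub>G\<^esub> g)"
    have vH: "range v \<subseteq> H" using u H.inv_op_closed2[OF g] by (auto simp: v_def)
    have vx: "\<phi> (v j) x \<in> X" for j using X.isometryD(1)[OF iso base(2)] vH H.subset by blast
    obtain \<rho>1 \<rho>2 where \<rho>: "\<And>i l c. X.quasi_geodesic 1 0 0 l c \<Longrightarrow> c 0 = eX \<Longrightarrow> c l = \<phi> (v i) x \<Longrightarrow>
        \<exists>T\<in>{0..l}. real i - \<rho>2 \<le> T \<and> c ` {0..T} \<subseteq> X.nbhd \<rho>1 ((\<lambda>t. \<phi> g (\<gamma> t)) ` {0..})"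
      using follow[OF g base(2,1)] unfolding v_def by blast
    have "\<exists>c. X.geodesic_segment c eX (\<phi> (v j) x)" for j using geoX base(1) vx unfolding X.geodesic_space_def by blast
    then obtain c where c: "\<And>j. X.geodesic_segment (c j) eX (\<phi> (v j) x)" by metis
    have cq: "X.quasi_geodesic 1 0 0 (dX eX (\<phi> (v j) x)) (c j)" and c0: "c j 0 = eX"
      and cl: "c j (dX eX (\<phi> (v j) x)) = \<phi> (v j) x" for j
      using X.segment_qg[OF c] c by (auto simp: X.geodesic_segment_def)
    have T: "\<exists>T\<in>{0..dX eX (\<phi> (v j) x)}. real j - \<rho>2 \<le> T \<and> c j ` {0..T} \<subseteq> X.nbhd \<rho>1 ((\<lambda>t. \<phi> g (\<gamma> t)) ` {0..})" for j
      by (rule \<rho>[OF cq c0 cl])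
    have long: "real j - \<rho>2 \<le> dX eX (\<phi> (v j) x)" for j using T[of j] by force
    have "finite {j. v j = w}" for w
    proof (rule finite_subset)
      show "{j. v j = w} \<subseteq> {..nat \<lceil>\<rho>2 + dX eX (\<phi> w x)\<rceil>}"
      proof clarsimp
        fix j assume "w = v j"
        then have "real j \<le> \<rho>2 + dX eX (\<phi> (v j) x)" using long[of j] by simp
        then show "j \<le> nat \<lceil>\<rho>2 + dX eX (\<phi> (v j) x)\<rceil>" by linarith
      qed
    qed simp
    from sub[OF vH this] obtain r \<zeta> where r: "strict_mono (r :: nat \<Rightarrow> nat)"
      "X.morse_converges eX (\<lambda>i. \<phi> (v (r i)) x) (f \<zeta>)" "\<zeta> \<in> Y.morse_boundary eY" by blast
    have inf: "filterlim (\<lambda>i. dX eX (\<phi> (v (r i)) x)) at_top sequentially" using r(2)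
      by (simp add: X.morse_converges_def)
    have "dX eX (c (r i) 0) \<le> 0" for i using c0 base(1) by simp
    from X.arzela_ascoli[OF prX base(1) cq inf this] obtain r' \<alpha>
      where \<alpha>: "strict_mono (r' :: nat \<Rightarrow> nat)" "\<alpha> \<in> {0..} \<rightarrow>\<^sub>E X"
      "X.locally_converges (\<lambda>i. c (r (r' i))) \<alpha>" by metis
    have inf': "filterlim (\<lambda>i. dX eX (\<phi> (v (r (r' i))) x)) at_top sequentially"
      by (rule filterlim_compose[OF inf filterlim_subseq[OF \<alpha>(1)]])
    have \<alpha>g: "\<alpha> \<in> X.geodesic_rays eX" by (rule X.limit_ray_from_base[OF \<alpha>(3) cq inf' \<alpha>(2) c0 base(1)])
    have mc: "\<forall>c r. \<forall>\<gamma> \<in> {0..} \<rightarrow>\<^sub>E X. (\<forall>i. X.geodesic_segment (c i) eX (\<phi> (v (r0 i)) x)) \<and> strict_mono (r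
      :: nat \<Rightarrow> nat) \<and>
        (\<forall>T. \<forall>\<epsilon>>0. \<forall>\<^sub>F i in sequentially. \<forall>t\<in>{0..T}. dX (c (r i) t) (\<gamma> t) < \<epsilon>) \<longrightarrow> \<gamma> \<in> \<eta>"
      if "X.morse_converges eX (\<lambda>i. \<phi> (v (r0 i)) x) \<eta>" for r0 \<eta> using that unfolding X.morse_converges_def by blast
    have "\<alpha> \<in> f \<zeta>"
      by (rule mc[OF r(2), rule_format, of \<alpha> "\<lambda>i. c (r i)" r']) (use \<alpha> c in \<open>auto simp: X.locally_converges_def\<close>)
    moreover have "\<alpha> ` {0..} \<subseteq> X.nbhd (\<rho>1 + 1) ((\<lambda>t. \<phi> g (\<gamma> t)) ` {0..})"
    proof (rule image_subsetI)
      fix t :: real assume t: "t \<in> {0..}"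
      obtain i0 where i0: "\<And>i s. i \<ge> i0 \<Longrightarrow> s \<in> {0..t} \<Longrightarrow> dX (c (r (r' i)) s) (\<alpha> s) < 1"
        using X.locally_convergesD[OF \<alpha>(3) inf' zero_less_one, where T = t] by metis
      define i where "i = max i0 (nat \<lceil>t + \<rho>2\<rceil>)"
      have "i \<le> r (r' i)" using seq_suble[OF r(1), of "r' i"] seq_suble[OF \<alpha>(1), of i] by linarith
      then have "t \<le> real (r (r' i)) - \<rho>2" unfolding i_def by linarith
      then have "c (r (r' i)) t \<in> X.nbhd \<rho>1 ((\<lambda>t. \<phi> g (\<gamma> t)) ` {0..})" using T[of "r (r' i)"] t
        by (force simp: image_subset_iff)
      then obtain w where w: "w \<in> (\<lambda>t. \<phi> g (\<gamma> t)) ` {0..}" "w \<in> X" "c (r (r' i)) t \<in> X" "dX w (c (r (r' i)) t) \<le> \<rho>1"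
        by (auto simp: X.in_nbhd)
      have am: "\<alpha> t \<in> X" using \<alpha>(2) t by auto
      have "dX (c (r (r' i)) t) (\<alpha> t) < 1" using i0[of i t] t by (auto simp: i_def)
      then have "dX w (\<alpha> t) \<le> \<rho>1 + 1" using X.triangle[OF w(2,3) am] w(4) by simp
      then show "\<alpha> t \<in> X.nbhd (\<rho>1 + 1) ((\<lambda>t. \<phi> g (\<gamma> t)) ` {0..})" using w am by (auto simp: X.in_nbhd)
    qed
    ultimately show ?thesis using r \<alpha>g by (auto simp: X.morse_converges_def)
  qed

  \<comment> \<open>The elements \<open>g n\<close> bring far points of the quasi-plane back to the basepoint.\<close>
  obtain R0 where R0: "R0 \<ge> 0" "\<And>w. w \<in> X \<Longrightarrow> \<exists>g\<in>carrier G. dX w (\<phi> g eX) \<le> R0"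
    using X.action_cobounded[OF gaX base(1)] by blast
  have "\<exists>g. g \<in> carrier G \<and> dX (\<phi> g (q (of_nat n))) eX \<le> R0" for n :: nat
  proof -
    obtain h where h: "h \<in> carrier G" "dX (q (of_nat n)) (\<phi> h eX) \<le> R0" using R0(2)[OF qm] by blast
    have hi: "inv\<^bsub>G\<^esub> h \<in> carrier G" using h by simp
    have "dX (\<phi> (inv\<^bsub>G\<^esub> h) (q (of_nat n))) (\<phi> (inv\<^bsub>G\<^esub> h) (\<phi> h eX)) = dX (q (of_nat n)) (\<phi> h eX)"
      by (rule X.isometryD(2)[OF iso[OF hi] qm X.isometryD(1)[OF iso[OF h(1)] base(1)]])
    then show ?thesis using h hi X.action_inv(1)[OF gaX h(1) base(1)] by auto
  qed
  then obtain g where g: "\<And>n :: nat. g n \<in> carrier G" "\<And>n. dX (\<phi> (g n) (q (of_nat n))) eX \<le> R0" by metis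
  have "\<exists>\<zeta> \<alpha> R. \<zeta> \<in> Y.morse_boundary eY \<and> f \<zeta> \<in> X.morse_boundary eX \<and> \<alpha> \<in> f \<zeta> \<and> \<alpha> \<in> X.geodesic_rays eX \<and> \<alpha> ` {0..} \<subseteq>
    X.nbhd R ((\<lambda>t. \<phi> (g n) (\<gamma> t)) ` {0..})" for n
    by (rule hit[OF g(1)])
  then obtain \<zeta> \<alpha> R where \<zeta>: "\<And>n. \<zeta> n \<in> Y.morse_boundary eY" "\<And>n. f (\<zeta> n) \<in> X.morse_boundary eX" "\<And>n. \<alpha> n \<in> f (\<zeta> n)"
    "\<And>n. \<alpha> n \<in> X.geodesic_rays eX"
    "\<And>n. \<alpha> n ` {0..} \<subseteq> X.nbhd (R n) ((\<lambda>t. \<phi> (g n) (\<gamma> t)) ` {0..})" by metis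

  \<comment> \<open>Rays that represent the \<open>\<zeta> n\<close> subconverge in \<open>Y\<close>; continuity carries this to \<open>X\<close>, where it
    provides one gauge for infinitely many \<open>f (\<zeta> n)\<close>.\<close>
  have "\<exists>\<beta>. \<beta> \<in> Y.geodesic_rays eY \<and> \<zeta> n = Y.ray_rel eY `` {\<beta>}" for n
    using \<zeta>(1)[of n] by (auto simp: Y.morse_boundary_def quotient_def Y.morse_rays_def Y.N_morse_rays_def)
  then obtain \<beta> where \<beta>: "\<And>n. \<beta> n \<in> Y.geodesic_rays eY" "\<And>n. \<zeta> n = Y.ray_rel eY `` {\<beta> n}" by metis
  have \<beta>q: "Y.quasi_geodesic 1 0 0 (real n) (\<beta> n)" for n
    by (rule Y.coarse_ray_qg[OF Y.geodesic_ray_coarse[OF \<beta>(1)]]) auto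
  have \<beta>0: "\<beta> n 0 = eY" for n using \<beta>(1)[of n] by (auto simp: Y.geodesic_rays_def)
  have "dY eY (\<beta> n 0) \<le> 0" for n using \<beta>0 base(3) by simp
  from Y.arzela_ascoli[OF prY base(3) \<beta>q filterlim_real_sequentially this] obtain r \<beta>'
    where r: "strict_mono (r :: nat \<Rightarrow> nat)"
     "\<beta>' \<in> {0..} \<rightarrow>\<^sub>E Y" "Y.locally_converges (\<lambda>i. \<beta> (r i)) \<beta>'" by metis
  have \<beta>'g: "\<beta>' \<in> Y.geodesic_rays eY"
    by (rule Y.limit_ray_from_base[OF r(3) \<beta>q filterlim_compose[OF filterlim_real_sequentially filterlim_subseq[OF
      r(1)]] r(2) \<beta>0 base(3)])
  define \<zeta>' where "\<zeta>' = Y.ray_rel eY `` {\<beta>'}"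
  have \<zeta>': "\<zeta>' \<in> Y.morse_boundary eY"
    using Y.N_morse_class_in_stratum[of NY \<beta>' eY] Y.uniformly_morse_ray[OF NY \<beta>'g] NY
    by (auto simp: \<zeta>'_def Y.morse_stratum_def Y.uniformly_morse_def)
  have lim: "\<forall>\<^sub>F i in sequentially. f (\<zeta> (r i)) \<in> U" if U: "openin (X.morse_topology eX) U" "f \<zeta>' \<in> U" for U
  proof -
    let ?V = "{\<xi> \<in> topspace (Y.morse_topology eY). f \<xi> \<in> U}"
    have "openin (Y.morse_topology eY) ?V" using cont U(1) by (simp add: openin_continuous_map_preimage)
    moreover have "Y.ray_rel eY `` {\<beta>'} \<in> ?V" using \<zeta>' U(2) by (simp add: Y.topspace_morse_topology \<zeta>'_def)
    ultimately have "\<forall>\<^sub>F i in sequentially. Y.ray_rel eY `` {\<beta> (r i)} \<in> ?V"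
      by (rule Y.boundary_limit[OF NY \<beta>(1) \<beta>'g r(3)])
    then show ?thesis by (rule eventually_mono) (simp add: \<beta>(2))
  qed
  have f\<zeta>': "f \<zeta>' \<in> X.morse_boundary eX"
    using cont \<zeta>' by (auto simp: continuous_map_def Y.topspace_morse_topology X.topspace_morse_topology)
  obtain N' where N': "X.gauge_fun N'" "infinite {i. f (\<zeta> (r i)) \<in> X.morse_stratum eX N'}"
    using X.morse_limit_in_stratum[OF geoX base(1) f\<zeta>' lim] by blast

  \<comment> \<open>The translate \<open>g n \<gamma>\<close> is asymptotic to \<open>\<alpha> n\<close>, hence to the Morse ray \<open>\<alpha>'\<close> of that gauge in the same class.\<close>
  obtain D where D: "\<And>u \<phi> \<alpha> R'. X.isometry \<phi> \<Longrightarrow> X.coarse_ray 0 \<alpha> \<Longrightarrow> X.morse_set N' (\<alpha> ` {0..}) \<Longrightarrow> \<phi> (q u) \<in> X.nbhd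
    R0 (\<alpha> ` {0..})
     \<Longrightarrow> (\<lambda>t. \<phi> (\<gamma> t)) ` {0..} \<subseteq> X.nbhd R' (\<alpha> ` {0..}) \<Longrightarrow> cmod u \<le> D"
    using X.flat_translates_not_uniformly_morse[OF geoX q \<gamma>c \<gamma>N R0(1), where N = N' and ?C1.0 = 0] by metis
  have "real i \<le> D" if i: "f (\<zeta> (r i)) \<in> X.morse_stratum eX N'" for i
  proof -
    define n where "n = r i"
    obtain \<alpha>' where \<alpha>': "\<alpha>' \<in> f (\<zeta> n)" "\<alpha>' \<in> X.N_morse_rays eX N'" using i by (auto simp: X.morse_stratum_def n_def)
    have \<alpha>'g: "\<alpha>' \<in> X.geodesic_rays eX" "X.morse_set N' (\<alpha>' ` {0..})" using \<alpha>'(2) by (auto simp: X.N_morse_rays_iff)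
    have "(\<alpha> n, \<alpha>') \<in> X.ray_rel eX"
      using quotient_eq_iff[OF X.ray_rel_equiv \<zeta>(2)[of n, unfolded X.morse_boundary_def] \<zeta>(2)[of n, unfolded
        X.morse_boundary_def] \<zeta>(3) \<alpha>'(1)] by blast
    then obtain R1 where R1: "\<alpha> n ` {0..} \<subseteq> X.nbhd R1 (\<alpha>' ` {0..})" unfolding X.ray_rel_def by blast
    have gc: "X.coarse_ray 0 (\<lambda>t. \<phi> (g n) (\<gamma> t))" by (rule X.isometry_coarse_ray[OF iso[OF g(1)] \<gamma>c])
    obtain R2 where R2: "(\<lambda>t. \<phi> (g n) (\<gamma> t)) ` {0..} \<subseteq> X.nbhd R2 (\<alpha> n ` {0..})"
      using X.asymptotic_sym[OF X.geodesic_ray_coarse[OF \<zeta>(4)] gc \<zeta>(5)] by blast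
    have near: "\<phi> (g n) (q (of_nat n)) \<in> X.nbhd R0 (\<alpha>' ` {0..})"
    proof -
      have "\<alpha>' 0 = eX" using \<alpha>'g(1) by (simp add: X.geodesic_rays_def)
      then have "eX \<in> \<alpha>' ` {0..}" by (metis atLeast_iff imageI order_refl)
      then show ?thesis using g(2)[of n] base(1) X.isometryD(1)[OF iso[OF g(1)] qm]
        by (auto simp: X.in_nbhd X.commute)
    qed
    have "cmod (of_nat n) \<le> D"
      by (rule D[OF iso[OF g(1)[of n]] X.geodesic_ray_coarse[OF \<alpha>'g(1)] \<alpha>'g(2) near X.asymptotic_trans[OF R2 R1]])
    then have "real n \<le> D" by simp
    moreover have "i \<le> n" unfolding n_def by (rule seq_suble[OF r(1)])
    ultimately show ?thesis by linarith
  qed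
  then have "i \<le> nat \<lceil>D\<rceil>" if "f (\<zeta> (r i)) \<in> X.morse_stratum eX N'" for i using that
    by (meson le_of_int_ceiling nat_ceiling_le_eq of_nat_le_iff order_trans real_nat_ceiling_ge)
  then have "{i. f (\<zeta> (r i)) \<in> X.morse_stratum eX N'} \<subseteq> {..nat \<lceil>D\<rceil>}" by blast
  then show False using N'(2) finite_subset by blast
qed

end
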